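(* For all partitions $\lambda,\mu$, \[ {}_{[\boldsymbol\alpha,\boldsymbol\beta]}\langle\mu|\lambda\rangle_{[\boldsymbol\alpha,\boldsymbol\beta]}={}^{[\boldsymbol\alpha,\boldsymbol\beta]}\langle\mu|\lambda\rangle^{[\boldsymbol\alpha,\boldsymbol\beta]}=\delta_{\lambda\mu}. \]
   Context: Alphabets: an alphabet is a formal $\mathbb{Z}$-linear combination $Z=\sum_i c_iz_i$ of variables; $p_k(Z)=\sum_i c_iz_i^k$. Parameters $\boldsymbol\alpha=(\alpha_1,\alpha_2,\dots)$, $\boldsymbol\beta=(\beta_1,\beta_2,\dots)$; $A_k=(-\alpha_1)+\dots+(-\alpha_k)$ for $k\ge1$, $A_k=0$ for $k\le 0$. Free fermions: $\mathcal{A}$ is the unital associative algebra generated by $\psi_n,\psi_n^*$ ($n\in\mathbb{Z}$) with $\psi_m\psi_n+\psi_n\psi_m=\psi^*_m\psi^*_n+\psi^*_n\psi^*_m=0$, $\psi_m\psi_n^*+\psi_n^*\psi_m=\delta_{m,n}$; $*$ is the anti-algebra involution with $\psi_n\leftrightarrow\psi_n^*$. Fock space $\mathcal{F}=\mathcal{A}|0\rangle$ with $\psi_n|0\rangle=\psi_m^*|0\rangle=0$ for $n<0\le m$; dual $\mathcal{F}^*=\langle0|\mathcal{A}$ with $\langle0|\psi_m=\langle0|\psi_n^*=0$ for $n<0\le m$; the pairing $\langle w|v\rangle$ is the unique bilinear map with $\langle0|0\rangle=1$ and $(\langle w|X)|v\rangle=\langle w|(X|v\rangle)$; $*:\mathcal{F}\to\mathcal{F}^*$,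 $X|0\rangle\mapsto\langle0|X^*$. Shifted vacua: $|m\rangle=\psi_{m-1}\cdots\psi_0|0\rangle$ ($m\ge0$), $|m\rangle=\psi_m^*\cdots\psi_{-1}^*|0\rangle$ ($m<0$). Currents $a_k=\sum_{i}{:}\psi_i\psi_{i+k}^*{:}$ with ${:}\psi_i\psi^*_{i+k}{:}=\psi_i\psi^*_{i+k}$ for $i\le0$ and $-\psi^*_{i+k}\psi_i$ for $i>0$; $a_k^*=a_{-k}$. $H(X)=\sum_{k>0}\frac{p_k(X)}{k}a_k$, $H^*(X)=\sum_{k>0}\frac{p_k(X)}{k}a_{-k}$; all expressions are formal power series in the parameters. $H(\beta_i)$ denotes the single-variable alphabet $\beta_i$. For a partition $\lambda$ and $\ell\ge\ell(\lambda)$ (the vectors are independent of $\ell$; $\prod^{\rightarrow}$ means the factors are ordered with $i$ increasing from left to right): $|\lambda\rangle_{[\boldsymbol\alpha,\boldsymbol\beta]}=\prod^{\rightarrow}_{1\le i\le\ell}\bigl(e^{-H(A_{\lambda_i-1})}\psi_{\lambda_i-i}e^{H(\beta_i)}e^{H(A_{\lambda_i-1})}\bigr)|-\ell\rangle$, $|\lambda\rangle^{[\boldsymbol\alpha,\boldsymbol\beta]}=\prod^{\rightarrow}_{1\le i\le\ell}\bigl(e^{H^*(A_{\lambda_i})}\psi_{\lambda_i-i}e^{-H^*(\beta_i)}e^{-H^*(A_{\lambda_i})}\bigr)e^{H^*(A_{\lambda_\ell})}|-\ell\rangle$, ${}^{[\boldsymbol\alpha,\boldsymbol\beta]}\langle\mu|=(|\mu\rangle_{[\boldsymbol\alpha,\boldsymbol\beta]})^*$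 and ${}_{[\boldsymbol\alpha,\boldsymbol\beta]}\langle\mu|=(|\mu\rangle^{[\boldsymbol\alpha,\boldsymbol\beta]})^*$.
   Formalization: The vectors |λ⟩^{[α,β]} (and their duals) are taken with ℓ>ℓ(λ) instead of ℓ≥ℓ(λ): at ℓ=ℓ(λ) the printed formula gives a different vector and the claim fails, e.g. μ=(1), ℓ=1, λ=(1,1) gives pairing −α_1. *)

theory Defs
  imports Complex_Main "HOL-Library.Poly_Mapping"
begin

section \<open>The algebra of free fermions\<close>

datatype generator = Psi int | PsiStar int

text \<open>
  Words in the generators form the free monoid, written additively, so that the finitely supported
  functions on words (with the convolution product of \<^theory>\<open>HOL-Library.Poly_Mapping\<close>)
  are the free unital associative algebra on the generators.
\<close>

datatype fword = FWord (letters: "generator list")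

instantiation fword :: monoid_add
begin

definition zero_fword :: fword where
  "zero_fword = FWord []"

definition plus_fword :: "fword \<Rightarrow> fword \<Rightarrow> fword" where
  "plus_fword u v = FWord (letters u @ letters v)"

instance
  by standard (simp_all add: zero_fword_def plus_fword_def)

end

type_synonym 'k free_alg = "fword \<Rightarrow>\<^sub>0 'k"

definition free_gen :: "generator \<Rightarrow> 'k::field_char_0 free_alg" where
  "free_gen g = Poly_Mapping.single (FWord [g]) 1"

definition free_scalar :: "'k::field_char_0 \<Rightarrow> 'k free_alg" where
  "free_scalar c = Poly_Mapping.single 0 c"

definition anticomm :: "'a::ring \<Rightarrow> 'a \<Rightarrow> 'a" where
  "anticomm x y = x * y + y * x"

text \<open>The two-sided ideal generated by the canonical anticommutation relations.\<close>

inductive_set car_ideal :: "'k::field_char_0 free_alg set" where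
  psi_psi: "anticomm (free_gen (Psi m)) (free_gen (Psi n)) \<in> car_ideal"
| star_star: "anticomm (free_gen (PsiStar m)) (free_gen (PsiStar n)) \<in> car_ideal"
| psi_star: "anticomm (free_gen (Psi m)) (free_gen (PsiStar n)) - of_bool (m = n) \<in> car_ideal"
| zero: "0 \<in> car_ideal"
| add: "x \<in> car_ideal \<Longrightarrow> y \<in> car_ideal \<Longrightarrow> x + y \<in> car_ideal"
| mult: "x \<in> car_ideal \<Longrightarrow> a * x * b \<in> car_ideal"

lemma car_ideal_left: "x \<in> car_ideal \<Longrightarrow> a * x \<in> car_ideal"
  using car_ideal.mult[of x a 1] by simp

lemma car_ideal_right: "x \<in> car_ideal \<Longrightarrow> x * b \<in> car_ideal"
  using car_ideal.mult[of x 1 b] by simp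

lemma car_ideal_uminus: "x \<in> car_ideal \<Longrightarrow> - x \<in> car_ideal"
  using car_ideal_left[of x "- 1"] by simp

definition car_rel :: "'k::field_char_0 free_alg \<Rightarrow> 'k free_alg \<Rightarrow> bool" where
  "car_rel x y \<longleftrightarrow> x - y \<in> car_ideal"

lemma car_rel_refl: "car_rel x x"
  by (simp add: car_rel_def car_ideal.zero)

lemma car_rel_add: "car_rel x x' \<Longrightarrow> car_rel y y' \<Longrightarrow> car_rel (x + y) (x' + y')"
  using car_ideal.add[of "x - x'" "y - y'"] by (simp add: car_rel_def add_diff_add)

lemma car_rel_uminus: "car_rel x x' \<Longrightarrow> car_rel (- x) (- x')"
  using car_ideal_uminus[of "x - x'"] by (simp add: car_rel_def)

lemma car_rel_diff: "car_rel x x' \<Longrightarrow> car_rel y y' \<Longrightarrow> car_rel (x - y) (x' - y')"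
  using car_rel_add[OF _ car_rel_uminus, of x x' y y'] by simp

lemma equivp_car_rel: "equivp car_rel"
proof (rule equivpI)
  show "reflp car_rel"
    by (rule reflpI) (simp add: car_rel_def car_ideal.zero)
  show "symp car_rel"
    by (rule sympI) (use car_ideal_uminus in \<open>force simp: car_rel_def\<close>)
  show "transp car_rel"
    by (rule transpI) (use car_ideal.add in \<open>force simp: car_rel_def\<close>)
qed

quotient_type (overloaded) 'k fermion = "'k::field_char_0 free_alg" / car_rel
  by (rule equivp_car_rel)

instantiation fermion :: (field_char_0) "{ring, monoid_mult}"
begin

lift_definition zero_fermion :: "'a fermion" is 0 .

lift_definition one_fermion :: "'a fermion" is 1 .

lift_definition plus_fermion :: "'a fermion \<Rightarrow> 'a fermion \<Rightarrow> 'a fermion" is "(+)"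
  by (rule car_rel_add)

lift_definition uminus_fermion :: "'a fermion \<Rightarrow> 'a fermion" is uminus
  by (rule car_rel_uminus)

lift_definition minus_fermion :: "'a fermion \<Rightarrow> 'a fermion \<Rightarrow> 'a fermion" is "(-)"
  by (rule car_rel_diff)

lift_definition times_fermion :: "'a fermion \<Rightarrow> 'a fermion \<Rightarrow> 'a fermion" is "(*)"
proof -
  fix x x' y y' :: "'a free_alg"
  assume "car_rel x x'" "car_rel y y'"
  then have "(x - x') * y + x' * (y - y') \<in> car_ideal"
    unfolding car_rel_def by (intro car_ideal.add car_ideal_left car_ideal_right)
  then show "car_rel (x * y) (x' * y')"
    by (simp add: car_rel_def algebra_simps)
qed

instance
proof
  fix a b c :: "'a fermion"
  show "a + b + c = a + (b + c)"
    by transfer (simp only: add.assoc car_rel_refl)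
  show "a + b = b + a"
    by transfer (simp only: add.commute car_rel_refl)
  show "0 + a = a"
    by transfer (simp only: add_0 car_rel_refl)
  show "- a + a = 0"
    by transfer (simp only: left_minus car_rel_refl)
  show "a - b = a + - b"
    by transfer (simp only: diff_conv_add_uminus car_rel_refl)
  show "a * b * c = a * (b * c)"
    by transfer (simp only: mult.assoc car_rel_refl)
  show "(a + b) * c = a * c + b * c"
    by transfer (simp only: distrib_right car_rel_refl)
  show "a * (b + c) = a * b + a * c"
    by transfer (simp only: distrib_left car_rel_refl)
  show "1 * a = a"
    by transfer (simp only: mult_1_left car_rel_refl)
  show "a * 1 = a"
    by transfer (simp only: mult_1_right car_rel_refl)
qed

end

lift_definition scalar :: "'k::field_char_0 \<Rightarrow> 'k fermion" is free_scalar .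

lift_definition psi :: "int \<Rightarrow> 'k::field_char_0 fermion" is "\<lambda>n. free_gen (Psi n)" .

lift_definition psi_star :: "int \<Rightarrow> 'k::field_char_0 fermion" is "\<lambda>n. free_gen (PsiStar n)" .

lemma anticomm_psi_psi: "anticomm (psi m) (psi n) = 0"
  unfolding anticomm_def
proof transfer
  fix m n
  show "car_rel (free_gen (Psi m) * free_gen (Psi n) + free_gen (Psi n) * free_gen (Psi m))
      (0 :: 'a free_alg)"
    using car_ideal.psi_psi[of m n] unfolding car_rel_def anticomm_def diff_0_right .
qed

lemma anticomm_star_star: "anticomm (psi_star m) (psi_star n) = 0"
  unfolding anticomm_def
proof transfer
  fix m n
  show "car_rel (free_gen (PsiStar m) * free_gen (PsiStar n) + free_gen (PsiStar n) * free_gen (PsiStar m))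
      (0 :: 'a free_alg)"
    using car_ideal.star_star[of m n] unfolding car_rel_def anticomm_def diff_0_right .
qed

lemma anticomm_psi_star: "anticomm (psi m) (psi_star n) = (if m = n then 1 else 0)"
  unfolding anticomm_def
proof transfer
  fix m n
  have "free_gen (Psi m) * free_gen (PsiStar n) + free_gen (PsiStar n) * free_gen (Psi m)
      - of_bool (m = n) \<in> (car_ideal :: 'a free_alg set)"
    using car_ideal.psi_star[of m n] unfolding anticomm_def .
  then show "car_rel (free_gen (Psi m) * free_gen (PsiStar n) + free_gen (PsiStar n) * free_gen (Psi m))
      (if m = n then 1 else (0 :: 'a free_alg))"
    unfolding car_rel_def of_bool_def .
qed


subsection \<open>The anti-involution\<close>

fun swap_gen :: "generator \<Rightarrow> generator" where
  "swap_gen (Psi n) = PsiStar n"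
| "swap_gen (PsiStar n) = Psi n"

definition word_star :: "fword \<Rightarrow> fword" where
  "word_star w = FWord (rev (map swap_gen (letters w)))"

definition free_star :: "'k::field_char_0 free_alg \<Rightarrow> 'k free_alg" where
  "free_star x = (\<Sum>w\<in>Poly_Mapping.keys x. Poly_Mapping.single (word_star w) (Poly_Mapping.lookup x w))"

lemma word_star_plus: "word_star (u + v) = word_star v + word_star u"
  by (simp add: word_star_def plus_fword_def)

lemma word_star_zero: "word_star 0 = 0"
  by (simp add: word_star_def zero_fword_def)

lemma free_star_superset:
  assumes "finite S" "Poly_Mapping.keys x \<subseteq> S"
  shows "free_star x = (\<Sum>w\<in>S. Poly_Mapping.single (word_star w) (Poly_Mapping.lookup x w))"
  unfolding free_star_def
  by (rule sum.mono_neutral_left) (use assms in \<open>auto simp: in_keys_iff\<close>)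

lemma free_star_zero: "free_star 0 = 0"
  by (simp add: free_star_def)

lemma free_star_add: "free_star (x + y) = free_star x + free_star y"
proof -
  let ?S = "Poly_Mapping.keys x \<union> Poly_Mapping.keys y"
  have "finite ?S" "Poly_Mapping.keys (x + y) \<subseteq> ?S"
    by (simp_all add: Poly_Mapping.keys_add)
  then show ?thesis
    by (simp add: free_star_superset[of ?S] lookup_add single_add sum.distrib)
qed

lemma free_star_single:
  "free_star (Poly_Mapping.single w c) = Poly_Mapping.single (word_star w) c"
  by (cases "c = 0") (simp_all add: free_star_def)

lemma free_star_sum: "free_star (sum f I) = (\<Sum>i\<in>I. free_star (f i))"
  by (induction I rule: infinite_finite_induct) (simp_all add: free_star_zero free_star_add)

lemma free_alg_sum_singles:
  "x = (\<Sum>w\<in>Poly_Mapping.keys x. Poly_Mapping.single w (Poly_Mapping.lookup x w))"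
proof (rule poly_mapping_eqI)
  fix u
  have "(\<Sum>w\<in>Poly_Mapping.keys x. Poly_Mapping.lookup (Poly_Mapping.single w (Poly_Mapping.lookup x w)) u)
      = (\<Sum>w\<in>Poly_Mapping.keys x. if w = u then Poly_Mapping.lookup x w else 0)"
    by (rule sum.cong) (simp_all add: lookup_single when_def)
  also have "\<dots> = Poly_Mapping.lookup x u"
    by (simp add: in_keys_iff)
  finally show "Poly_Mapping.lookup x u = Poly_Mapping.lookup
      (\<Sum>w\<in>Poly_Mapping.keys x. Poly_Mapping.single w (Poly_Mapping.lookup x w)) u"
    by (simp add: lookup_sum)
qed

lemma free_star_mult: "free_star (x * y) = free_star y * free_star x"
proof -
  have "x * y = (\<Sum>u\<in>Poly_Mapping.keys x. \<Sum>v\<in>Poly_Mapping.keys y.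
      Poly_Mapping.single (u + v) (Poly_Mapping.lookup x u * Poly_Mapping.lookup y v))"
    using arg_cong2[OF free_alg_sum_singles[of x] free_alg_sum_singles[of y], of "(*)"]
    by (simp only: sum_product mult_single)
  then have "free_star (x * y) = (\<Sum>u\<in>Poly_Mapping.keys x. \<Sum>v\<in>Poly_Mapping.keys y.
      Poly_Mapping.single (word_star v + word_star u)
        (Poly_Mapping.lookup y v * Poly_Mapping.lookup x u))"
    by (simp add: free_star_sum free_star_single word_star_plus mult.commute)
  also have "\<dots> = free_star y * free_star x"
    by (subst sum.swap) (simp add: free_star_def sum_product mult_single)
  finally show ?thesis .
qed

lemma free_star_diff: "free_star (x - y) = free_star x - free_star y"
  using free_star_add[of "x - y" y] by (simp add: algebra_simps)

lemma free_star_gen: "free_star (free_gen g) = free_gen (swap_gen g)"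
  by (simp add: free_gen_def free_star_single word_star_def)

lemma free_star_of_bool: "free_star (of_bool b) = of_bool b"
proof (cases b)
  case True
  have "free_star (Poly_Mapping.single 0 1) = (Poly_Mapping.single 0 1 :: 'a free_alg)"
    unfolding free_star_single by (simp only: word_star_zero)
  with True show ?thesis
    by simp
qed (simp add: free_star_zero)

lemma free_star_anticomm:
  "free_star (anticomm x y) = anticomm (free_star x) (free_star y)"
  by (simp add: anticomm_def free_star_add free_star_mult add.commute)

lemma free_star_car_ideal: "x \<in> car_ideal \<Longrightarrow> free_star x \<in> car_ideal"
proof (induction rule: car_ideal.induct)
  case (psi_star m n)
  have "free_star (anticomm (free_gen (Psi m)) (free_gen (PsiStar n)) - of_bool (m = n))
      = anticomm (free_gen (Psi n)) (free_gen (PsiStar m)) - (of_bool (n = m) :: 'a free_alg)"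
    unfolding free_star_diff free_star_of_bool free_star_anticomm free_star_gen swap_gen.simps
    by (simp add: anticomm_def add.commute eq_commute)
  then show ?case
    using car_ideal.psi_star[of n m] by simp
next
  case (mult x a b)
  then show ?case
    unfolding free_star_mult using car_ideal.mult[of "free_star x" "free_star b" "free_star a"]
    by (simp only: mult.assoc)
qed (simp_all add: free_star_add free_star_zero free_star_anticomm free_star_gen
    car_ideal.psi_psi car_ideal.star_star car_ideal.zero car_ideal.add)

lift_definition star :: "'k::field_char_0 fermion \<Rightarrow> 'k fermion" is free_star
  unfolding car_rel_def free_star_diff [symmetric] by (rule free_star_car_ideal)

lemma star_psi: "star (psi n) = psi_star n"
  by transfer (simp add: free_star_gen car_rel_def car_ideal.zero)

lemma star_psi_star: "star (psi_star n) = psi n"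
  by transfer (simp add: free_star_gen car_rel_def car_ideal.zero)

lemma star_add: "star (x + y) = star x + star y"
  by transfer (simp add: free_star_add car_rel_def car_ideal.zero)

lemma star_diff: "star (x - y) = star x - star y"
  by transfer (simp add: free_star_diff car_rel_def car_ideal.zero)

lemma star_mult: "star (x * y) = star y * star x"
  by transfer (simp add: free_star_mult car_rel_def car_ideal.zero)

lemma star_scalar: "star (scalar c) = scalar c"
  by transfer
    (simp add: free_scalar_def free_star_single word_star_zero car_rel_def car_ideal.zero)


section \<open>Fock space, its dual, and the pairing\<close>

text \<open>
  The cyclic modules \<open>\<A>|0\<rangle>\<close> and \<open>\<langle>0|\<A>\<close> are the quotients of the algebra by the left, respectively right,
  ideal generated by the elements that annihilate the vacuum.
\<close>

inductive_set vac_left_ideal :: "'k::field_char_0 fermion set" where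
  psi: "n < 0 \<Longrightarrow> psi n \<in> vac_left_ideal"
| psi_star: "0 \<le> m \<Longrightarrow> psi_star m \<in> vac_left_ideal"
| zero: "0 \<in> vac_left_ideal"
| add: "x \<in> vac_left_ideal \<Longrightarrow> y \<in> vac_left_ideal \<Longrightarrow> x + y \<in> vac_left_ideal"
| mult: "x \<in> vac_left_ideal \<Longrightarrow> a * x \<in> vac_left_ideal"

inductive_set vac_right_ideal :: "'k::field_char_0 fermion set" where
  psi: "0 \<le> m \<Longrightarrow> psi m \<in> vac_right_ideal"
| psi_star: "n < 0 \<Longrightarrow> psi_star n \<in> vac_right_ideal"
| zero: "0 \<in> vac_right_ideal"
| add: "x \<in> vac_right_ideal \<Longrightarrow> y \<in> vac_right_ideal \<Longrightarrow> x + y \<in> vac_right_ideal"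
| mult: "x \<in> vac_right_ideal \<Longrightarrow> x * a \<in> vac_right_ideal"

lemma vac_left_ideal_uminus: "x \<in> vac_left_ideal \<Longrightarrow> - x \<in> vac_left_ideal"
  using vac_left_ideal.mult[of x "- 1"] by simp

lemma vac_right_ideal_uminus: "x \<in> vac_right_ideal \<Longrightarrow> - x \<in> vac_right_ideal"
  using vac_right_ideal.mult[of x "- 1"] by simp

definition fock_rel :: "'k::field_char_0 fermion \<Rightarrow> 'k fermion \<Rightarrow> bool" where
  "fock_rel x y \<longleftrightarrow> x - y \<in> vac_left_ideal"

definition dual_fock_rel :: "'k::field_char_0 fermion \<Rightarrow> 'k fermion \<Rightarrow> bool" where
  "dual_fock_rel x y \<longleftrightarrow> x - y \<in> vac_right_ideal"

lemma fock_rel_add: "fock_rel x x' \<Longrightarrow> fock_rel y y' \<Longrightarrow> fock_rel (x + y) (x' + y')"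
  using vac_left_ideal.add[of "x - x'" "y - y'"] by (simp add: fock_rel_def add_diff_add)

lemma fock_rel_uminus: "fock_rel x x' \<Longrightarrow> fock_rel (- x) (- x')"
  using vac_left_ideal_uminus[of "x - x'"] by (simp add: fock_rel_def)

lemma fock_rel_diff: "fock_rel x x' \<Longrightarrow> fock_rel y y' \<Longrightarrow> fock_rel (x - y) (x' - y')"
  using fock_rel_add[OF _ fock_rel_uminus, of x x' y y'] by simp

lemma equivp_fock_rel: "equivp fock_rel"
proof (rule equivpI)
  show "reflp fock_rel"
    by (rule reflpI) (simp add: fock_rel_def vac_left_ideal.zero)
  show "symp fock_rel"
    by (rule sympI) (use vac_left_ideal_uminus in \<open>force simp: fock_rel_def\<close>)
  show "transp fock_rel"
    by (rule transpI) (use vac_left_ideal.add in \<open>force simp: fock_rel_def\<close>)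
qed

lemma dual_fock_rel_add: "dual_fock_rel x x' \<Longrightarrow> dual_fock_rel y y' \<Longrightarrow> dual_fock_rel (x + y) (x' + y')"
  using vac_right_ideal.add[of "x - x'" "y - y'"] by (simp add: dual_fock_rel_def add_diff_add)

lemma dual_fock_rel_uminus: "dual_fock_rel x x' \<Longrightarrow> dual_fock_rel (- x) (- x')"
  using vac_right_ideal_uminus[of "x - x'"] by (simp add: dual_fock_rel_def)

lemma dual_fock_rel_diff: "dual_fock_rel x x' \<Longrightarrow> dual_fock_rel y y' \<Longrightarrow> dual_fock_rel (x - y) (x' - y')"
  using dual_fock_rel_add[OF _ dual_fock_rel_uminus, of x x' y y'] by simp

lemma equivp_dual_fock_rel: "equivp dual_fock_rel"
proof (rule equivpI)
  show "reflp dual_fock_rel"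
    by (rule reflpI) (simp add: dual_fock_rel_def vac_right_ideal.zero)
  show "symp dual_fock_rel"
    by (rule sympI) (use vac_right_ideal_uminus in \<open>force simp: dual_fock_rel_def\<close>)
  show "transp dual_fock_rel"
    by (rule transpI) (use vac_right_ideal.add in \<open>force simp: dual_fock_rel_def\<close>)
qed

quotient_type (overloaded) 'k fock = "'k::field_char_0 fermion" / fock_rel
  by (rule equivp_fock_rel)

quotient_type (overloaded) 'k dual_fock = "'k::field_char_0 fermion" / dual_fock_rel
  by (rule equivp_dual_fock_rel)

instantiation fock :: (field_char_0) ab_group_add
begin

lift_definition zero_fock :: "'a fock" is 0 .

lift_definition plus_fock :: "'a fock \<Rightarrow> 'a fock \<Rightarrow> 'a fock" is "(+)"
  by (rule fock_rel_add)

lift_definition uminus_fock :: "'a fock \<Rightarrow> 'a fock" is uminus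
  by (rule fock_rel_uminus)

lift_definition minus_fock :: "'a fock \<Rightarrow> 'a fock \<Rightarrow> 'a fock" is "(-)"
  by (rule fock_rel_diff)

instance
  by standard (transfer, simp add: fock_rel_def vac_left_ideal.zero algebra_simps)+

end

instantiation dual_fock :: (field_char_0) ab_group_add
begin

lift_definition zero_dual_fock :: "'a dual_fock" is 0 .

lift_definition plus_dual_fock :: "'a dual_fock \<Rightarrow> 'a dual_fock \<Rightarrow> 'a dual_fock" is "(+)"
  by (rule dual_fock_rel_add)

lift_definition uminus_dual_fock :: "'a dual_fock \<Rightarrow> 'a dual_fock" is uminus
  by (rule dual_fock_rel_uminus)

lift_definition minus_dual_fock :: "'a dual_fock \<Rightarrow> 'a dual_fock \<Rightarrow> 'a dual_fock" is "(-)"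
  by (rule dual_fock_rel_diff)

instance
  by standard (transfer, simp add: dual_fock_rel_def vac_right_ideal.zero algebra_simps)+

end

lifting_forget fermion.lifting

lift_definition vac :: "'k::field_char_0 fock" is 1 .

lift_definition dual_vac :: "'k::field_char_0 dual_fock" is 1 .

lift_definition act :: "'k::field_char_0 fermion \<Rightarrow> 'k fock \<Rightarrow> 'k fock" is "(*)"
  unfolding fock_rel_def right_diff_distrib [symmetric] by (rule vac_left_ideal.mult)

lift_definition dual_act :: "'k::field_char_0 dual_fock \<Rightarrow> 'k fermion \<Rightarrow> 'k dual_fock" is "(*)"
  unfolding dual_fock_rel_def left_diff_distrib [symmetric] by (rule vac_right_ideal.mult)

lemma star_vac_left_ideal: "x \<in> vac_left_ideal \<Longrightarrow> star x \<in> vac_right_ideal"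
proof (induction rule: vac_left_ideal.induct)
  case zero
  show ?case
    using star_diff[of 0 "0 :: 'a fermion"] by (simp add: vac_right_ideal.zero)
qed (auto simp: star_psi star_psi_star star_add star_mult intro: vac_right_ideal.intros)

lift_definition fock_star :: "'k::field_char_0 fock \<Rightarrow> 'k dual_fock" is star
  unfolding fock_rel_def dual_fock_rel_def star_diff [symmetric] by (rule star_vac_left_ideal)

lemma fock_star_act_vac: "fock_star (act X vac) = dual_act dual_vac (star X)"
  by transfer (simp add: dual_fock_rel_def vac_right_ideal.zero)

lemma act_vac_eq_0:
  "n < 0 \<Longrightarrow> act (psi n) vac = 0" "0 \<le> m \<Longrightarrow> act (psi_star m) vac = 0"
  by (transfer, simp add: fock_rel_def vac_left_ideal.psi vac_left_ideal.psi_star)+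

lemma dual_vac_act_eq_0:
  "0 \<le> m \<Longrightarrow> dual_act dual_vac (psi m) = 0" "n < 0 \<Longrightarrow> dual_act dual_vac (psi_star n) = 0"
  by (transfer, simp add: dual_fock_rel_def vac_right_ideal.psi vac_right_ideal.psi_star)+

definition fock_scale :: "'k::field_char_0 \<Rightarrow> 'k fock \<Rightarrow> 'k fock" where
  "fock_scale c v = act (scalar c) v"

definition dual_fock_scale :: "'k::field_char_0 \<Rightarrow> 'k dual_fock \<Rightarrow> 'k dual_fock" where
  "dual_fock_scale c w = dual_act w (scalar c)"

definition is_fock_pairing :: "('k::field_char_0 dual_fock \<Rightarrow> 'k fock \<Rightarrow> 'k) \<Rightarrow> bool" where
  "is_fock_pairing P \<longleftrightarrow>
     (\<forall>w w' v. P (w + w') v = P w v + P w' v) \<and>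
     (\<forall>w v v'. P w (v + v') = P w v + P w v') \<and>
     (\<forall>c w v. P (dual_fock_scale c w) v = c * P w v) \<and>
     (\<forall>c w v. P w (fock_scale c v) = c * P w v) \<and>
     P dual_vac vac = 1 \<and>
     (\<forall>w X v. P (dual_act w X) v = P w (act X v))"

definition pairing :: "'k::field_char_0 dual_fock \<Rightarrow> 'k fock \<Rightarrow> 'k" where
  "pairing = (THE P. is_fock_pairing P)"

definition shifted_vac :: "int \<Rightarrow> 'k::field_char_0 fock" where
  "shifted_vac m =
     (if 0 \<le> m then foldr (\<lambda>i. act (psi i)) (rev [0..m - 1]) vac
      else foldr (\<lambda>i. act (psi_star i)) [m..- 1] vac)"

text \<open>
  The case distinction in the normal ordering only matters for \<open>k = 0\<close>, since the two factors
  anticommute otherwise.  For \<open>k \<noteq> 0\<close> all but finitely many terms of the sum defining the current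
  vanish on a given vector; the current with \<open>k = 0\<close> is never used.
\<close>

definition normal_ordered :: "int \<Rightarrow> int \<Rightarrow> 'k::field_char_0 fermion" where
  "normal_ordered i k =
     (if i \<le> 0 then psi i * psi_star (i + k) else - (psi_star (i + k) * psi i))"

definition current :: "int \<Rightarrow> 'k::field_char_0 fock \<Rightarrow> 'k fock" where
  "current k v = Sum_any (\<lambda>i. act (normal_ordered i k) v)"


section \<open>Parameters, alphabets and formal power series\<close>

text \<open>
  The parameters are \<open>\<alpha>\<^sub>i\<close> and \<open>\<beta>\<^sub>i\<close> with \<open>i \<ge> 1\<close>; the index \<open>0\<close> is never used.  Monomials are finitely
  supported exponent vectors.  A formal power series with coefficients in \<open>'v\<close> is an arbitrary function
  on monomials, a polynomial is a finitely supported one.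
\<close>

datatype param = Alpha nat | Beta nat

type_synonym monom = "param \<Rightarrow>\<^sub>0 nat"

type_synonym 'k ppoly = "monom \<Rightarrow>\<^sub>0 'k"

type_synonym 'v pseries = "monom \<Rightarrow> 'v"

definition var :: "param \<Rightarrow> 'k::field_char_0 ppoly" where
  "var p = Poly_Mapping.single (Poly_Mapping.single p 1) 1"

type_synonym 'k alphabet = "'k ppoly \<Rightarrow>\<^sub>0 int"

definition letter :: "'k::field_char_0 ppoly \<Rightarrow> 'k alphabet" where
  "letter z = Poly_Mapping.single z 1"

definition power_sum :: "nat \<Rightarrow> 'k::field_char_0 alphabet \<Rightarrow> 'k ppoly" where
  "power_sum k Z = (\<Sum>z\<in>Poly_Mapping.keys Z. of_int (Poly_Mapping.lookup Z z) * z ^ k)"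

text \<open>
  The letters of \<open>A\<^sub>k\<close> are the variables \<open>-\<alpha>\<^sub>i\<close> with multiplicity one, so its power sums are
  \<open>\<Sum>\<^sub>i (-\<alpha>\<^sub>i)\<^sup>r\<close> and not \<open>-\<Sum>\<^sub>i \<alpha>\<^sub>i\<^sup>r\<close>.
\<close>

definition A_alph :: "int \<Rightarrow> 'k::field_char_0 alphabet" where
  "A_alph k = (\<Sum>i = 1..nat k. letter (- var (Alpha i)))"

definition B_alph :: "nat \<Rightarrow> 'k::field_char_0 alphabet" where
  "B_alph i = letter (var (Beta i))"

definition splits :: "monom \<Rightarrow> (monom \<times> monom) set" where
  "splits m = {(a, b). a + b = m}"

definition series_of :: "'v::zero \<Rightarrow> 'v pseries" where
  "series_of v = (\<lambda>m. if m = 0 then v else 0)"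

definition series_sum :: "('i \<Rightarrow> 'v::comm_monoid_add pseries) \<Rightarrow> 'v pseries" where
  "series_sum f = (\<lambda>m. Sum_any (\<lambda>i. f i m))"

definition series_uminus :: "'v::ab_group_add pseries \<Rightarrow> 'v pseries" where
  "series_uminus v = (\<lambda>m. - v m)"

definition series_scale :: "'k::field_char_0 \<Rightarrow> 'k fock pseries \<Rightarrow> 'k fock pseries" where
  "series_scale c v = (\<lambda>m. fock_scale c (v m))"

definition series_act :: "'k::field_char_0 fermion \<Rightarrow> 'k fock pseries \<Rightarrow> 'k fock pseries" where
  "series_act X v = (\<lambda>m. act X (v m))"

definition series_mult :: "'k::field_char_0 ppoly \<Rightarrow> 'k fock pseries \<Rightarrow> 'k fock pseries" where
  "series_mult f v = (\<lambda>m. \<Sum>(a, b)\<in>splits m. fock_scale (Poly_Mapping.lookup f a) (v b))"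

definition series_current :: "int \<Rightarrow> 'k::field_char_0 fock pseries \<Rightarrow> 'k fock pseries" where
  "series_current k v = (\<lambda>m. current k (v m))"

definition series_star :: "'k::field_char_0 fock pseries \<Rightarrow> 'k dual_fock pseries" where
  "series_star v = (\<lambda>m. fock_star (v m))"

definition series_pairing ::
    "'k::field_char_0 dual_fock pseries \<Rightarrow> 'k fock pseries \<Rightarrow> 'k pseries" where
  "series_pairing w v = (\<lambda>m. \<Sum>(a, b)\<in>splits m. pairing (w a) (v b))"


section \<open>Vertex operators and the vectors attached to partitions\<close>

definition H :: "'k::field_char_0 alphabet \<Rightarrow> 'k fock pseries \<Rightarrow> 'k fock pseries" where
  "H X v = series_sum (\<lambda>k::nat. if k = 0 then (\<lambda>m. 0)
     else series_scale (1 / of_nat k) (series_mult (power_sum k X) (series_current (int k) v)))"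

definition H_star :: "'k::field_char_0 alphabet \<Rightarrow> 'k fock pseries \<Rightarrow> 'k fock pseries" where
  "H_star X v = series_sum (\<lambda>k::nat. if k = 0 then (\<lambda>m. 0)
     else series_scale (1 / of_nat k) (series_mult (power_sum k X) (series_current (- int k) v)))"

definition exp_op ::
    "('k::field_char_0 fock pseries \<Rightarrow> 'k fock pseries) \<Rightarrow> 'k fock pseries \<Rightarrow> 'k fock pseries" where
  "exp_op T v = series_sum (\<lambda>n::nat. series_scale (1 / fact n) ((T ^^ n) v))"

definition neg_op :: "('v \<Rightarrow> 'w::ab_group_add pseries) \<Rightarrow> 'v \<Rightarrow> 'w pseries" where
  "neg_op T v = series_uminus (T v)"

definition is_partition :: "nat list \<Rightarrow> bool" where
  "is_partition lam \<longleftrightarrow> sorted_wrt (\<ge>) lam \<and> 0 \<notin> set lam"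

definition part :: "nat list \<Rightarrow> nat \<Rightarrow> nat" where
  "part lam i = (if 1 \<le> i \<and> i \<le> length lam then lam ! (i - 1) else 0)"

definition lower_factor ::
    "nat list \<Rightarrow> nat \<Rightarrow> 'k::field_char_0 fock pseries \<Rightarrow> 'k fock pseries" where
  "lower_factor lam i =
     exp_op (neg_op (H (A_alph (int (part lam i) - 1)))) \<circ>
     series_act (psi (int (part lam i) - int i)) \<circ>
     exp_op (H (B_alph i)) \<circ>
     exp_op (H (A_alph (int (part lam i) - 1)))"

definition upper_factor ::
    "nat list \<Rightarrow> nat \<Rightarrow> 'k::field_char_0 fock pseries \<Rightarrow> 'k fock pseries" where
  "upper_factor lam i =
     exp_op (H_star (A_alph (int (part lam i)))) \<circ>
     series_act (psi (int (part lam i) - int i)) \<circ>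
     exp_op (neg_op (H_star (B_alph i))) \<circ>
     exp_op (neg_op (H_star (A_alph (int (part lam i)))))"

definition ket_lower :: "nat \<Rightarrow> nat list \<Rightarrow> 'k::field_char_0 fock pseries" where
  "ket_lower l lam = foldr (lower_factor lam) [1..<Suc l] (series_of (shifted_vac (- int l)))"

text \<open>
  \<open>ket_upper l lam\<close> is independent of \<open>l\<close> in the range \<open>l > length lam\<close>, where the rightmost exponential
  is the identity.  At \<open>l = length lam > 0\<close> it is a different vector: for \<open>lam = [1]\<close> and \<open>\<beta> = 0\<close>, the
  coefficient of \<open>|(1,1)\<rangle>\<close> is \<open>-\<alpha>\<^sub>1\<close> for \<open>l = 1\<close> and \<open>0\<close> for \<open>l > 1\<close>.
\<close>

definition ket_upper :: "nat \<Rightarrow> nat list \<Rightarrow> 'k::field_char_0 fock pseries" where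
  "ket_upper l lam = foldr (upper_factor lam) [1..<Suc l]
     (exp_op (H_star (A_alph (int (part lam l)))) (series_of (shifted_vac (- int l))))"

definition bra_upper :: "nat \<Rightarrow> nat list \<Rightarrow> 'k::field_char_0 dual_fock pseries" where
  "bra_upper l mu = series_star (ket_lower l mu)"

definition bra_lower :: "nat \<Rightarrow> nat list \<Rightarrow> 'k::field_char_0 dual_fock pseries" where
  "bra_lower l mu = series_star (ket_upper l mu)"

end

theory Submission
  imports Defs "HOL-Library.FSet"
begin

text \<open>
  Work in the ring of formal power series in the parameters with coefficients in the linear
  endomorphisms of Fock space.  For an alphabet with power sums \<open>p\<^sub>k\<close>, the exponential \<open>E = e\<^bsup>H\<^esup>\<close> is the
  unique solution with constant term \<open>1\<close> of \<open>D E = (\<Sum>\<^sub>k p\<^sub>k a\<^sub>k) E\<close>, where \<open>D\<close> is the Euler derivation.  As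
  \<open>p\<^sub>k\<close> is homogeneous of degree \<open>k\<close>, all sums over \<open>k\<close> are recovered from the grading.  Uniqueness
  gives the commutation of the exponentials with each other and with the fermions.

  Taking adjoints in the bra and moving all exponentials to the outside, where they fix the shifted
  vacuum, the pairing becomes the vacuum expectation of \<open>u\<^sup>*\<^sub>L \<dots> u\<^sup>*\<^sub>1 u\<^sub>1 \<dots> u\<^sub>L\<close>, where the anticommutator of
  \<open>u\<^sup>*\<^sub>i\<close> and \<open>u\<^sub>j\<close> is the part of degree \<open>\<lambda>\<^sub>j - j - \<mu>\<^sub>i + i\<close> of the series
  \<open>\<Prod>\<^bsub>k < i\<^esub> (1 - \<beta>\<^sub>k) \<Prod>\<^bsub>k < j\<^esub> (1 - \<beta>\<^sub>k)\<^sup>-\<^sup>1 \<Prod>\<^bsub>k < \<lambda>\<^sub>j\<^esub> (1 + \<alpha>\<^sub>k) \<Prod>\<^bsub>k \<le> \<mu>\<^sub>i\<^esub> (1 + \<alpha>\<^sub>k)\<^sup>-\<^sup>1\<close>.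
  For \<open>j \<le> i\<close> and \<open>\<lambda>\<^sub>j > \<mu>\<^sub>i\<close> this is a polynomial of too small a degree, and for \<open>j \<ge> i\<close> and \<open>\<lambda>\<^sub>j \<le> \<mu>\<^sub>i\<close>
  the degree is negative unless \<open>i = j\<close> and \<open>\<lambda>\<^sub>i = \<mu>\<^sub>i\<close>, when the part is \<open>1\<close>.  So the matrix of anticommutators
  is unitriangular for \<open>\<lambda> = \<mu>\<close>, and otherwise it has a block of zeros that is too large for a nonzero determinant.
  The second half of the theorem follows because the bilinear form \<open>\<langle>u\<^sup>*|v\<rangle>\<close> is symmetric.
\<close>

section \<open>The algebra of fermions\<close>

lemma abs_fermion_mult: "abs_fermion x * abs_fermion y = abs_fermion (x * y)"
  by (rule times_fermion.abs_eq)

lemma free_alg_induct [case_names single add]: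
  assumes "\<And>w c. P (Poly_Mapping.single w c)" and "\<And>x y. P x \<Longrightarrow> P y \<Longrightarrow> P (x + y)"
  shows "P (x :: 'k::field_char_0 free_alg)"
proof -
  have *: "P (\<Sum>w\<in>S. Poly_Mapping.single w (Poly_Mapping.lookup x w))" if "finite S" for S
    using that
  proof (induction S rule: finite_induct)
    case empty
    show ?case using assms(1)[of 0 0] by simp
  next
    case (insert w S)
    then show ?case using assms by simp
  qed
  show ?thesis
    by (subst free_alg_sum_singles) (rule *, simp)
qed

text \<open>Modulo the relations every element is still a sum of words with scalar coefficients, and
  a word arises from a scalar by multiplying generators on the left.\<close>

lemma fermion_induct [case_names scalar add psi psi_star]:
  assumes scalar: "\<And>c. P (scalar c)"
    and add: "\<And>x y. P x \<Longrightarrow> P y \<Longrightarrow> P (x + y)"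
    and psi: "\<And>n x. P x \<Longrightarrow> P (psi n * x)"
    and psi_star: "\<And>n x. P x \<Longrightarrow> P (psi_star n * x)"
  shows "P (X :: 'k::field_char_0 fermion)"
proof -
  have word: "P (abs_fermion (Poly_Mapping.single (FWord ws) c))" for ws c
  proof (induction ws)
    case Nil
    show ?case
      using scalar[of c] by (simp add: scalar.abs_eq free_scalar_def zero_fword_def)
  next
    case (Cons g ws)
    have "Poly_Mapping.single (FWord (g # ws)) c = free_gen g * Poly_Mapping.single (FWord ws) c"
      by (simp add: free_gen_def mult_single plus_fword_def)
    then have *: "abs_fermion (Poly_Mapping.single (FWord (g # ws)) c) =
        abs_fermion (free_gen g) * abs_fermion (Poly_Mapping.single (FWord ws) c)"
      by (simp add: abs_fermion_mult)
    show ?case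
      unfolding * using psi[OF Cons.IH] psi_star[OF Cons.IH]
      by (cases g) (simp_all add: psi.abs_eq psi_star.abs_eq)
  qed
  have "P (abs_fermion x)" for x
  proof (induction x rule: free_alg_induct)
    case (single w c)
    show ?case using word by (cases w) simp
  next
    case (add x y)
    then show ?case using assms(2) by (simp add: plus_fermion.abs_eq [symmetric])
  qed
  then show ?thesis
    by (metis Quotient_abs_rep Quotient_fermion)
qed

lemma scalar_mult_commute: "scalar c * X = X * scalar c"
proof -
  have "free_scalar c * x = x * free_scalar c" for x
    by (induction x rule: free_alg_induct)
      (simp_all add: free_scalar_def mult_single mult.commute algebra_simps)
  then have "scalar c * abs_fermion x = abs_fermion x * scalar c" for x
    by (simp add: scalar.abs_eq abs_fermion_mult)
  then show ?thesis
    by (metis Quotient_abs_rep Quotient_fermion)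
qed

lemma scalar_add: "scalar (c + d) = scalar c + scalar d"
  by (simp add: scalar.abs_eq plus_fermion.abs_eq free_scalar_def single_add)

lemma scalar_mult: "scalar (c * d) = scalar c * scalar d"
  by (simp add: scalar.abs_eq abs_fermion_mult free_scalar_def mult_single)

lemma scalar_1: "scalar 1 = 1"
  by (simp add: scalar.abs_eq one_fermion.abs_eq free_scalar_def)

lemma psi_anticommute: "psi m * psi n = - (psi n * psi m)"
  using anticomm_psi_psi[of m n] by (simp add: anticomm_def eq_neg_iff_add_eq_0)

lemma psi_star_anticommute: "psi_star m * psi_star n = - (psi_star n * psi_star m)"
  using anticomm_star_star[of m n] by (simp add: anticomm_def eq_neg_iff_add_eq_0)

lemma psi_psi_star: "psi m * psi_star n = (if m = n then 1 else 0) - psi_star n * psi m"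
  using anticomm_psi_star[of m n] by (simp add: anticomm_def algebra_simps)

lemma psi_star_psi: "psi_star n * psi m = (if m = n then 1 else 0) - psi m * psi_star n"
  using anticomm_psi_star[of m n] by (simp add: anticomm_def algebra_simps)

section \<open>The pairing\<close>

text \<open>
  A concrete Fock space, needed because \<open>pairing\<close> is a definite description: vectors are functions on finite sets of integers, where a set records the
  sites whose occupation differs from the vacuum (in which the negative sites are occupied).  The
  signs are those of Jordan and Wigner.
\<close>

definition occupied :: "int \<Rightarrow> int fset \<Rightarrow> bool" where
  "occupied n S \<longleftrightarrow> (n < 0) \<noteq> (n |\<in>| S)"

definition toggle :: "int \<Rightarrow> int fset \<Rightarrow> int fset" where
  "toggle n S = (if n |\<in>| S then S |-| {|n|} else finsert n S)"

text \<open>The occupied sites below \<open>n\<close> are infinitely many. Those that deviate from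
  the vacuum are finite in number, and their parity also flips whenever a site below
  \<open>n\<close> is toggled.\<close>

definition jw_sign :: "int \<Rightarrow> int fset \<Rightarrow> 'k::field_char_0" where
  "jw_sign n S = (- 1) ^ fcard (ffilter (\<lambda>s. s < n) S)"

text \<open>Functions are coefficient vectors, so the coefficient at \<open>S\<close> is pulled back
  from \<open>toggle n S\<close>. Creation at \<open>n\<close> can lead to \<open>S\<close> only if
  \<open>n\<close> is occupied in \<open>S\<close>, annihilation only if it is not.\<close>

fun gen_act :: "generator \<Rightarrow> (int fset \<Rightarrow> 'k::field_char_0) \<Rightarrow> int fset \<Rightarrow> 'k" where
  "gen_act (Psi n) f S = (if occupied n S then jw_sign n S * f (toggle n S) else 0)"
| "gen_act (PsiStar n) f S = (if occupied n S then 0 else jw_sign n S * f (toggle n S))"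

lemma occupied_toggle: "occupied n (toggle m S) = (if n = m then \<not> occupied n S else occupied n S)"
  by (auto simp: occupied_def toggle_def)

lemma toggle_commute: "toggle n (toggle m S) = toggle m (toggle n S)"
  by (rule fset_eqI) (auto simp: toggle_def)

lemma toggle_toggle: "toggle n (toggle n S) = S"
  by (rule fset_eqI) (auto simp: toggle_def)

lemma jw_sign_sq: "jw_sign n S * jw_sign n S = (1 :: 'k::field_char_0)"
  by (simp add: jw_sign_def power_mult_distrib [symmetric])

text \<open>For two different sites exactly one of the two orders of acting picks up this minus
  sign, whence the anticommutation; for equal sites neither does.\<close>

lemma jw_sign_toggle:
  "jw_sign n (toggle m S) = (if m < n then - jw_sign n S else (jw_sign n S :: 'k::field_char_0))"
proof -
  let ?F = "ffilter (\<lambda>s. s < n)"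
  have 1: "?F (toggle m S) = toggle m (?F S)" if "m < n"
    using that by (intro fset_eqI) (auto simp: toggle_def)
  have 2: "?F (toggle m S) = ?F S" if "\<not> m < n"
    using that by (intro fset_eqI) (auto simp: toggle_def)
  have 3: "(- 1) ^ fcard (toggle m T) = - ((- 1) ^ fcard T :: 'k)" for T
  proof (cases "m |\<in>| T")
    case True
    then have "fcard T = Suc (fcard (T |-| {|m|}))"
      by (metis fcard_Suc_fminus1)
    then have "(- 1) ^ fcard T = - ((- 1) ^ fcard (T |-| {|m|}) :: 'k)"
      by (metis power_Suc mult_minus1)
    with True show ?thesis
      by (simp only: toggle_def if_True minus_minus)
  next
    case False
    then show ?thesis
      by (simp add: toggle_def fcard_finsert_disjoint)
  qed
  show ?thesis
    using 1 2 3 by (simp add: jw_sign_def)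
qed

lemma gen_act_psi_psi: "gen_act (Psi m) (gen_act (Psi n) f) S + gen_act (Psi n) (gen_act (Psi m) f) S = 0"
  by (auto simp: occupied_toggle jw_sign_toggle toggle_commute[of n m])

lemma gen_act_star_star:
  "gen_act (PsiStar m) (gen_act (PsiStar n) f) S + gen_act (PsiStar n) (gen_act (PsiStar m) f) S = 0"
  by (auto simp: occupied_toggle jw_sign_toggle toggle_commute[of n m])

lemma gen_act_psi_star:
  "gen_act (Psi m) (gen_act (PsiStar n) f) S + gen_act (PsiStar n) (gen_act (Psi m) f) S
     = (if m = n then f S else 0)"
proof (cases "m = n")
  case True
  have *: "jw_sign n S * (jw_sign n S * f S) = f S"
    unfolding mult.assoc [symmetric] jw_sign_sq by simp
  show ?thesis
    using True by (simp add: occupied_toggle jw_sign_toggle toggle_toggle *)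
next
  case False
  then show ?thesis
    by (auto simp: occupied_toggle jw_sign_toggle toggle_commute[of n m])
qed

definition word_act :: "fword \<Rightarrow> (int fset \<Rightarrow> 'k::field_char_0) \<Rightarrow> int fset \<Rightarrow> 'k" where
  "word_act w f = foldr gen_act (letters w) f"

definition free_act :: "'k::field_char_0 free_alg \<Rightarrow> (int fset \<Rightarrow> 'k) \<Rightarrow> int fset \<Rightarrow> 'k" where
  "free_act x f S = (\<Sum>w\<in>Poly_Mapping.keys x. Poly_Mapping.lookup x w * word_act w f S)"

lemma gen_act_add: "gen_act g (\<lambda>S. f S + h S) = (\<lambda>S. gen_act g f S + gen_act g h S)"
  by (cases g) (auto simp: algebra_simps)

lemma gen_act_scale: "gen_act g (\<lambda>S. c * f S) = (\<lambda>S. c * gen_act g f S)"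
  by (cases g) (auto simp: algebra_simps)

lemma word_act_add: "word_act w (\<lambda>S. f S + h S) = (\<lambda>S. word_act w f S + word_act w h S)"
proof -
  have "foldr gen_act ws (\<lambda>S. f S + h S) = (\<lambda>S. foldr gen_act ws f S + foldr gen_act ws h S)" for ws
    by (induction ws) (simp_all add: gen_act_add)
  then show ?thesis by (simp add: word_act_def)
qed

lemma word_act_scale: "word_act w (\<lambda>S. c * f S) = (\<lambda>S. c * word_act w f S)"
proof -
  have "foldr gen_act ws (\<lambda>S. c * f S) = (\<lambda>S. c * foldr gen_act ws f S)" for ws
    by (induction ws) (simp_all add: gen_act_scale)
  then show ?thesis by (simp add: word_act_def)
qed

lemma word_act_plus: "word_act (u + v) f = word_act u (word_act v f)"
  by (simp add: word_act_def plus_fword_def)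

lemma free_act_single: "free_act (Poly_Mapping.single w c) f = (\<lambda>S. c * word_act w f S)"
  by (rule ext, cases "c = 0") (simp_all add: free_act_def)

lemma free_act_add: "free_act (x + y) f = (\<lambda>S. free_act x f S + free_act y f S)"
proof
  fix S
  let ?K = "Poly_Mapping.keys x \<union> Poly_Mapping.keys y"
  have *: "free_act z f S = (\<Sum>w\<in>?K. Poly_Mapping.lookup z w * word_act w f S)"
    if "Poly_Mapping.keys z \<subseteq> ?K" for z
    unfolding free_act_def
    by (rule sum.mono_neutral_left) (use that in \<open>auto simp: in_keys_iff\<close>)
  show "free_act (x + y) f S = free_act x f S + free_act y f S"
    by (simp add: * Poly_Mapping.keys_add lookup_add distrib_right sum.distrib)
qed

lemma free_act_diff: "free_act (x - y) f S = free_act x f S - free_act y f S"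
  using free_act_add[of "x - y" y f] by (simp add: fun_eq_iff algebra_simps)

lemma free_act_mult: "free_act (x * y) f = free_act x (free_act y f)"
proof (induction x rule: free_alg_induct)
  case (single u c)
  show ?case
    by (induction y rule: free_alg_induct)
      (simp_all add: mult_single free_act_single word_act_plus word_act_scale distrib_left
        free_act_add word_act_add mult.assoc)
next
  case (add x x')
  then show ?case by (simp add: distrib_right free_act_add)
qed

lemma free_act_gen: "free_act (free_gen g) f = gen_act g f"
  by (simp add: free_gen_def free_act_single word_act_def)

lemma free_act_zero: "free_act x (\<lambda>S. 0) = (\<lambda>S. 0)"
proof -
  have "word_act w (\<lambda>S. 0) = (\<lambda>S. 0 :: 'a)" for w
    using word_act_scale[of w 0 "\<lambda>S. 0 :: 'a"] by simp
  then show ?thesis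
    by (simp add: free_act_def fun_eq_iff)
qed

lemma free_act_1: "free_act 1 f = f"
proof -
  have "word_act 0 f = f"
    by (simp add: word_act_def zero_fword_def)
  then show ?thesis
    using free_act_single[of 0 1 f] by simp
qed

lemma free_act_car_ideal: "x \<in> car_ideal \<Longrightarrow> free_act x f S = 0"
proof (induction arbitrary: f S rule: car_ideal.induct)
  case (psi_psi m n)
  show ?case
    unfolding anticomm_def free_act_add free_act_mult free_act_gen by (rule gen_act_psi_psi)
next
  case (star_star m n)
  show ?case
    unfolding anticomm_def free_act_add free_act_mult free_act_gen by (rule gen_act_star_star)
next
  case (psi_star m n)
  have "free_act (of_bool (m = n)) f S = (if m = n then f S else 0)"
    by (cases "m = n") (simp_all only: free_act_1 of_bool_eq if_True if_False free_act_def
        keys_zero sum.empty simp_thms)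
  then show ?case
    unfolding anticomm_def free_act_add free_act_mult free_act_gen free_act_diff gen_act_psi_star
    by simp
next
  case zero
  show ?case by (simp add: free_act_def)
next
  case (add x y)
  then show ?case by (simp add: free_act_add)
next
  case (mult x a b)
  then have "free_act x (free_act b f) = (\<lambda>S. 0)" by blast
  then show ?case by (simp add: free_act_mult free_act_zero)
qed

text \<open>The choice of representative is immaterial by \<open>free_act_car_ideal\<close>.\<close>

definition fermion_act :: "'k::field_char_0 fermion \<Rightarrow> (int fset \<Rightarrow> 'k) \<Rightarrow> int fset \<Rightarrow> 'k" where
  "fermion_act X = free_act (rep_fermion X)"

lemma fermion_act_abs: "fermion_act (abs_fermion x) = free_act x"
proof -
  have "car_rel (rep_fermion (abs_fermion x)) x"
    by (rule Quotient3_rep_abs [OF Quotient3_fermion car_rel_refl])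
  then have "free_act (rep_fermion (abs_fermion x) - x) f S = 0" for f S
    unfolding car_rel_def by (rule free_act_car_ideal)
  then show ?thesis
    by (simp add: fermion_act_def free_act_diff fun_eq_iff)
qed

lemma fermion_abs_cases: obtains x where "X = abs_fermion x"
  by (metis Quotient_abs_rep Quotient_fermion)

lemma fermion_act_add: "fermion_act (X + Y) f S = fermion_act X f S + fermion_act Y f S"
  by (cases X rule: fermion_abs_cases, cases Y rule: fermion_abs_cases)
    (simp add: plus_fermion.abs_eq fermion_act_abs free_act_add)

lemma fermion_act_mult: "fermion_act (X * Y) f = fermion_act X (fermion_act Y f)"
  by (cases X rule: fermion_abs_cases, cases Y rule: fermion_abs_cases)
    (simp add: abs_fermion_mult fermion_act_abs free_act_mult)

lemma fermion_act_scalar: "fermion_act (scalar c) f = (\<lambda>S. c * f S)"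
  by (simp add: scalar.abs_eq fermion_act_abs free_scalar_def free_act_single word_act_def
      zero_fword_def)

lemma fermion_act_psi: "fermion_act (psi n) f = gen_act (Psi n) f"
  by (simp add: psi.abs_eq fermion_act_abs free_act_gen)

lemma fermion_act_psi_star: "fermion_act (psi_star n) f = gen_act (PsiStar n) f"
  by (simp add: psi_star.abs_eq fermion_act_abs free_act_gen)

section \<open>Vacuum expectation values\<close>

definition vac_fun :: "int fset \<Rightarrow> 'k::field_char_0" where
  "vac_fun S = (if S = {||} then 1 else 0)"

definition vev :: "'k::field_char_0 fermion \<Rightarrow> 'k" where
  "vev X = fermion_act X vac_fun {||}"

lemma vev_add: "vev (X + Y) = vev X + vev Y"
  by (simp add: vev_def fermion_act_add)

lemma vev_scalar_mult: "vev (scalar c * X) = c * vev X"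
  by (simp add: vev_def fermion_act_mult fermion_act_scalar)

lemma vev_1: "vev 1 = 1"
  by (simp add: scalar_1 [symmetric] vev_def fermion_act_scalar vac_fun_def)

lemma vev_diff: "vev (X - Y) = vev X - vev Y"
  using vev_add[of "X - Y" Y] by (simp add: algebra_simps)

lemma fermion_act_vac:
  "n < 0 \<Longrightarrow> fermion_act (psi n) vac_fun = (\<lambda>S. 0)"
  "0 \<le> n \<Longrightarrow> fermion_act (psi_star n) vac_fun = (\<lambda>S. 0)"
  by (auto simp: fermion_act_psi fermion_act_psi_star vac_fun_def occupied_def toggle_def fun_eq_iff)

text \<open>The whole vector vanishes and not only its coefficient at the empty set; this stronger
  property survives multiplication from the left.\<close>

lemma vev_vac_left_ideal: "X \<in> vac_left_ideal \<Longrightarrow> vev X = 0"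
proof -
  have zero: "fermion_act X (\<lambda>S. 0) = (\<lambda>S. 0)" for X :: "'a fermion"
    by (simp add: fermion_act_def free_act_zero)
  assume "X \<in> vac_left_ideal"
  then have "fermion_act X vac_fun = (\<lambda>S. 0)"
  proof (induction rule: vac_left_ideal.induct)
    case zero
    show ?case using fermion_act_scalar[of 0 vac_fun] fermion_act_add[of 0 0 vac_fun] by auto
  next
    case (add x y)
    then show ?case by (simp add: fun_eq_iff fermion_act_add)
  next
    case (mult x a)
    then show ?case by (simp add: fermion_act_mult zero)
  qed (simp_all add: fermion_act_vac)
  then show ?thesis by (simp add: vev_def)
qed

lemma vev_vac_right_ideal: "X \<in> vac_right_ideal \<Longrightarrow> vev X = 0"
proof -
  assume "X \<in> vac_right_ideal"
  \<comment> \<open>All \<open>f\<close> are considered at once, since a right factor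
    \<open>a\<close> replaces the function by \<open>fermion_act a f\<close>.\<close>
  then have "fermion_act X f {||} = 0" for f
  proof (induction arbitrary: f rule: vac_right_ideal.induct)
    case zero
    show ?case using fermion_act_add[of 0 0 f] by auto
  next
    case (add x y)
    then show ?case by (simp add: fermion_act_add)
  next
    case (mult x a)
    then show ?case by (simp add: fermion_act_mult)
  qed (simp_all add: fermion_act_psi fermion_act_psi_star occupied_def)
  then show ?thesis by (simp add: vev_def)
qed

text \<open>The outcome of normal ordering: scalars, elements that kill the vacuum, and products
  with a creation operator in front. Showing that this is everything makes a functional that
  vanishes on both vacuum ideals depend only on its values at scalars.\<close>

inductive_set creation_span :: "'k::field_char_0 fermion set" where
  scalar: "scalar c \<in> creation_span"
| ideal: "x \<in> vac_left_ideal \<Longrightarrow> x \<in> creation_span"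
| add: "x \<in> creation_span \<Longrightarrow> y \<in> creation_span \<Longrightarrow> x + y \<in> creation_span"
| psi: "0 \<le> n \<Longrightarrow> x \<in> creation_span \<Longrightarrow> psi n * x \<in> creation_span"
| psi_star: "n < 0 \<Longrightarrow> x \<in> creation_span \<Longrightarrow> psi_star n * x \<in> creation_span"

lemma creation_span_uminus: "x \<in> creation_span \<Longrightarrow> - x \<in> creation_span"
proof (induction rule: creation_span.induct)
  case (scalar c)
  have "scalar c + scalar (- c) = 0"
    by (metis add.right_inverse add_cancel_right_right scalar_add)
  then have "- scalar c = scalar (- c)" by (simp add: minus_unique)
  then show ?case by (simp add: creation_span.scalar)
next
  case (psi n x)
  then show ?case using creation_span.psi[of n "- x"] by simp
next
  case (psi_star n x)
  then show ?case using creation_span.psi_star[of n "- x"] by simp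
next
  case (add x y)
  then show ?case using creation_span.add[of "- x" "- y"] by simp
qed (simp_all add: vac_left_ideal_uminus creation_span.ideal)

text \<open>An annihilation operator passes each creation operator at the cost of a sign and
  possibly a term without either of them. Once it reaches a scalar, the result kills the
  vacuum.\<close>

lemma creation_span_annihilator:
  assumes "(\<exists>n. G = psi n \<and> n < 0) \<or> (\<exists>n. G = psi_star n \<and> 0 \<le> n)" and "x \<in> creation_span"
  shows "G * x \<in> creation_span"
  using assms(2)
proof (induction rule: creation_span.induct)
  case (scalar c)
  have "G \<in> vac_left_ideal"
    using assms(1) by (auto intro: vac_left_ideal.intros)
  then have "scalar c * G \<in> vac_left_ideal" by (rule vac_left_ideal.mult)
  then show ?case by (simp add: scalar_mult_commute creation_span.ideal)
next
  case (ideal x)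
  then show ?case by (simp add: vac_left_ideal.mult creation_span.ideal)
next
  case (add x y)
  then show ?case by (simp add: distrib_left creation_span.add)
next
  case (psi n x)
  have "G * psi n = 1 - psi n * G \<or> G * psi n = - (psi n * G)"
    using assms(1) psi.hyps by (auto simp: psi_star_psi psi_anticommute[of _ n])
  then have "G * (psi n * x) = x - psi n * (G * x) \<or> G * (psi n * x) = - (psi n * (G * x))"
    unfolding mult.assoc [symmetric] by (auto simp: left_diff_distrib)
  then show ?case
    using psi creation_span.psi[of n "G * x"] creation_span_uminus[of "psi n * (G * x)"]
      creation_span.add[of x "- (psi n * (G * x))"] by auto
next
  case (psi_star n x)
  have "G * psi_star n = 1 - psi_star n * G \<or> G * psi_star n = - (psi_star n * G)"
    using assms(1) psi_star.hyps by (auto simp: psi_psi_star psi_star_anticommute[of _ n])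
  then have "G * (psi_star n * x) = x - psi_star n * (G * x) \<or>
      G * (psi_star n * x) = - (psi_star n * (G * x))"
    unfolding mult.assoc [symmetric] by (auto simp: left_diff_distrib)
  then show ?case
    using psi_star creation_span.psi_star[of n "G * x"] creation_span_uminus[of "psi_star n * (G * x)"]
      creation_span.add[of x "- (psi_star n * (G * x))"] by auto
qed

lemma creation_span_UNIV: "X \<in> creation_span"
proof (induction X rule: fermion_induct)
  case (psi n x)
  then show ?case
    by (cases "n < 0") (auto intro: creation_span_annihilator creation_span.psi)
next
  case (psi_star n x)
  then show ?case
    using creation_span_annihilator[of "psi_star n" x]
    by (cases "n < 0") (auto intro: creation_span.psi_star simp: not_less)
qed (auto intro: creation_span.intros)

text \<open>Of the generating clauses of \<open>creation_span\<close>, those with a creation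
  operator in front land in the right ideal, so only scalars contribute. This gives both the
  invariance under \<open>star\<close> and the uniqueness of the pairing.\<close>

lemma vev_unique:
  assumes add: "\<And>X Y. f (X + Y) = f X + f Y" and scalar: "\<And>c. f (scalar c) = c"
    and left: "\<And>X. X \<in> vac_left_ideal \<Longrightarrow> f X = 0"
    and right: "\<And>X. X \<in> vac_right_ideal \<Longrightarrow> f X = 0"
  shows "f X = vev X"
  using creation_span_UNIV[of X]
proof (induction rule: creation_span.induct)
  case (scalar c)
  then show ?case using assms(2) vev_scalar_mult[of c 1] by (simp add: vev_1)
next
  case (psi n x)
  then have "psi n * x \<in> vac_right_ideal" by (simp add: vac_right_ideal.intros)
  then show ?case by (simp add: right vev_vac_right_ideal)
next
  case (psi_star n x)
  then have "psi_star n * x \<in> vac_right_ideal" by (simp add: vac_right_ideal.intros)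
  then show ?case by (simp add: right vev_vac_right_ideal)
qed (simp_all add: left vev_vac_left_ideal add vev_add)

lemma star_vac_right_ideal: "x \<in> vac_right_ideal \<Longrightarrow> star x \<in> vac_left_ideal"
proof (induction rule: vac_right_ideal.induct)
  case zero
  show ?case
    using star_diff[of 0 "0 :: 'a fermion"] by (simp add: vac_left_ideal.zero)
qed (auto simp: star_psi star_psi_star star_add star_mult intro: vac_left_ideal.intros)

text \<open>The involution fixes scalars and exchanges the two vacuum ideals, so the
  characterization by \<open>vev_unique\<close> applies.\<close>

lemma vev_star: "vev (star X) = vev X"
  by (rule vev_unique)
    (simp_all add: star_add vev_add star_scalar vev_vac_left_ideal vev_vac_right_ideal
      star_vac_left_ideal star_vac_right_ideal vev_scalar_mult[of _ 1, simplified] vev_1)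

lemma star_star: "star (star X) = X"
proof (induction X rule: fermion_induct)
qed (simp_all add: star_scalar star_add star_mult star_psi star_psi_star)

section \<open>Actions on Fock space and its dual\<close>

lemma fock_cases: obtains X where "v = act X vac"
proof -
  have "\<exists>X. v = act X vac"
    by transfer (metis fock_rel_def diff_self mult_1_right vac_left_ideal.zero)
  then show ?thesis using that by blast
qed

lemma dual_fock_cases: obtains X where "w = dual_act dual_vac X"
proof -
  have "\<exists>X. w = dual_act dual_vac X"
    by transfer (metis dual_fock_rel_def diff_self mult_1_left vac_right_ideal.zero)
  then show ?thesis using that by blast
qed

lemma act_mult: "act (X * Y) v = act X (act Y v)"
  by transfer (simp add: mult.assoc fock_rel_def vac_left_ideal.zero)

lemma act_add_left: "act (X + Y) v = act X v + act Y v"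
  by transfer (simp add: distrib_right fock_rel_def vac_left_ideal.zero)

lemma act_add_right: "act X (u + v) = act X u + act X v"
  by transfer (simp add: distrib_left fock_rel_def vac_left_ideal.zero)

lemma act_1: "act 1 v = v"
  by transfer (simp add: fock_rel_def vac_left_ideal.zero)

lemma act_0_left: "act 0 v = 0"
  using act_add_left[of 0 0 v] by simp

lemma act_0_right: "act X 0 = 0"
  using act_add_right[of X 0 0] by simp

lemma act_uminus_left: "act (- X) v = - act X v"
  using act_add_left[of X "- X" v] by (simp add: act_0_left eq_neg_iff_add_eq_0 add.commute)

lemma act_uminus_right: "act X (- v) = - act X v"
  using act_add_right[of X v "- v"] by (simp add: act_0_right eq_neg_iff_add_eq_0 add.commute)

lemma act_diff_left: "act (X - Y) v = act X v - act Y v"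
  using act_add_left[of X "- Y" v] by (simp add: act_uminus_left)

lemma act_vac_eq_0_iff: "act X vac = 0 \<longleftrightarrow> X \<in> vac_left_ideal"
  by transfer (simp add: fock_rel_def)

lemma dual_act_mult: "dual_act w (X * Y) = dual_act (dual_act w X) Y"
  by transfer (simp add: mult.assoc dual_fock_rel_def vac_right_ideal.zero)

lemma dual_act_add_right: "dual_act w (X + Y) = dual_act w X + dual_act w Y"
  by transfer (simp add: distrib_left dual_fock_rel_def vac_right_ideal.zero)

lemma dual_act_vac_eq_0_iff: "dual_act dual_vac X = 0 \<longleftrightarrow> X \<in> vac_right_ideal"
  by transfer (simp add: dual_fock_rel_def)

definition vev_pairing :: "'k::field_char_0 dual_fock \<Rightarrow> 'k fock \<Rightarrow> 'k" where
  "vev_pairing w v = vev (rep_dual_fock w * rep_fock v)"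

text \<open>Representatives may differ by an element of the right ideal on the left and of the left
  ideal on the right; \<open>vev\<close> vanishes on both kinds of correction.\<close>

lemma vev_pairing_eq: "vev_pairing (dual_act dual_vac X) (act Y vac) = vev (X * Y)"
proof -
  let ?X = "rep_dual_fock (dual_act dual_vac X)" and ?Y = "rep_fock (act Y vac)"
  have absX: "dual_act dual_vac X = abs_dual_fock X"
    by (simp add: dual_vac_def dual_act.abs_eq)
  have absY: "act Y vac = abs_fock Y"
    by (simp add: vac_def act.abs_eq)
  have "dual_fock_rel ?X X"
    unfolding absX
    by (rule Quotient3_rep_abs [OF Quotient3_dual_fock]) (simp add: dual_fock_rel_def vac_right_ideal.zero)
  then have "(?X - X) * ?Y \<in> vac_right_ideal"
    unfolding dual_fock_rel_def by (rule vac_right_ideal.mult)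
  then have 1: "vev (?X * ?Y) = vev (X * ?Y)"
    using vev_vac_right_ideal by (fastforce simp: left_diff_distrib vev_diff)
  have "fock_rel ?Y Y"
    unfolding absY
    by (rule Quotient3_rep_abs [OF Quotient3_fock]) (simp add: fock_rel_def vac_left_ideal.zero)
  then have "X * (?Y - Y) \<in> vac_left_ideal"
    unfolding fock_rel_def by (rule vac_left_ideal.mult)
  then have 2: "vev (X * ?Y) = vev (X * Y)"
    using vev_vac_left_ideal by (fastforce simp: right_diff_distrib vev_diff)
  show ?thesis
    using 1 2 by (simp add: vev_pairing_def)
qed

lemma is_fock_pairing_vev_pairing: "is_fock_pairing vev_pairing"
  unfolding is_fock_pairing_def
proof (intro conjI allI)
  fix w w' :: "'a dual_fock" and v v' :: "'a fock" and c :: 'a and X :: "'a fermion"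
  obtain W where w: "w = dual_act dual_vac W" by (rule dual_fock_cases)
  obtain W' where w': "w' = dual_act dual_vac W'" by (rule dual_fock_cases)
  obtain V where v: "v = act V vac" by (rule fock_cases)
  obtain V' where v': "v' = act V' vac" by (rule fock_cases)
  show "vev_pairing (w + w') v = vev_pairing w v + vev_pairing w' v"
    by (simp add: w w' v dual_act_add_right [symmetric] vev_pairing_eq distrib_right vev_add)
  show "vev_pairing w (v + v') = vev_pairing w v + vev_pairing w v'"
    by (simp add: w v v' act_add_left [symmetric] vev_pairing_eq distrib_left vev_add)
  show "vev_pairing (dual_fock_scale c w) v = c * vev_pairing w v"
    by (simp only: w v dual_fock_scale_def dual_act_mult [symmetric] vev_pairing_eq
        scalar_mult_commute [symmetric] mult.assoc vev_scalar_mult)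
  have "W * (scalar c * V) = scalar c * (W * V)"
    by (metis mult.assoc scalar_mult_commute)
  then show "vev_pairing w (fock_scale c v) = c * vev_pairing w v"
    by (simp add: w v fock_scale_def act_mult [symmetric] vev_pairing_eq vev_scalar_mult)
  show "vev_pairing dual_vac vac = (1 :: 'a)"
    using vev_pairing_eq[of 1 1] dual_fock_cases[of dual_vac]
    by (metis act_1 dual_act_vac_eq_0_iff dual_vac.abs_eq dual_act.abs_eq mult_1_right vev_1)
  show "vev_pairing (dual_act w X) v = vev_pairing w (act X v)"
    by (simp add: w v dual_act_mult [symmetric] act_mult [symmetric] vev_pairing_eq mult.assoc)
qed

text \<open>By cyclicity a pairing is determined by the functional sending \<open>X\<close> to
  \<open>P dual_vac (act X vac)\<close>, and the axioms of a pairing are enough for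
  \<open>vev_unique\<close>.\<close>

lemma fock_pairing_unique:
  fixes P :: "'a::field_char_0 dual_fock \<Rightarrow> 'a fock \<Rightarrow> 'a"
  assumes "is_fock_pairing P"
  shows "P = vev_pairing"
proof (intro ext)
  fix w :: "'a dual_fock" and v :: "'a fock"
  obtain W where w: "w = dual_act dual_vac W" by (rule dual_fock_cases)
  obtain V where v: "v = act V vac" by (rule fock_cases)
  have P: "P (dual_act w X) v = P w (act X v)" "P w (v + v') = P w v + P w v'"
      "P w (fock_scale c v) = c * P w v" "P (w + w') v = P w v + P w' v" "P dual_vac vac = 1"
    for w w' v v' c X
    using assms by (simp_all add: is_fock_pairing_def)
  have P0: "P w 0 = 0" "P 0 v = 0" for w v
    using P(2)[of w 0 0] P(4)[of 0 0 v] by simp_all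
  have "P dual_vac (act X vac) = vev X" for X
  proof (rule vev_unique)
    fix X Y
    show "P dual_vac (act (X + Y) vac) = P dual_vac (act X vac) + P dual_vac (act Y vac)"
      by (simp add: act_add_left P)
  next
    fix c
    show "P dual_vac (act (scalar c) vac) = c"
      by (simp add: fock_scale_def [symmetric] P)
  next
    fix X :: "'a fermion" assume "X \<in> vac_left_ideal"
    then show "P dual_vac (act X vac) = 0"
      by (simp add: act_vac_eq_0_iff [symmetric] P0)
  next
    fix X :: "'a fermion" assume "X \<in> vac_right_ideal"
    then show "P dual_vac (act X vac) = 0"
      by (simp add: dual_act_vac_eq_0_iff [symmetric] P0 P(1) [symmetric])
  qed
  then show "P w v = vev_pairing w v"
    by (simp add: w v P act_mult [symmetric] vev_pairing_eq)
qed

lemma pairing_eq: "pairing = vev_pairing"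
  unfolding pairing_def
  by (rule the_equality) (rule is_fock_pairing_vev_pairing, rule fock_pairing_unique)

section \<open>The symmetric bilinear form\<close>

definition bilin :: "'k::field_char_0 fock \<Rightarrow> 'k fock \<Rightarrow> 'k" where
  "bilin u v = pairing (fock_star u) v"

lemma bilin_eq: "bilin (act X vac) (act Y vac) = vev (star X * Y)"
  by (simp add: bilin_def pairing_eq fock_star_act_vac vev_pairing_eq)

lemma bilin_sym: "bilin u v = bilin v u"
proof -
  obtain X Y where "u = act X vac" "v = act Y vac" by (metis fock_cases)
  moreover have "vev (star X * Y) = vev (star Y * X)"
    using vev_star[of "star X * Y"] by (simp add: star_mult star_star)
  ultimately show ?thesis by (simp add: bilin_eq)
qed

lemma bilin_add_right: "bilin w (u + v) = bilin w u + bilin w v"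
  by (metis bilin_def pairing_eq is_fock_pairing_vev_pairing is_fock_pairing_def)

lemma bilin_scale_right: "bilin w (fock_scale c v) = c * bilin w v"
  by (metis bilin_def pairing_eq is_fock_pairing_vev_pairing is_fock_pairing_def)

lemma bilin_act_left: "bilin (act Z u) v = bilin u (act (star Z) v)"
proof -
  obtain X Y where "u = act X vac" "v = act Y vac" by (metis fock_cases)
  then show ?thesis by (simp add: bilin_eq act_mult [symmetric] star_mult mult.assoc)
qed

lemma bilin_vac: "bilin vac vac = (1 :: 'a::field_char_0)"
  using bilin_eq[of "1 :: 'a fermion" 1] star_scalar[of "1 :: 'a"] by (simp add: act_1 vev_1 scalar_1)

lemma fock_scale_add_right: "fock_scale c (u + v) = fock_scale c u + fock_scale c v"
  by (simp add: fock_scale_def act_add_right)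

lemma fock_scale_add_left: "fock_scale (c + d) v = fock_scale c v + fock_scale d v"
  by (simp add: fock_scale_def scalar_add act_add_left)

lemma fock_scale_fock_scale: "fock_scale c (fock_scale d v) = fock_scale (c * d) v"
  by (simp add: fock_scale_def scalar_mult act_mult)

lemma fock_scale_1: "fock_scale 1 v = v"
  by (simp add: fock_scale_def scalar_1 act_1)

lemma fock_scale_0_right: "fock_scale c 0 = 0"
  by (simp add: fock_scale_def act_0_right)

lemma fock_scale_0_left: "fock_scale 0 v = 0"
  using fock_scale_add_left[of 0 0 v] by simp

lemma act_fock_scale: "act X (fock_scale c v) = fock_scale c (act X v)"
  by (simp add: fock_scale_def act_mult [symmetric] scalar_mult_commute)

lemma act_sum_right: "act X (sum f A) = (\<Sum>i\<in>A. act X (f i))"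
  by (induction A rule: infinite_finite_induct) (simp_all add: act_0_right act_add_right)

lemma fock_scale_sum: "fock_scale c (sum f A) = (\<Sum>i\<in>A. fock_scale c (f i))"
  by (simp add: fock_scale_def act_sum_right)

lemma fock_induct [case_names vac add psi psi_star]:
  assumes vac: "\<And>c. P (fock_scale c vac)"
    and add: "\<And>u v. P u \<Longrightarrow> P v \<Longrightarrow> P (u + v)"
    and psi: "\<And>n v. P v \<Longrightarrow> P (act (psi n) v)"
    and psi_star: "\<And>n v. P v \<Longrightarrow> P (act (psi_star n) v)"
  shows "P (v :: 'k::field_char_0 fock)"
proof -
  have "P (act X vac)" for X
    by (induction X rule: fermion_induct)
      (simp_all add: fock_scale_def [symmetric] act_add_left act_mult assms)
  then show ?thesis
    by (metis fock_cases)
qed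

lemma act_psi_psi: "act (psi m) (act (psi n) v) = - act (psi n) (act (psi m) v)"
  by (simp add: act_mult [symmetric] psi_anticommute[of m n] act_uminus_left)

lemma act_psi_star_psi_star:
  "act (psi_star m) (act (psi_star n) v) = - act (psi_star n) (act (psi_star m) v)"
  by (simp add: act_mult [symmetric] psi_star_anticommute[of m n] act_uminus_left)

lemma act_psi_star_psi:
  "act (psi_star n) (act (psi m) v) = (if m = n then v else 0) - act (psi m) (act (psi_star n) v)"
  by (simp add: act_mult [symmetric] psi_star_psi act_diff_left act_0_left act_1)

lemma act_psi_psi_star:
  "act (psi m) (act (psi_star n) v) = (if m = n then v else 0) - act (psi_star n) (act (psi m) v)"
  by (simp add: act_psi_star_psi)

section \<open>Currents\<close>

definition current_support :: "int \<Rightarrow> 'k::field_char_0 fock \<Rightarrow> int set" where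
  "current_support k v = {i. act (psi i) (act (psi_star (i + k)) v) \<noteq> 0}"

lemma act_normal_ordered:
  "k \<noteq> 0 \<Longrightarrow> act (normal_ordered i k) v = act (psi i) (act (psi_star (i + k)) v)"
  by (simp add: normal_ordered_def act_mult act_uminus_left act_psi_psi_star[of i "i + k"])

text \<open>On the vacuum only the indices with 0 \<le> i < - k survive. Each further generator
  anticommutes with all but one term of the current, so it enlarges the support by at most one
  index.\<close>

lemma finite_current_support: "k \<noteq> 0 \<Longrightarrow> finite (current_support k v)"
proof (induction v rule: fock_induct)
  case (vac c)
  have "i \<in> {0..<- k}" if "i \<in> current_support k (fock_scale c vac)" for i
  proof (rule ccontr)
    assume "i \<notin> {0..<- k}"
    then consider "0 \<le> i + k" | "i < 0" by force
    then have "act (psi i) (act (psi_star (i + k)) vac) = (0 :: 'a fock)"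
    proof cases
      case 1
      then show ?thesis by (simp add: act_vac_eq_0 act_0_right)
    next
      case 2
      then show ?thesis using vac by (simp add: act_psi_psi_star act_vac_eq_0 act_0_right)
    qed
    then show False
      using that by (simp add: current_support_def act_fock_scale fock_scale_0_right)
  qed
  then show ?case
    by (meson finite_atLeastLessThan_int finite_subset subsetI)
next
  case (add u v)
  then have "finite (current_support k u \<union> current_support k v)" by simp
  then show ?case
    by (rule finite_subset [rotated]) (auto simp: current_support_def act_add_right)
next
  case (psi n v)
  then have "finite (insert (n - k) (current_support k v))" by simp
  then show ?case
    by (rule finite_subset [rotated])
      (auto simp: current_support_def act_psi_star_psi act_uminus_right act_psi_psi[of _ n] act_0_right)
next
  case (psi_star n v)
  then have "finite (insert n (current_support k v))" by simp
  then show ?case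
    by (rule finite_subset [rotated])
      (auto simp: current_support_def act_psi_star_psi_star[of _ n] act_uminus_right
        act_psi_psi_star[of _ n] act_0_right)
qed

lemma current_eq_sum:
  assumes "k \<noteq> 0" "finite A" "current_support k v \<subseteq> A"
  shows "current k v = (\<Sum>i\<in>A. act (psi i) (act (psi_star (i + k)) v))"
  using assms(2-3) unfolding current_def act_normal_ordered[OF assms(1)] current_support_def
  by (rule Sum_any.expand_superset)

lemma current_add: "k \<noteq> 0 \<Longrightarrow> current k (u + v) = current k u + current k v"
proof -
  assume k: "k \<noteq> 0"
  define A where "A = current_support k u \<union> current_support k v \<union> current_support k (u + v)"
  have A: "finite A" "current_support k u \<subseteq> A" "current_support k v \<subseteq> A"
      "current_support k (u + v) \<subseteq> A"
    using finite_current_support[OF k] by (auto simp: A_def)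
  then show ?thesis
    by (simp add: current_eq_sum[OF k A(1)] act_add_right sum.distrib)
qed

lemma current_scale: "k \<noteq> 0 \<Longrightarrow> current k (fock_scale c v) = fock_scale c (current k v)"
proof -
  assume k: "k \<noteq> 0"
  define A where "A = current_support k v \<union> current_support k (fock_scale c v)"
  have A: "finite A" "current_support k v \<subseteq> A" "current_support k (fock_scale c v) \<subseteq> A"
    using finite_current_support[OF k] by (auto simp: A_def)
  then show ?thesis
    by (simp add: current_eq_sum[OF k A(1)] act_fock_scale fock_scale_sum)
qed

lemma current_0: "k \<noteq> 0 \<Longrightarrow> current k 0 = 0"
  using current_add[of k 0 0] by simp

lemma current_diff: "k \<noteq> 0 \<Longrightarrow> current k (u - v) = current k u - current k v"
  using current_add[of k "u - v" v] by (simp add: algebra_simps)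

text \<open>Only the term with \<open>i + k = n\<close> fails to commute with \<open>psi n\<close>,
  and it leaves \<open>psi (n - k)\<close> behind.\<close>

lemma current_psi:
  assumes "k \<noteq> 0"
  shows "current k (act (psi n) v) = act (psi n) (current k v) + act (psi (n - k)) v"
proof -
  define A where "A = insert (n - k) (current_support k v \<union> current_support k (act (psi n) v))"
  have A: "finite A" "current_support k v \<subseteq> A" "current_support k (act (psi n) v) \<subseteq> A" "n - k \<in> A"
    using finite_current_support[OF assms] by (auto simp: A_def)
  have "act (psi i) (act (psi_star (i + k)) (act (psi n) v)) =
      act (psi n) (act (psi i) (act (psi_star (i + k)) v)) + (if i = n - k then act (psi i) v else 0)" for i
    by (auto simp: act_psi_star_psi act_uminus_right act_psi_psi[of i n] act_0_right
        act_add_right diff_conv_add_uminus simp del: add_uminus_conv_diff)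
  then show ?thesis
    using A by (simp add: current_eq_sum[OF assms A(1)] sum.distrib act_sum_right)
qed

lemma current_psi_star:
  assumes "k \<noteq> 0"
  shows "current k (act (psi_star n) v) = act (psi_star n) (current k v) - act (psi_star (n + k)) v"
proof -
  define A where "A = insert n (current_support k v \<union> current_support k (act (psi_star n) v))"
  have A: "finite A" "current_support k v \<subseteq> A" "current_support k (act (psi_star n) v) \<subseteq> A" "n \<in> A"
    using finite_current_support[OF assms] by (auto simp: A_def)
  have "act (psi i) (act (psi_star (i + k)) (act (psi_star n) v)) =
      act (psi_star n) (act (psi i) (act (psi_star (i + k)) v)) - (if i = n then act (psi_star (n + k)) v else 0)" for i
    by (simp add: act_psi_star_psi_star[of "i + k" n] act_uminus_right act_psi_psi_star[of i n] )
  then show ?thesis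
    using A by (simp add: current_eq_sum[OF assms A(1)] sum_subtractf act_sum_right)
qed

lemma current_vac: "0 < k \<Longrightarrow> current k vac = (0 :: 'a::field_char_0 fock)"
proof -
  assume k: "0 < k"
  have "act (psi i) (act (psi_star (i + k)) vac) = (0 :: 'a fock)" for i
    using k by (cases "0 \<le> i + k")
      (simp_all add: act_psi_psi_star[of i "i + k"] act_vac_eq_0 act_0_right)
  then show ?thesis
    using k current_eq_sum[of k "{}" "vac :: 'a fock"] by (simp add: current_support_def)
qed

text \<open>Both currents kill the vacuum, and their commutators with the generators are index
  shifts, which commute with each other.\<close>

lemma current_commute:
  "0 < j \<Longrightarrow> 0 < k \<Longrightarrow> current j (current k v) = current k (current j v)"
proof (induction v rule: fock_induct)
  case (vac c)
  then show ?case by (simp add: current_scale current_vac fock_scale_0_right current_0)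
next
  case (add u v)
  then show ?case by (simp add: current_add)
next
  case (psi n v)
  then show ?case
    by (simp add: current_psi current_add algebra_simps)
next
  case (psi_star n v)
  then show ?case
    by (simp add: current_psi_star current_diff algebra_simps)
qed

lemma bilin_0_right: "bilin u 0 = 0"
  using bilin_add_right[of u 0 0] by simp

lemma bilin_sum_right: "bilin u (sum f A) = (\<Sum>i\<in>A. bilin u (f i))"
  by (induction A rule: infinite_finite_induct) (simp_all add: bilin_0_right bilin_add_right)

lemma bilin_sum_left: "bilin (sum f A) v = (\<Sum>i\<in>A. bilin (f i) v)"
  by (simp add: bilin_sym[of _ v] bilin_sum_right)

text \<open>The involution turns the term of index \<open>i\<close> of one current into the term of
  index \<open>i + k\<close> of the other, so the two sums agree after a shift.\<close>

lemma bilin_current: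
  assumes "k \<noteq> 0"
  shows "bilin (current k u) v = bilin u (current (- k) v)"
proof -
  define A where "A = current_support k u \<union> (\<lambda>i. i - k) ` current_support (- k) v"
  have A: "finite A" "current_support k u \<subseteq> A"
    using assms by (auto simp: A_def finite_current_support)
  have A': "finite ((\<lambda>i. i + k) ` A)" "current_support (- k) v \<subseteq> (\<lambda>i. i + k) ` A"
    using assms A(1) by (auto simp: A_def image_Un image_image finite_current_support)
  have "bilin (current k u) v = (\<Sum>i\<in>A. bilin u (act (psi (i + k)) (act (psi_star i) v)))"
    using assms A by (simp add: current_eq_sum bilin_sum_left bilin_act_left star_psi star_psi_star)
  also have "\<dots> = (\<Sum>i\<in>(\<lambda>i. i + k) ` A. bilin u (act (psi i) (act (psi_star (i - k)) v)))"
    by (subst sum.reindex) (auto simp: inj_on_def)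
  also have "\<dots> = bilin u (current (- k) v)"
    using assms A' by (simp add: current_eq_sum bilin_sum_right)
  finally show ?thesis .
qed

section \<open>Shifted vacua\<close>

lemma shifted_vac_0: "shifted_vac (- int 0) = vac"
  by (simp add: shifted_vac_def)

lemma shifted_vac_Suc: "shifted_vac (- int (Suc l)) = act (psi_star (- int (Suc l))) (shifted_vac (- int l))"
proof -
  have "[- int (Suc l)..- 1] = (- int (Suc l)) # [- int l..- 1]"
    by (subst upto_rec1) simp_all
  then show ?thesis
    by (cases l) (simp_all add: shifted_vac_def)
qed

lemma psi_star_shifted_vac:
  "- int l \<le> n \<Longrightarrow> act (psi_star n) (shifted_vac (- int l)) = (0 :: 'a::field_char_0 fock)"
proof (induction l arbitrary: n)
  case 0
  then show ?case by (simp only: shifted_vac_0) (simp add: act_vac_eq_0)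
next
  case (Suc l)
  show ?case
  proof (cases "n = - int (Suc l)")
    case True
    \<comment> \<open>The relation of \<open>psi_star n\<close> with itself says that twice the
      square is zero; characteristic 0 permits division by 2.\<close>
    have "act (psi_star n) (act (psi_star n) v) = 0" for v :: "'b::field_char_0 fock"
    proof -
      have "act (psi_star n) (act (psi_star n) v) + act (psi_star n) (act (psi_star n) v) = 0"
        using act_psi_star_psi_star[of n n v] by (simp add: eq_neg_iff_add_eq_0)
      then have "fock_scale (1 / 2) (fock_scale 2 (act (psi_star n) (act (psi_star n) v))) = 0"
        using fock_scale_add_left[of 1 "1 :: 'b"] by (simp add: fock_scale_1 fock_scale_0_right)
      then show ?thesis by (simp add: fock_scale_fock_scale fock_scale_1)
    qed
    then show ?thesis using True by (simp only: shifted_vac_Suc)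
  next
    case False
    with Suc.prems have "- int l \<le> n" by simp
    then have "act (psi_star n) (shifted_vac (- int l)) = (0 :: 'a fock)"
      by (rule Suc.IH)
    then show ?thesis
      by (simp only: shifted_vac_Suc act_psi_star_psi_star[of n]) (simp add: act_0_right)
  qed
qed

lemma psi_shifted_vac:
  "act (psi (- int (Suc l))) (shifted_vac (- int (Suc l))) = (shifted_vac (- int l) :: 'a::field_char_0 fock)"
proof -
  have "n < - int l \<Longrightarrow> act (psi n) (shifted_vac (- int l)) = (0 :: 'a fock)" for n
  proof (induction l)
    case 0
    then show ?case by (simp only: shifted_vac_0) (simp add: act_vac_eq_0)
  next
    case (Suc l)
    then show ?case
      by (simp only: shifted_vac_Suc act_psi_psi_star[of n]) (simp add: act_0_right)
  qed
  then show ?thesis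
    by (simp only: shifted_vac_Suc act_psi_psi_star) (simp add: act_0_right)
qed

text \<open>The commutator with the outermost operator raises its index by \<open>k\<close> > 0, so
  that it duplicates one already present or kills the vacuum.\<close>

lemma current_shifted_vac: "0 < k \<Longrightarrow> current k (shifted_vac (- int l)) = 0"
proof (induction l)
  case 0
  then show ?case by (simp only: shifted_vac_0 current_vac)
next
  case (Suc l)
  have "act (psi_star (- int (Suc l) + k)) (shifted_vac (- int l)) = 0"
    using Suc.prems by (intro psi_star_shifted_vac) simp
  then show ?case
    using Suc by (simp only: shifted_vac_Suc) (simp add: current_psi_star act_0_right)
qed

lemma bilin_shifted_vac:
  "bilin (shifted_vac (- int l)) (shifted_vac (- int l)) = (1 :: 'a::field_char_0)"
proof (induction l)
  case 0
  then show ?case by (simp only: shifted_vac_0 bilin_vac)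
next
  case (Suc l)
  have "bilin (shifted_vac (- int (Suc l))) (shifted_vac (- int (Suc l))) =
      (bilin (shifted_vac (- int l)) (act (psi (- int (Suc l))) (shifted_vac (- int (Suc l)))) :: 'a)"
    by (subst shifted_vac_Suc) (simp only: bilin_act_left star_psi_star)
  then show ?case
    using Suc by (simp only: psi_shifted_vac)
qed

section \<open>Linear endomorphisms of Fock space\<close>

typedef (overloaded) 'k fend = "{f :: 'k::field_char_0 fock \<Rightarrow> 'k fock.
    (\<forall>u v. f (u + v) = f u + f v) \<and> (\<forall>c v. f (fock_scale c v) = fock_scale c (f v))}"
  morphisms app Fend
  by (rule exI[of _ id]) simp

setup_lifting type_definition_fend

lemma app_add: "app f (u + v) = app f u + app f v"
  by transfer blast

lemma app_scale: "app f (fock_scale c v) = fock_scale c (app f v)"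
  by transfer blast

lemma app_0: "app f 0 = 0"
  using app_add[of f 0 0] by simp

lemma fock_scale_uminus: "fock_scale c (- v) = - fock_scale c v"
  by (simp add: fock_scale_def act_uminus_right)

lemma fock_scale_diff: "fock_scale c (u - v) = fock_scale c u - fock_scale c v"
  using fock_scale_add_right[of c "u - v" v] by (simp add: algebra_simps)

instantiation fend :: (field_char_0) ring_1
begin

lift_definition zero_fend :: "'a fend" is "\<lambda>v. 0"
  by (simp add: fock_scale_0_right)

lift_definition one_fend :: "'a fend" is "\<lambda>v. v"
  by simp

lift_definition plus_fend :: "'a fend \<Rightarrow> 'a fend \<Rightarrow> 'a fend" is "\<lambda>f g v. f v + g v"
  by (simp add: fock_scale_add_right)

lift_definition uminus_fend :: "'a fend \<Rightarrow> 'a fend" is "\<lambda>f v. - f v"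
  by (simp add: fock_scale_uminus)

lift_definition minus_fend :: "'a fend \<Rightarrow> 'a fend \<Rightarrow> 'a fend" is "\<lambda>f g v. f v - g v"
  by (simp add: fock_scale_diff)

lift_definition times_fend :: "'a fend \<Rightarrow> 'a fend \<Rightarrow> 'a fend" is "\<lambda>f g v. f (g v)"
  by simp

instance
proof
  fix a b c :: "'a fend"
  show "a + b + c = a + (b + c)" "a + b = b + a" "0 + a = a" "- a + a = 0" "a - b = a + - b"
      "a * b * c = a * (b * c)" "(a + b) * c = a * c + b * c" "1 * a = a" "a * 1 = a"
    by (transfer, simp add: fun_eq_iff algebra_simps)+
  show "a * (b + c) = a * b + a * c"
    by transfer (simp add: fun_eq_iff)
  have "vac \<noteq> (0 :: 'a fock)"
    using bilin_vac[where 'a = 'a] bilin_0_right[of "vac :: 'a fock"] by auto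
  then have "app 0 vac \<noteq> app 1 (vac :: 'a fock)"
    by (simp add: zero_fend.rep_eq one_fend.rep_eq)
  then show "(0 :: 'a fend) \<noteq> 1"
    by auto
qed

end

lemma app_simps [simp]:
  "app 0 v = 0" "app 1 v = v" "app (f + g) v = app f v + app g v" "app (- f) v = - app f v"
  "app (f - g) v = app f v - app g v" "app (f * g) v = app f (app g v)"
  by (simp_all add: zero_fend.rep_eq one_fend.rep_eq plus_fend.rep_eq uminus_fend.rep_eq
      minus_fend.rep_eq times_fend.rep_eq)

lemma fend_eqI: "(\<And>v. app f v = app g v) \<Longrightarrow> f = g"
  by transfer blast

lemma app_sum_left: "app (sum f A) v = (\<Sum>i\<in>A. app (f i) v)"
  by (induction A rule: infinite_finite_induct) simp_all

lift_definition fop :: "'k::field_char_0 fermion \<Rightarrow> 'k fend" is act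
  by (simp add: act_add_right act_fock_scale)

lift_definition sc :: "'k::field_char_0 \<Rightarrow> 'k fend" is fock_scale
  by (simp add: fock_scale_add_right fock_scale_fock_scale mult.commute)

text \<open>The value 0 at \<open>k = 0\<close> makes the constant terms of \<open>Hop\<close> and
  \<open>Jop\<close> vanish for every \<open>p\<close>; linearity of \<open>current k\<close> is
  established for \<open>k \<noteq> 0\<close>.\<close>

lift_definition cur :: "int \<Rightarrow> 'k::field_char_0 fend" is "\<lambda>k. if k = 0 then (\<lambda>v. 0) else current k"
  by (simp add: current_add current_scale fock_scale_0_right)

lemma app_sc [simp]: "app (sc c) v = fock_scale c v"
  by transfer simp

lemma app_fop [simp]: "app (fop X) v = act X v"
  by transfer simp

lemma app_cur: "k \<noteq> 0 \<Longrightarrow> app (cur k) v = current k v"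
  by transfer simp

lemma sc_commute: "sc c * f = f * sc c"
  by (rule fend_eqI) (simp add: app_scale)

lemma sc_add: "sc (c + d) = sc c + sc d"
  by (rule fend_eqI) (simp add: fock_scale_add_left)

lemma sc_mult: "sc (c * d) = sc c * sc d"
  by (rule fend_eqI) (simp add: fock_scale_fock_scale)

lemma sc_1 [simp]: "sc 1 = 1"
  by (rule fend_eqI) (simp add: fock_scale_1)

lemma sc_0 [simp]: "sc 0 = 0"
  by (rule fend_eqI) (simp add: fock_scale_0_left)

lemma sc_uminus: "sc (- c) = - sc c"
  using sc_add[of c "- c"] by (simp add: eq_neg_iff_add_eq_0 add.commute)

lemma sc_of_nat: "sc (of_nat n) = of_nat n"
  by (induction n) (simp_all add: sc_add)

lemma sc_sum: "sc (sum f A) = (\<Sum>i\<in>A. sc (f i))"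
  by (induction A rule: infinite_finite_induct) (simp_all add: sc_add)

lemma of_nat_mult_fend_eq_0: "of_nat n * f = (0 :: 'k::field_char_0 fend) \<Longrightarrow> 0 < n \<Longrightarrow> f = 0"
proof -
  assume "of_nat n * f = 0" "0 < n"
  then have "sc (1 / of_nat n) * (sc (of_nat n) * f) = 0"
    by (simp add: sc_of_nat)
  then show ?thesis
    using \<open>0 < n\<close> by (simp add: mult.assoc [symmetric] sc_mult [symmetric])
qed

lemma fop_psi_star_psi:
  "fop (psi_star n) * fop (psi m) = of_bool (n = m) - fop (psi m) * fop (psi_star n)"
  by (rule fend_eqI) (simp add: act_psi_star_psi)

lemma cur_psi: "k \<noteq> 0 \<Longrightarrow> cur k * fop (psi n) = fop (psi n) * cur k + fop (psi (n - k))"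
  by (rule fend_eqI) (simp add: app_cur current_psi)

lemma cur_psi_star:
  "k \<noteq> 0 \<Longrightarrow> cur k * fop (psi_star n) = fop (psi_star n) * cur k - fop (psi_star (n + k))"
  by (rule fend_eqI) (simp add: app_cur current_psi_star)

lemma cur_commute: "0 < j \<Longrightarrow> 0 < k \<Longrightarrow> cur j * cur k = cur k * cur j"
  by (rule fend_eqI) (simp add: app_cur current_commute)

section \<open>Formal power series over a ring\<close>

definition mdeg :: "monom \<Rightarrow> nat" where
  "mdeg a = (\<Sum>p\<in>Poly_Mapping.keys a. Poly_Mapping.lookup a p)"

lemma mdeg_0 [simp]: "mdeg 0 = 0"
  by (simp add: mdeg_def)

lemma mdeg_eq_0_iff [simp]: "mdeg a = 0 \<longleftrightarrow> a = 0"
proof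
  assume "mdeg a = 0"
  then have "Poly_Mapping.lookup a p = 0" for p
    by (cases "p \<in> Poly_Mapping.keys a") (auto simp: mdeg_def in_keys_iff)
  then show "a = 0"
    by (intro poly_mapping_eqI) simp
qed simp

lemma mdeg_add [simp]: "mdeg (a + b) = mdeg a + mdeg b"
proof -
  let ?K = "Poly_Mapping.keys a \<union> Poly_Mapping.keys b"
  have *: "mdeg c = (\<Sum>p\<in>?K. Poly_Mapping.lookup c p)" if "Poly_Mapping.keys c \<subseteq> ?K" for c
    unfolding mdeg_def by (rule sum.mono_neutral_left) (use that in \<open>auto simp: in_keys_iff\<close>)
  show ?thesis
    by (simp add: * Poly_Mapping.keys_add lookup_add sum.distrib)
qed

lemma mdeg_single [simp]: "mdeg (Poly_Mapping.single p n) = n"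
  by (simp add: mdeg_def)

text \<open>A divisor of \<open>m\<close> involves only variables of \<open>m\<close>, with
  exponents at most the total degree, and the cofactor is determined by the divisor.\<close>

lemma finite_splits [simp, intro]: "finite (splits m)"
proof -
  let ?F = "{f. (\<forall>p. (p \<in> Poly_Mapping.keys m \<longrightarrow> f p \<in> {..mdeg m}) \<and> (p \<notin> Poly_Mapping.keys m \<longrightarrow> f p = 0))}"
  have fin: "finite ?F"
    by (rule finite_set_of_finite_funs) simp_all
  have "Poly_Mapping.lookup ` {a. \<exists>b. a + b = m} \<subseteq> ?F"
  proof clarify
    fix a b :: monom and p
    have le: "Poly_Mapping.lookup a p \<le> Poly_Mapping.lookup (a + b) p"
      by (simp add: lookup_add)
    have "Poly_Mapping.lookup (a + b) p \<le> mdeg (a + b)" if "p \<in> Poly_Mapping.keys (a + b)"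
      unfolding mdeg_def by (rule member_le_sum) (use that in simp_all)
    with le show "(p \<in> Poly_Mapping.keys (a + b) \<longrightarrow> Poly_Mapping.lookup a p \<in> {..mdeg (a + b)}) \<and>
        (p \<notin> Poly_Mapping.keys (a + b) \<longrightarrow> Poly_Mapping.lookup a p = 0)"
      by (auto simp: in_keys_iff)
  qed
  then have "finite (Poly_Mapping.lookup ` {a. \<exists>b. a + b = m})"
    by (rule finite_subset) (rule fin)
  then have "finite {a. \<exists>b. a + b = m}"
    by (rule finite_imageD) (simp add: inj_on_def poly_mapping_eqI)
  then have "finite ((\<lambda>a. (a, m - a)) ` {a. \<exists>b. a + b = m})"
    by (rule finite_imageI)
  then show ?thesis
    by (rule finite_subset [rotated]) (auto simp: splits_def image_iff)
qed

lemma sum_splits_assoc: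
  "(\<Sum>(x, c)\<in>splits m. \<Sum>(a, b)\<in>splits x. F a b c) = (\<Sum>(a, y)\<in>splits m. \<Sum>(b, c)\<in>splits y. F a b c)"
proof -
  have "(\<Sum>(x, c)\<in>splits m. \<Sum>(a, b)\<in>splits x. F a b c) =
      (\<Sum>((x, c), (a, b))\<in>Sigma (splits m) (\<lambda>(x, c). splits x). F a b c)"
    by (subst sum.Sigma [symmetric]) (auto simp: case_prod_unfold)
  also have "\<dots> = (\<Sum>((a, y), (b, c))\<in>Sigma (splits m) (\<lambda>(a, y). splits y). F a b c)"
    by (rule sum.reindex_bij_witness[where i = "\<lambda>((a, y), (b, c)). ((a + b, c), (a, b))"
          and j = "\<lambda>((x, c), (a, b)). ((a, b + c), (b, c))"]) (auto simp: splits_def add.assoc)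
  also have "\<dots> = (\<Sum>(a, y)\<in>splits m. \<Sum>(b, c)\<in>splits y. F a b c)"
    by (subst sum.Sigma [symmetric]) (auto simp: case_prod_unfold)
  finally show ?thesis .
qed

lemma sum_splits_commute: "(\<Sum>(a, b)\<in>splits m. F a b) = (\<Sum>(a, b)\<in>splits m. F b a)"
  by (rule sum.reindex_bij_witness[where i = "\<lambda>(a, b). (b, a)" and j = "\<lambda>(a, b). (b, a)"])
    (auto simp: splits_def add.commute)

lemma sum_splits_left:
  assumes "\<And>a b. a \<noteq> 0 \<Longrightarrow> F a b = (0 :: 'a::comm_monoid_add)"
  shows "(\<Sum>(a, b)\<in>splits m. F a b) = F 0 m"
proof -
  have "(\<Sum>(a, b)\<in>splits m. F a b) = (\<Sum>(a, b)\<in>{(0, m)}. F a b)"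
  proof (rule sum.mono_neutral_right)
    show "\<forall>x\<in>splits m - {(0, m)}. (case x of (a, b) \<Rightarrow> F a b) = 0"
      using assms by (clarsimp simp: splits_def) (metis add_0)
  qed (simp_all add: splits_def [of m] finite_splits [unfolded splits_def])
  then show ?thesis by simp
qed

lemma sum_splits_right:
  assumes "\<And>a b. b \<noteq> 0 \<Longrightarrow> F a b = (0 :: 'a::comm_monoid_add)"
  shows "(\<Sum>(a, b)\<in>splits m. F a b) = F m 0"
  by (subst sum_splits_commute) (rule sum_splits_left, rule assms)

section \<open>The ring of formal power series\<close>

typedef 'a mser = "UNIV :: (monom \<Rightarrow> 'a) set"
  morphisms cf Mser
  by simp

setup_lifting type_definition_mser

lemma mser_eqI: "(\<And>m. cf f m = cf g m) \<Longrightarrow> f = g"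
  by transfer blast

instantiation mser :: (ring_1) ring_1
begin

lift_definition zero_mser :: "'a mser" is "\<lambda>m. 0" .
lift_definition one_mser :: "'a mser" is "\<lambda>m. if m = 0 then 1 else 0" .
lift_definition plus_mser :: "'a mser \<Rightarrow> 'a mser \<Rightarrow> 'a mser" is "\<lambda>f g m. f m + g m" .
lift_definition minus_mser :: "'a mser \<Rightarrow> 'a mser \<Rightarrow> 'a mser" is "\<lambda>f g m. f m - g m" .
lift_definition uminus_mser :: "'a mser \<Rightarrow> 'a mser" is "\<lambda>f m. - f m" .
lift_definition times_mser :: "'a mser \<Rightarrow> 'a mser \<Rightarrow> 'a mser" is
  "\<lambda>f g m. \<Sum>(a, b)\<in>splits m. f a * g b" .

instance
proof
  fix f g h :: "'a mser"
  show "f + g + h = f + (g + h)" "f + g = g + f" "0 + f = f" "- f + f = 0" "f - g = f + - g"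
    by (transfer, simp add: fun_eq_iff algebra_simps)+
  show "f * g * h = f * (g * h)"
  proof transfer
    fix f g h :: "monom \<Rightarrow> 'a"
    have "(\<Sum>(x, c)\<in>splits m. (\<Sum>(a, b)\<in>splits x. f a * g b) * h c) =
        (\<Sum>(x, c)\<in>splits m. \<Sum>(a, b)\<in>splits x. f a * (g b * h c))" for m
      by (intro sum.cong refl) (simp add: sum_distrib_right mult.assoc case_prod_unfold)
    moreover have "(\<Sum>(a, y)\<in>splits m. f a * (\<Sum>(b, c)\<in>splits y. g b * h c)) =
        (\<Sum>(a, y)\<in>splits m. \<Sum>(b, c)\<in>splits y. f a * (g b * h c))" for m
      by (intro sum.cong refl) (simp add: sum_distrib_left case_prod_unfold)
    ultimately show "(\<lambda>m. \<Sum>(x, c)\<in>splits m. (\<Sum>(a, b)\<in>splits x. f a * g b) * h c) =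
        (\<lambda>m. \<Sum>(a, y)\<in>splits m. f a * (\<Sum>(b, c)\<in>splits y. g b * h c))"
      by (simp only: sum_splits_assoc)
  qed
  show "(f + g) * h = f * h + g * h" "f * (g + h) = f * g + f * h"
    by (transfer, simp add: fun_eq_iff algebra_simps sum.distrib case_prod_unfold)+
  show "1 * f = f"
    by transfer (rule ext, subst sum_splits_left, auto)
  show "f * 1 = f"
    by transfer (rule ext, subst sum_splits_right, auto)
  show "(0 :: 'a mser) \<noteq> 1"
    by transfer (metis zero_neq_one)
qed

end

instance mser :: (comm_ring_1) comm_ring_1
proof
  fix f g h :: "'a mser"
  show "f * g = g * f"
    by transfer (rule ext, subst sum_splits_commute, simp add: mult.commute)
qed (simp_all add: distrib_right)

lemma cf_simps [simp]:
  "cf 0 m = 0" "cf (f + g) m = cf f m + cf g m" "cf (f - g) m = cf f m - cf g m"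
  "cf (- f) m = - cf f m"
  by (simp_all add: zero_mser.rep_eq plus_mser.rep_eq minus_mser.rep_eq uminus_mser.rep_eq)

lemma cf_1: "cf 1 m = (if m = 0 then 1 else 0)"
  by transfer simp

lemma cf_mult: "cf (f * g) m = (\<Sum>(a, b)\<in>splits m. cf f a * cf g b)"
  by transfer simp

lemma splits_0: "splits 0 = {(0, 0)}"
proof -
  have "a = 0 \<and> b = 0" if "(a, b) \<in> splits 0" for a b
  proof -
    have "a + b = 0" using that by (simp add: splits_def)
    then have "mdeg a + mdeg b = 0" by (metis mdeg_add mdeg_0)
    then show ?thesis by simp
  qed
  moreover have "(0, 0) \<in> splits 0" by (simp add: splits_def)
  ultimately show ?thesis by auto
qed

lemma cf_mult_0 [simp]: "cf (f * g) 0 = cf f 0 * cf g 0"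
  by (simp add: cf_mult splits_0)

lemma cf_1_0 [simp]: "cf 1 0 = 1"
  by (simp add: cf_1)

lemma cf_sum: "cf (sum f A) m = (\<Sum>i\<in>A. cf (f i) m)"
  by (induction A rule: infinite_finite_induct) simp_all

lemma cf_mult_cong:
  assumes "\<And>a b. a + b = m \<Longrightarrow> cf f a * cf g b = cf f' a * cf g' b"
  shows "cf (f * g) m = cf (f' * g') m"
  unfolding cf_mult by (rule sum.cong) (use assms in \<open>auto simp: splits_def\<close>)

lift_definition cst :: "'a::ring_1 \<Rightarrow> 'a mser" is "\<lambda>x m. if m = 0 then x else 0" .

lemma cf_cst: "cf (cst x) m = (if m = 0 then x else 0)"
  by transfer simp

lemma cf_cst_mult [simp]: "cf (cst x * f) m = x * cf f m"
  unfolding cf_mult by (subst sum_splits_left) (simp_all add: cf_cst)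

lemma cf_mult_cst [simp]: "cf (f * cst x) m = cf f m * x"
  unfolding cf_mult by (subst sum_splits_right) (simp_all add: cf_cst)

section \<open>The Euler derivation\<close>

lift_definition euler :: "'a::ring_1 mser \<Rightarrow> 'a mser" is "\<lambda>f m. of_nat (mdeg m) * f m" .

lemma cf_euler [simp]: "cf (euler f) m = of_nat (mdeg m) * cf f m"
  by transfer simp

lemma euler_add: "euler (f + g) = euler f + euler g"
  by (rule mser_eqI) (simp add: distrib_left)

lemma euler_diff: "euler (f - g) = euler f - euler g"
  by (rule mser_eqI) (simp add: right_diff_distrib)

lemma euler_0: "euler 0 = 0"
  by (rule mser_eqI) simp

lemma euler_sum: "euler (sum f A) = (\<Sum>i\<in>A. euler (f i))"
  by (induction A rule: infinite_finite_induct) (simp_all add: euler_0 euler_add)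

lemma euler_cst: "euler (cst x) = 0"
  by (rule mser_eqI) (simp add: cf_cst)

lemma euler_1: "euler 1 = 0"
  by (rule mser_eqI) (simp add: cf_1)

lemma euler_mult: "euler (f * g) = euler f * g + f * euler g"
proof (rule mser_eqI)
  fix m
  have "of_nat (mdeg m) * (\<Sum>(a, b)\<in>splits m. cf f a * cf g b) =
      (\<Sum>(a, b)\<in>splits m. of_nat (mdeg a) * cf f a * cf g b + cf f a * (of_nat (mdeg b) * cf g b))"
    unfolding sum_distrib_left
  proof (rule sum.cong[OF refl], clarify)
    fix a b assume "(a, b) \<in> splits m"
    then have m: "mdeg m = mdeg a + mdeg b"
      by (auto simp: splits_def)
    have "cf f a * (of_nat (mdeg b) * cf g b) = of_nat (mdeg b) * (cf f a * cf g b)"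
      by (metis mult.assoc mult_of_nat_commute)
    then show "of_nat (mdeg m) * (cf f a * cf g b) =
        of_nat (mdeg a) * cf f a * cf g b + cf f a * (of_nat (mdeg b) * cf g b)"
      by (simp add: m distrib_right mult.assoc)
  qed
  then show "cf (euler (f * g)) m = cf (euler f * g + f * euler g) m"
    by (simp add: cf_mult sum.distrib case_prod_unfold)
qed

lemma euler_power_commute:
  assumes "euler f * f = f * euler f"
  shows "euler (f ^ Suc n) = of_nat (Suc n) * (euler f * f ^ n)"
proof (induction n)
  case (Suc n)
  have "f * (of_nat (Suc n) * (euler f * f ^ n)) = of_nat (Suc n) * (f * euler f * f ^ n)"
    using mult_of_nat_commute[of "Suc n" f] by (simp only: mult.assoc [symmetric])
  also have "\<dots> = of_nat (Suc n) * (euler f * f ^ Suc n)"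
    by (simp only: assms [symmetric] power_Suc mult.assoc)
  finally have *: "f * euler (f ^ Suc n) = of_nat (Suc n) * (euler f * f ^ Suc n)"
    by (simp only: Suc)
  have "euler (f ^ Suc (Suc n)) = euler f * f ^ Suc n + f * euler (f ^ Suc n)"
    by (simp only: power_Suc[of f "Suc n"] euler_mult)
  also have "\<dots> = of_nat (Suc (Suc n)) * (euler f * f ^ Suc n)"
    unfolding * of_nat_Suc[of "Suc n"] distrib_right mult_1_left ..
  finally show ?case .
qed (simp add: euler_mult euler_1)

lemma cf_power_eq_0: "cf f 0 = 0 \<Longrightarrow> mdeg m < n \<Longrightarrow> cf (f ^ n) m = 0"
proof (induction n arbitrary: m)
  case (Suc n)
  have "cf f a * cf (f ^ n) b = 0" if "a + b = m" for a b
  proof (cases "a = 0")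
    case False
    then have "mdeg b < n" using Suc.prems that by (auto simp: mdeg_eq_0_iff[symmetric] simp del: mdeg_eq_0_iff)
    then show ?thesis using Suc by simp
  qed (use Suc in simp)
  then have "cf (f * f ^ n) m = cf (0 * 0) m"
    by (intro cf_mult_cong) simp
  then show ?case by simp
qed simp

lemma mser_commuteI:
  assumes "\<And>a b. cf f a * cf g b = cf g b * cf f a"
  shows "f * g = g * f"
proof (rule mser_eqI)
  fix m
  have "cf (f * g) m = (\<Sum>(a, b)\<in>splits m. cf g b * cf f a)"
    unfolding cf_mult by (intro sum.cong refl) (simp add: assms case_prod_unfold)
  also have "\<dots> = cf (g * f) m"
    unfolding cf_mult by (rule sum_splits_commute)
  finally show "cf (f * g) m = cf (g * f) m" .
qed

text \<open>Induction on the degree: as \<open>J\<close> has no constant term, the coefficient of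
  \<open>J * U\<close> at \<open>m\<close> involves \<open>U\<close> only in smaller degrees, while
  on the left the coefficient is multiplied by the positive integer \<open>mdeg m\<close>.\<close>

lemma euler_solution_eq_0:
  fixes U :: "'k::field_char_0 fend mser"
  assumes "euler U = J * U" "cf J 0 = 0" "cf U 0 = 0"
  shows "U = 0"
proof (rule mser_eqI)
  fix m
  show "cf U m = cf 0 m"
  proof (induction "mdeg m" arbitrary: m rule: less_induct)
    case less
    show ?case
    proof (cases "m = 0")
      case False
      have "cf J a * cf U b = 0" if "a + b = m" for a b
      proof (cases "a = 0")
        case False
        then have "0 < mdeg a" using mdeg_eq_0_iff[of a] by linarith
        then have "mdeg b < mdeg m"
          using that by auto
        then show ?thesis using less by simp
      qed (simp add: assms)
      then have "cf (J * U) m = cf (0 * 0) m"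
        by (intro cf_mult_cong) simp
      then have "of_nat (mdeg m) * cf U m = 0"
        by (simp add: assms(1) [symmetric])
      moreover have "0 < mdeg m" using False mdeg_eq_0_iff[of m] by linarith
      ultimately show ?thesis
        by (simp add: of_nat_mult_fend_eq_0)
    qed (simp add: assms)
  qed
qed

lemma euler_solution_unique:
  fixes F G :: "'k::field_char_0 fend mser"
  assumes "euler F = J * F" "euler G = J * G" "cf J 0 = 0" "cf F 0 = cf G 0"
  shows "F = G"
  using euler_solution_eq_0[of "F - G" J] assms by (simp add: euler_diff right_diff_distrib)

section \<open>Exponentials\<close>

lemma cf_Mser [simp]: "cf (Mser f) m = f m"
  by (simp add: Mser_inverse)

text \<open>For \<open>f\<close> without constant term, \<open>f ^ n\<close> starts in degree
  \<open>n\<close>, so the cut-off at \<open>mdeg m\<close> drops only zeros.\<close>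

definition mexp :: "'k::field_char_0 fend mser \<Rightarrow> 'k fend mser" where
  "mexp f = Mser (\<lambda>m. \<Sum>n\<le>mdeg m. sc (1 / fact n) * cf (f ^ n) m)"

lemma cf_mexp: "cf (mexp f) m = (\<Sum>n\<le>mdeg m. sc (1 / fact n) * cf (f ^ n) m)"
  by (simp add: mexp_def)

lemma cf_mexp_trunc:
  assumes "cf f 0 = 0" "mdeg m \<le> N"
  shows "cf (mexp f) m = cf (\<Sum>n\<le>N. cst (sc (1 / fact n)) * f ^ n) m"
  unfolding cf_mexp cf_sum cf_cst_mult
  by (rule sum.mono_neutral_left) (use assms in \<open>auto simp: cf_power_eq_0\<close>)

lemma cf_mexp_0 [simp]: "cf (mexp f) 0 = 1"
  by (simp add: cf_mexp)

text \<open>Coefficients are compared on truncated exponentials: deriving the truncation at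
  \<open>Suc N\<close> gives \<open>euler f\<close> times the truncation at \<open>N\<close>. The
  latter suffices in degree \<open>Suc N\<close> because \<open>euler f\<close> has no constant
  term.\<close>

lemma euler_mexp:
  assumes "cf f 0 = 0" "euler f * f = f * euler f"
  shows "euler (mexp f) = euler f * mexp f"
proof (rule mser_eqI)
  fix m
  let ?t = "\<lambda>N. \<Sum>n\<le>N. cst (sc (1 / fact n)) * f ^ n"
  show "cf (euler (mexp f)) m = cf (euler f * mexp f) m"
  proof (cases "mdeg m")
    case 0
    then show ?thesis by simp
  next
    case (Suc N)
    have step: "euler (cst (sc (1 / fact (Suc n))) * f ^ Suc n) = euler f * (cst (sc (1 / fact n)) * f ^ n)" for n
    proof (rule mser_eqI)
      fix m
      have "cst (sc (1 / fact n)) * euler f = euler f * cst (sc (1 / fact n))"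
        by (rule mser_commuteI) (simp add: cf_cst sc_commute)
      then have *: "euler f * (cst (sc (1 / fact n)) * f ^ n) = cst (sc (1 / fact n)) * (euler f * f ^ n)"
        by (simp only: mult.assoc [symmetric])
      have "(of_nat (Suc n) :: 'a fend mser) = cst (sc (of_nat (Suc n)))"
      proof -
        have "cf (of_nat k :: 'a fend mser) m = cf (cst (of_nat k)) m" for m k
          by (induction k) (auto simp: cf_cst cf_1)
        then show ?thesis
          unfolding sc_of_nat by (intro mser_eqI)
      qed
      then have "euler (cst (sc (1 / fact (Suc n))) * f ^ Suc n) =
          cst (sc (1 / fact (Suc n))) * (cst (sc (of_nat (Suc n))) * (euler f * f ^ n))"
        by (simp only: euler_mult euler_cst euler_power_commute[OF assms(2)] mult_zero_left add_0)
      then have "cf (euler (cst (sc (1 / fact (Suc n))) * f ^ Suc n)) m =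
          sc (1 / fact (Suc n)) * (sc (of_nat (Suc n)) * cf (euler f * f ^ n) m)"
        by (simp only: cf_cst_mult)
      also have "\<dots> = sc (1 / fact (Suc n) * of_nat (Suc n)) * cf (euler f * f ^ n) m"
        by (simp only: sc_mult mult.assoc)
      also have "1 / fact (Suc n) * of_nat (Suc n) = (1 / fact n :: 'a)"
        by (simp add: divide_simps del: of_nat_Suc)
      finally show "cf (euler (cst (sc (1 / fact (Suc n))) * f ^ Suc n)) m =
          cf (euler f * (cst (sc (1 / fact n)) * f ^ n)) m"
        unfolding * cf_cst_mult .
    qed
    have "euler (?t (Suc N)) = euler f * ?t N"
      by (simp only: sum.atMost_Suc_shift euler_add euler_sum step sum_distrib_left)
        (simp add: euler_cst)
    moreover have "cf (euler (mexp f)) m = cf (euler (?t (Suc N))) m"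
      unfolding cf_euler using cf_mexp_trunc[OF assms(1), of m "Suc N"] Suc by simp
    moreover have "cf (euler f * mexp f) m = cf (euler f * ?t N) m"
    proof (rule cf_mult_cong)
      fix a b :: monom assume ab: "a + b = m"
      show "cf (euler f) a * cf (mexp f) b = cf (euler f) a * cf (?t N) b"
      proof (cases "a = 0")
        case False
        then have "0 < mdeg a" using mdeg_eq_0_iff[of a] by linarith
        then have "mdeg b \<le> N" using ab Suc by auto
        then show ?thesis by (simp only: cf_mexp_trunc[OF assms(1)])
      qed simp
    qed
    ultimately show ?thesis by simp
  qed
qed

section \<open>Vertex operators\<close>

text \<open>When \<open>p\<close> is the sum of power sums p_k of degree k, the index k of the
  current can be read off as the degree of the monomial. The sign \<open>s\<close> is 1 for
  \<open>H\<close> and -1 for \<open>H_star\<close>.\<close>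

definition Hop :: "int \<Rightarrow> 'k::field_char_0 mser \<Rightarrow> 'k fend mser" where
  "Hop s p = Mser (\<lambda>a. sc (cf p a / of_nat (mdeg a)) * cur (s * int (mdeg a)))"

definition Jop :: "'k::field_char_0 mser \<Rightarrow> 'k fend mser" where
  "Jop p = Mser (\<lambda>a. sc (cf p a) * cur (int (mdeg a)))"

definition Eop :: "'k::field_char_0 mser \<Rightarrow> 'k fend mser" where
  "Eop p = mexp (Hop 1 p)"

lemma cur_0 [simp]: "cur 0 = 0"
  by (rule fend_eqI) (transfer, simp)

lemma cf_Hop_0 [simp]: "cf (Hop s p) 0 = 0"
  by (simp add: Hop_def)

lemma cf_Jop_0 [simp]: "cf (Jop p) 0 = 0"
  by (simp add: Jop_def)

lemma euler_Hop: "euler (Hop 1 p) = Jop p"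
proof (rule mser_eqI)
  fix a
  show "cf (euler (Hop 1 p)) a = cf (Jop p) a"
    by (cases "a = 0")
      (simp_all add: Hop_def Jop_def mult.assoc [symmetric] sc_of_nat [symmetric] sc_mult [symmetric])
qed

lemma sc_mult_commute: "(sc c * f) * (sc d * g) = (sc c * sc d) * (f * g)"
  by (metis mult.assoc sc_commute)

lemma cur_nat_commute: "cur (int i) * cur (int j) = cur (int j) * cur (int i)"
  by (cases "i = 0"; cases "j = 0") (simp_all add: cur_commute)

lemma Jop_Hop_commute: "Jop p * Hop 1 q = Hop 1 q * Jop p"
proof (rule mser_commuteI)
  fix a b
  show "cf (Jop p) a * cf (Hop 1 q) b = cf (Hop 1 q) b * cf (Jop p) a"
    by (simp add: Jop_def Hop_def sc_mult_commute cur_nat_commute[of "mdeg a" "mdeg b"]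
        sc_commute[of "cf p a" "sc (cf q b / _)"])
qed

lemma euler_Eop: "euler (Eop p) = Jop p * Eop p"
  unfolding Eop_def using euler_mexp[of "Hop 1 p"] by (simp add: euler_Hop Jop_Hop_commute)

lemma cf_Eop_0 [simp]: "cf (Eop p) 0 = 1"
  by (simp add: Eop_def)

lemma Jop_cur_commute:
  fixes p :: "'a::field_char_0 mser"
  shows "cst (cur (int k)) * Jop p = Jop p * cst (cur (int k))"
proof -
  have "cur (int k) * (sc c * cur (int j)) = sc c * cur (int j) * cur (int k)" for c :: 'a and j
    by (metis mult.assoc sc_commute cur_nat_commute)
  then show ?thesis
    by (intro mser_commuteI) (simp add: Jop_def cf_cst)
qed

text \<open>Both products solve the differential equation of \<open>Eop p\<close> with the same
  constant term.\<close>

lemma Eop_cur_commute: "cst (cur (int k)) * Eop p = Eop p * cst (cur (int k))"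
proof (rule euler_solution_unique[of _ "Jop p"])
  show "euler (cst (cur (int k)) * Eop p) = Jop p * (cst (cur (int k)) * Eop p)"
    by (simp add: euler_mult euler_cst euler_Eop mult.assoc [symmetric] Jop_cur_commute)
  show "euler (Eop p * cst (cur (int k))) = Jop p * (Eop p * cst (cur (int k)))"
    by (simp add: euler_mult euler_cst euler_Eop mult.assoc)
qed simp_all

lemma Eop_Jop_commute: "Eop p * Jop q = Jop q * Eop p"
proof (rule mser_commuteI)
  fix a b
  have "cur (int k) * cf (Eop p) a = cf (Eop p) a * cur (int k)" for k
    using Eop_cur_commute[of k p] by (metis cf_cst_mult cf_mult_cst)
  then show "cf (Eop p) a * cf (Jop q) b = cf (Jop q) b * cf (Eop p) a"
    by (simp add: Jop_def) (metis mult.assoc sc_commute)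
qed

lemma Jop_add: "Jop (p + q) = Jop p + Jop q"
  by (rule mser_eqI) (simp add: Jop_def sc_add distrib_right)

lemma Jop_0: "Jop 0 = 0"
  by (rule mser_eqI) (simp add: Jop_def)

lemma Eop_mult: "Eop p * Eop q = Eop (p + q)"
proof (rule euler_solution_unique[of _ "Jop (p + q)"])
  have "Eop p * (Jop q * Eop q) = Jop q * (Eop p * Eop q)"
    by (simp only: mult.assoc [symmetric] Eop_Jop_commute)
  then show "euler (Eop p * Eop q) = Jop (p + q) * (Eop p * Eop q)"
    by (simp add: euler_mult euler_Eop Jop_add distrib_right mult.assoc)
qed (simp_all add: euler_Eop)

lemma Eop_0: "Eop 0 = 1"
  by (rule euler_solution_unique[of _ "Jop 0"]) (simp_all add: euler_Eop euler_1 Jop_0)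

text \<open>
  \<open>psi_mser h n\<close> is \<open>\<Sum>\<^sub>q h\<^sub>q \<psi>\<^bsub>n - q\<^esub>\<close>, where \<open>h\<^sub>q\<close> is the homogeneous part of degree \<open>q\<close> of \<open>h\<close>.
\<close>

definition psi_mser :: "'k::field_char_0 mser \<Rightarrow> int \<Rightarrow> 'k fend mser" where
  "psi_mser h n = Mser (\<lambda>a. sc (cf h a) * fop (psi (n - int (mdeg a))))"

definition psi_star_mser :: "'k::field_char_0 mser \<Rightarrow> int \<Rightarrow> 'k fend mser" where
  "psi_star_mser h n = Mser (\<lambda>a. sc (cf h a) * fop (psi_star (n + int (mdeg a))))"

lemma euler_psi_mser: "euler (psi_mser h n) = psi_mser (euler h) n"
  by (rule mser_eqI) (simp add: psi_mser_def sc_mult sc_of_nat mult.assoc)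

lemma euler_psi_star_mser: "euler (psi_star_mser h n) = psi_star_mser (euler h) n"
  by (rule mser_eqI) (simp add: psi_star_mser_def sc_mult sc_of_nat mult.assoc)

text \<open>The commutator with the current of degree k lowers the fermion index by k. As degrees of
  monomials add up, the coefficients get convolved, which is the product
  \<open>p * h\<close>.\<close>

lemma Jop_psi_mser:
  assumes "cf p 0 = 0"
  shows "Jop p * psi_mser h n = psi_mser h n * Jop p + psi_mser (p * h) n"
proof (rule mser_eqI)
  fix m
  have "cf (Jop p) a * cf (psi_mser h n) b =
      cf (psi_mser h n) b * cf (Jop p) a + sc (cf p a * cf h b) * fop (psi (n - int (mdeg m)))"
    if "a + b = m" for a b
  proof (cases "a = 0")
    case False
    have m: "n - int (mdeg b) - int (mdeg a) = n - int (mdeg m)"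
      using that by auto
    have "cf (Jop p) a * cf (psi_mser h n) b =
        sc (cf p a) * sc (cf h b) * (cur (int (mdeg a)) * fop (psi (n - int (mdeg b))))"
      by (simp add: Jop_def psi_mser_def sc_mult_commute)
    also have "\<dots> = sc (cf h b) * sc (cf p a) * (fop (psi (n - int (mdeg b))) * cur (int (mdeg a)))
        + sc (cf p a * cf h b) * fop (psi (n - int (mdeg m)))"
      using False by (simp add: cur_psi distrib_left sc_mult m sc_commute[of "cf h b"])
    also have "sc (cf h b) * sc (cf p a) * (fop (psi (n - int (mdeg b))) * cur (int (mdeg a))) =
        cf (psi_mser h n) b * cf (Jop p) a"
      by (simp add: Jop_def psi_mser_def sc_mult_commute)
    finally show ?thesis .
  qed (simp add: assms)
  then have "cf (Jop p * psi_mser h n) m = (\<Sum>(a, b)\<in>splits m. cf (psi_mser h n) b * cf (Jop p) a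
      + sc (cf p a * cf h b) * fop (psi (n - int (mdeg m))))"
    unfolding cf_mult by (intro sum.cong refl) (auto simp: splits_def)
  also have "\<dots> = (\<Sum>(a, b)\<in>splits m. cf (psi_mser h n) b * cf (Jop p) a) +
      (\<Sum>(a, b)\<in>splits m. sc (cf p a * cf h b) * fop (psi (n - int (mdeg m))))"
    by (simp add: case_prod_unfold sum.distrib)
  also have "(\<Sum>(a, b)\<in>splits m. cf (psi_mser h n) b * cf (Jop p) a) = cf (psi_mser h n * Jop p) m"
    unfolding cf_mult by (rule sum_splits_commute)
  also have "(\<Sum>(a, b)\<in>splits m. sc (cf p a * cf h b) * fop (psi (n - int (mdeg m)))) =
      cf (psi_mser (p * h) n) m"
    by (simp add: psi_mser_def cf_mult sc_sum sum_distrib_right case_prod_unfold)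
  finally show "cf (Jop p * psi_mser h n) m = cf (psi_mser h n * Jop p + psi_mser (p * h) n) m"
    by simp
qed

lemma Jop_psi_star_mser:
  assumes "cf p 0 = 0"
  shows "Jop p * psi_star_mser h n = psi_star_mser h n * Jop p - psi_star_mser (p * h) n"
proof (rule mser_eqI)
  fix m
  have "cf (Jop p) a * cf (psi_star_mser h n) b =
      cf (psi_star_mser h n) b * cf (Jop p) a - sc (cf p a * cf h b) * fop (psi_star (n + int (mdeg m)))"
    if "a + b = m" for a b
  proof (cases "a = 0")
    case False
    have m: "n + int (mdeg b) + int (mdeg a) = n + int (mdeg m)"
      using that by auto
    have "cf (Jop p) a * cf (psi_star_mser h n) b =
        sc (cf p a) * sc (cf h b) * (cur (int (mdeg a)) * fop (psi_star (n + int (mdeg b))))"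
      by (simp add: Jop_def psi_star_mser_def sc_mult_commute)
    also have "\<dots> = sc (cf h b) * sc (cf p a) * (fop (psi_star (n + int (mdeg b))) * cur (int (mdeg a)))
        - sc (cf p a * cf h b) * fop (psi_star (n + int (mdeg m)))"
      using False by (simp add: cur_psi_star right_diff_distrib sc_mult m sc_commute[of "cf h b"])
    also have "sc (cf h b) * sc (cf p a) * (fop (psi_star (n + int (mdeg b))) * cur (int (mdeg a))) =
        cf (psi_star_mser h n) b * cf (Jop p) a"
      by (simp add: Jop_def psi_star_mser_def sc_mult_commute)
    finally show ?thesis .
  qed (simp add: assms)
  then have "cf (Jop p * psi_star_mser h n) m = (\<Sum>(a, b)\<in>splits m. cf (psi_star_mser h n) b * cf (Jop p) a
      - sc (cf p a * cf h b) * fop (psi_star (n + int (mdeg m))))"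
    unfolding cf_mult by (intro sum.cong refl) (auto simp: splits_def)
  also have "\<dots> = (\<Sum>(a, b)\<in>splits m. cf (psi_star_mser h n) b * cf (Jop p) a) -
      (\<Sum>(a, b)\<in>splits m. sc (cf p a * cf h b) * fop (psi_star (n + int (mdeg m))))"
    by (simp add: case_prod_unfold sum_subtractf)
  also have "(\<Sum>(a, b)\<in>splits m. cf (psi_star_mser h n) b * cf (Jop p) a) = cf (psi_star_mser h n * Jop p) m"
    unfolding cf_mult by (rule sum_splits_commute)
  also have "(\<Sum>(a, b)\<in>splits m. sc (cf p a * cf h b) * fop (psi_star (n + int (mdeg m)))) =
      cf (psi_star_mser (p * h) n) m"
    by (simp add: psi_star_mser_def cf_mult sc_sum sum_distrib_right case_prod_unfold)
  finally show "cf (Jop p * psi_star_mser h n) m = cf (psi_star_mser h n * Jop p - psi_star_mser (p * h) n) m"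
    by simp
qed

text \<open>
  \<open>p\<close> and \<open>h\<close> are the sums over all degrees of the power sums and of the complete homogeneous
  functions of one alphabet; the last condition is Newton's identity.
\<close>

definition newton :: "'k::field_char_0 mser \<Rightarrow> 'k mser \<Rightarrow> bool" where
  "newton p h \<longleftrightarrow> cf p 0 = 0 \<and> cf h 0 = 1 \<and> euler h = p * h"

text \<open>Again two solutions of one differential equation: by Newton's identity the derivative of
  \<open>h\<close> supplies exactly the commutator term of \<open>Jop p\<close> with
  \<open>psi_mser h n\<close>.\<close>

lemma Eop_psi:
  assumes "newton p h"
  shows "Eop p * cst (fop (psi n)) = psi_mser h n * Eop p"
proof (rule euler_solution_unique[of _ "Jop p"])
  have "euler (psi_mser h n * Eop p) = (psi_mser (p * h) n + psi_mser h n * Jop p) * Eop p"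
    using assms by (simp add: euler_mult euler_Eop euler_psi_mser newton_def distrib_right mult.assoc)
  also have "\<dots> = Jop p * (psi_mser h n * Eop p)"
    using assms by (simp add: Jop_psi_mser newton_def add.commute mult.assoc [symmetric])
  finally show "euler (psi_mser h n * Eop p) = Jop p * (psi_mser h n * Eop p)" .
qed (use assms in \<open>simp_all add: euler_mult euler_cst euler_Eop mult.assoc newton_def psi_mser_def cf_cst\<close>)

text \<open>The commutator of a current with \<open>psi_star\<close> has the opposite sign, hence
  the negated alphabet in the Newton condition.\<close>

lemma Eop_psi_star:
  assumes "newton (- p) h"
  shows "Eop p * cst (fop (psi_star n)) = psi_star_mser h n * Eop p"
proof (rule euler_solution_unique[of _ "Jop p"])
  have um: "psi_star_mser (- g) n = - psi_star_mser g n" for g :: "'a mser"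
    by (rule mser_eqI) (simp add: psi_star_mser_def sc_uminus)
  have "euler (psi_star_mser h n * Eop p) = (psi_star_mser h n * Jop p - psi_star_mser (p * h) n) * Eop p"
    using assms by (simp add: euler_mult euler_Eop euler_psi_star_mser newton_def left_diff_distrib
        mult.assoc um)
  also have "\<dots> = Jop p * (psi_star_mser h n * Eop p)"
    using assms by (simp add: Jop_psi_star_mser newton_def mult.assoc [symmetric])
  finally show "euler (psi_star_mser h n * Eop p) = Jop p * (psi_star_mser h n * Eop p)" .
qed (use assms in \<open>simp_all add: euler_mult euler_cst euler_Eop mult.assoc newton_def psi_star_mser_def cf_cst\<close>)

text \<open>The homogeneous part of degree \<open>d\<close> as a series of scalar operators. The
  degree is an integer because it will be a difference of fermion indices.\<close>

definition graded :: "int \<Rightarrow> 'k::field_char_0 mser \<Rightarrow> 'k fend mser" where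
  "graded d f = Mser (\<lambda>a. if int (mdeg a) = d then sc (cf f a) else 0)"

lemma graded_commute: "graded d f * T = T * graded d f"
  by (rule mser_commuteI) (simp add: graded_def sc_commute)

text \<open>Coefficients at monomials of degrees p and q carry \<open>psi_star\<close> of index m +
  p and \<open>psi\<close> of index n - q, whose anticommutator is 1 just when p + q = n - m; the
  product of the series is thereby restricted to that degree.\<close>

lemma psi_star_psi_mser:
  "psi_star_mser g m * psi_mser h n = graded (n - m) (g * h) - psi_mser h n * psi_star_mser g m"
proof (rule mser_eqI)
  fix c
  have "cf (psi_star_mser g m) a * cf (psi_mser h n) b =
      sc (cf g a * cf h b) * of_bool (int (mdeg c) = n - m) - cf (psi_mser h n) b * cf (psi_star_mser g m) a"
    if "a + b = c" for a b
  proof -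
    have "m + int (mdeg a) = n - int (mdeg b) \<longleftrightarrow> int (mdeg c) = n - m"
      using that by auto
    then show ?thesis
      by (simp add: psi_star_mser_def psi_mser_def sc_mult_commute fop_psi_star_psi
          right_diff_distrib sc_mult sc_commute[of "cf h b" "sc (cf g a)"])
  qed
  then have "cf (psi_star_mser g m * psi_mser h n) c =
      (\<Sum>(a, b)\<in>splits c. sc (cf g a * cf h b) * of_bool (int (mdeg c) = n - m)
        - cf (psi_mser h n) b * cf (psi_star_mser g m) a)"
    unfolding cf_mult by (intro sum.cong refl) (auto simp: splits_def)
  also have "\<dots> = (\<Sum>(a, b)\<in>splits c. sc (cf g a * cf h b) * of_bool (int (mdeg c) = n - m))
        - (\<Sum>(a, b)\<in>splits c. cf (psi_mser h n) b * cf (psi_star_mser g m) a)"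
    by (simp add: case_prod_unfold sum_subtractf)
  also have "(\<Sum>(a, b)\<in>splits c. cf (psi_mser h n) b * cf (psi_star_mser g m) a) =
      cf (psi_mser h n * psi_star_mser g m) c"
    unfolding cf_mult by (rule sum_splits_commute)
  also have "(\<Sum>(a, b)\<in>splits c. sc (cf g a * cf h b) * of_bool (int (mdeg c) = n - m)) =
      cf (graded (n - m) (g * h)) c"
    by (simp add: graded_def cf_mult sc_sum case_prod_unfold)
  finally show "cf (psi_star_mser g m * psi_mser h n) c =
      cf (graded (n - m) (g * h) - psi_mser h n * psi_star_mser g m) c"
    by simp
qed

section \<open>Vectors and adjoints\<close>

text \<open>Writing series of vectors as series of operators applied to one fixed vector turns
  operators on such series into left multiplications.\<close>

definition ev :: "'k::field_char_0 fend mser \<Rightarrow> 'k fock \<Rightarrow> 'k fock pseries" where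
  "ev T x = (\<lambda>m. app (cf T m) x)"

lemma series_of_ev: "series_of x = ev 1 x"
  by (auto simp: ev_def series_of_def cf_1)

lemma series_act_ev: "series_act X (ev T x) = ev (cst (fop X) * T) x"
  by (simp add: series_act_def ev_def)

text \<open>Since \<open>F\<close> has no constant term, only the powers up to \<open>mdeg m\<close>
  reach the monomial \<open>m\<close>, and there the sum agrees with \<open>mexp F\<close>.\<close>

lemma exp_op_ev:
  assumes F: "\<And>S. T (ev S x) = ev (F * S) x" and F0: "cf F 0 = 0"
  shows "exp_op T (ev S x) = ev (mexp F * S) x"
proof
  fix m
  have pow: "(T ^^ n) (ev S x) = ev (F ^ n * S) x" for n
    by (induction n) (simp_all add: F mult.assoc)
  have zero: "cf (F ^ n * S) m = 0" if "mdeg m < n" for n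
  proof -
    have "cf (F ^ n) a * cf S b = 0" if "a + b = m" for a b
      using that \<open>mdeg m < n\<close> by (auto simp: cf_power_eq_0[OF F0])
    then have "cf (F ^ n * S) m = cf (0 * 0) m"
      by (intro cf_mult_cong) simp
    then show ?thesis by simp
  qed
  have "exp_op T (ev S x) m = Sum_any (\<lambda>n. fock_scale (1 / fact n) (app (cf (F ^ n * S) m) x))"
    by (simp add: exp_op_def series_sum_def series_scale_def pow) (simp add: ev_def)
  also have "\<dots> = (\<Sum>n\<le>mdeg m. fock_scale (1 / fact n) (app (cf (F ^ n * S) m) x))"
    by (rule Sum_any.expand_superset)
      (auto simp: zero fock_scale_0_right intro: ccontr simp: not_le [symmetric])
  also have "\<dots> = app (cf ((\<Sum>n\<le>mdeg m. cst (sc (1 / fact n)) * F ^ n) * S) m) x"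
    by (simp add: sum_distrib_right cf_sum app_sum_left mult.assoc)
  also have "cf ((\<Sum>n\<le>mdeg m. cst (sc (1 / fact n)) * F ^ n) * S) m = cf (mexp F * S) m"
  proof (rule cf_mult_cong)
    fix a b assume "a + b = m"
    then have "mdeg a \<le> mdeg m" by auto
    then show "cf (\<Sum>n\<le>mdeg m. cst (sc (1 / fact n)) * F ^ n) a * cf S b = cf (mexp F) a * cf S b"
      by (simp only: cf_mexp_trunc[OF F0])
  qed
  finally show "exp_op T (ev S x) m = ev (mexp F * S) x m"
    by (simp add: ev_def)
qed

text \<open>A relation rather than an operation, since an arbitrary endomorphism of Fock space need
  not have an adjoint. The parameters are fixed by it.\<close>

definition adj :: "'k::field_char_0 fend mser \<Rightarrow> 'k fend mser \<Rightarrow> bool" where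
  "adj S T \<longleftrightarrow> (\<forall>m u v. bilin (app (cf S m) u) v = bilin u (app (cf T m) v))"

lemma bilin_scale_left: "bilin (fock_scale c u) w = c * bilin u w"
  by (simp add: bilin_sym[of _ w] bilin_scale_right)

lemma adj_mult:
  assumes "adj S T" "adj S' T'"
  shows "adj (S * S') (T' * T)"
  unfolding adj_def
proof (intro allI)
  fix m u v
  have "bilin (app (cf (S * S') m) u) v = (\<Sum>(a, b)\<in>splits m. bilin u (app (cf T' b) (app (cf T a) v)))"
    using assms by (simp add: adj_def cf_mult app_sum_left bilin_sum_left case_prod_unfold)
  also have "\<dots> = (\<Sum>(a, b)\<in>splits m. bilin u (app (cf T' a) (app (cf T b) v)))"
    by (rule sum_splits_commute)
  also have "\<dots> = bilin u (app (cf (T' * T) m) v)"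
    by (simp add: cf_mult app_sum_left bilin_sum_right case_prod_unfold)
  finally show "bilin (app (cf (S * S') m) u) v = bilin u (app (cf (T' * T) m) v)" .
qed

lemma adj_1: "adj 1 1"
  by (simp add: adj_def cf_1 bilin_0_right bilin_sym[of 0])

lemma adj_power:
  assumes "adj S T"
  shows "adj (S ^ n) (T ^ n)"
proof (induction n)
  case (Suc n)
  then have "adj (S * S ^ n) (T ^ n * T)"
    using assms by (intro adj_mult)
  then show ?case by (simp add: power_commutes)
qed (simp add: adj_1)

lemma adj_mexp: "adj S T \<Longrightarrow> adj (mexp S) (mexp T)"
  using adj_power[of S T]
  by (simp add: adj_def cf_mexp app_sum_left bilin_sum_left bilin_sum_right bilin_scale_left
      bilin_scale_right)

lemma adj_Hop: "adj (Hop (- 1) p) (Hop 1 p)"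
  unfolding adj_def
proof (intro allI)
  fix m u v
  show "bilin (app (cf (Hop (- 1) p) m) u) v = bilin u (app (cf (Hop 1 p) m) v)"
    by (cases "m = 0") (simp_all add: Hop_def app_cur bilin_current bilin_scale_left bilin_scale_right
        bilin_0_right bilin_sym[of 0])
qed

lemma adj_fop: "adj (cst (fop X)) (cst (fop (star X)))"
  by (simp add: adj_def cf_cst bilin_act_left bilin_0_right bilin_sym[of 0])

text \<open>All operators are moved to the ket, so that the pairing becomes a matrix coefficient of
  one product.\<close>

lemma series_pairing_ev:
  assumes "adj S S'"
  shows "series_pairing (series_star (ev S x)) (ev T y) = (\<lambda>m. bilin x (app (cf (S' * T) m) y))"
proof
  fix m
  have "series_pairing (series_star (ev S x)) (ev T y) m =
      (\<Sum>(a, b)\<in>splits m. bilin (app (cf S a) x) (app (cf T b) y))"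
    by (simp add: series_pairing_def series_star_def bilin_def ev_def)
  also have "\<dots> = bilin x (app (cf (S' * T) m) y)"
    using assms by (simp add: adj_def cf_mult app_sum_left bilin_sum_right case_prod_unfold)
  finally show "series_pairing (series_star (ev S x)) (ev T y) m = bilin x (app (cf (S' * T) m) y)" .
qed

lemma series_pairing_sym:
  "series_pairing (series_star u) v = series_pairing (series_star v) u"
  by (rule ext, simp only: series_pairing_def series_star_def bilin_def [symmetric])
    (subst sum_splits_commute, simp add: bilin_sym)

section \<open>Power sums\<close>

text \<open>All power sums of positive index in one series: the one of index k is read off in degree
  k. Under \<open>homog\<close> no monomial is lost.\<close>

definition psum :: "'k::field_char_0 alphabet \<Rightarrow> 'k mser" where
  "psum X = Mser (\<lambda>a. if a = 0 then 0 else Poly_Mapping.lookup (power_sum (mdeg a) X) a)"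

definition homog :: "'k::field_char_0 alphabet \<Rightarrow> bool" where
  "homog X \<longleftrightarrow> (\<forall>k a. Poly_Mapping.lookup (power_sum k X) a \<noteq> 0 \<longrightarrow> mdeg a = k)"

lemma power_sum_add: "power_sum k (X + Y) = power_sum k X + power_sum k Y"
proof -
  let ?K = "Poly_Mapping.keys X \<union> Poly_Mapping.keys Y"
  have *: "power_sum k Z = (\<Sum>z\<in>?K. of_int (Poly_Mapping.lookup Z z) * z ^ k)"
    if "Poly_Mapping.keys Z \<subseteq> ?K" for Z
    unfolding power_sum_def
    by (rule sum.mono_neutral_left) (use that in \<open>auto simp: in_keys_iff\<close>)
  show ?thesis
    by (simp add: * Poly_Mapping.keys_add lookup_add distrib_right sum.distrib)
qed

lemma power_sum_0: "power_sum k 0 = 0"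
  by (simp add: power_sum_def)

lemma power_sum_letter: "power_sum k (letter z) = z ^ k"
  by (simp add: power_sum_def letter_def)

lemma psum_add: "psum (X + Y) = psum X + psum Y"
  by (rule mser_eqI) (simp add: psum_def power_sum_add lookup_add)

lemma psum_0: "psum 0 = 0"
  by (rule mser_eqI) (simp add: psum_def power_sum_0)

lemma psum_sum: "psum (sum f A) = (\<Sum>i\<in>A. psum (f i))"
  by (induction A rule: infinite_finite_induct) (simp_all add: psum_0 psum_add)

lemma homog_add: "homog X \<Longrightarrow> homog Y \<Longrightarrow> homog (X + Y)"
  unfolding homog_def power_sum_add lookup_add by (metis add_0)

lemma homog_0: "homog 0"
  by (simp add: homog_def power_sum_0)

lemma homog_sum: "(\<And>i. i \<in> A \<Longrightarrow> homog (f i)) \<Longrightarrow> homog (sum f A)"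
  by (induction A rule: infinite_finite_induct) (simp_all add: homog_0 homog_add)

definition lin :: "'k::field_char_0 \<Rightarrow> param \<Rightarrow> 'k ppoly" where
  "lin c p = Poly_Mapping.single (Poly_Mapping.single p 1) c"

lemma lin_power: "lin c p ^ k = Poly_Mapping.single (Poly_Mapping.single p k) (c ^ k)"
  by (induction k) (simp_all add: lin_def mult_single single_add [symmetric] flip: single_one)

lemma homog_lin: "homog (letter (lin c p))"
  by (simp add: homog_def power_sum_letter lin_power lookup_single when_def)

lemma A_alph_lin: "A_alph k = (\<Sum>i = 1..nat k. letter (lin (- 1) (Alpha i)))"
  by (simp add: A_alph_def lin_def var_def single_uminus)

lemma B_alph_lin: "B_alph i = letter (lin 1 (Beta i))"
  by (simp add: B_alph_def lin_def var_def)

lemma homog_A_alph: "homog (A_alph k)"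
  unfolding A_alph_lin by (intro homog_sum homog_lin)

lemma homog_B_alph: "homog (B_alph k)"
  unfolding B_alph_lin by (rule homog_lin)

text \<open>The geometric series of the one-letter alphabet whose letter is \<open>c\<close> times
  the variable \<open>p\<close>, that is, its complete homogeneous functions summed over all
  degrees. The letter itself, as a series, is \<open>mvar c p\<close>.\<close>

definition geo :: "'k::field_char_0 \<Rightarrow> param \<Rightarrow> 'k mser" where
  "geo c p = Mser (\<lambda>a. if a = Poly_Mapping.single p (mdeg a) then c ^ mdeg a else 0)"

definition mvar :: "'k::field_char_0 \<Rightarrow> param \<Rightarrow> 'k mser" where
  "mvar c p = Mser (\<lambda>a. if a = Poly_Mapping.single p 1 then c else 0)"

lemma cf_geo_0 [simp]: "cf (geo c p) 0 = 1"
  by (simp add: geo_def)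

lemma cf_mvar_0 [simp]: "cf (mvar c p) 0 = 0"
proof -
  have "mdeg 0 \<noteq> mdeg (Poly_Mapping.single p 1)" by simp
  then have "0 \<noteq> Poly_Mapping.single p (1 :: nat)" by metis
  then show ?thesis by (simp add: mvar_def)
qed

text \<open>Multiplication by \<open>mvar c p\<close> raises the exponent of \<open>p\<close> by
  one. A monomial not divisible by \<open>p\<close> thus receives nothing from the product, and
  \<open>geo c p\<close> contains it only if it is 1.\<close>

lemma geo_rec: "geo c p = 1 + mvar c p * geo c p"
proof (rule mser_eqI)
  fix m
  let ?s = "Poly_Mapping.single p (1 :: nat)"
  show "cf (geo c p) m = cf (1 + mvar c p * geo c p) m"
  proof (cases "\<exists>b. m = ?s + b")
    case True
    then obtain b where b: "m = ?s + b" by blast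
    then have deg: "mdeg m = Suc (mdeg b)" by simp
    have "m \<noteq> 0" using deg by auto
    have "cf (mvar c p * geo c p) m = (\<Sum>(a, b)\<in>{(?s, b)}. cf (mvar c p) a * cf (geo c p) b)"
      unfolding cf_mult
    proof (rule sum.mono_neutral_right)
      show "\<forall>x\<in>splits m - {(?s, b)}. (case x of (a, b) \<Rightarrow> cf (mvar c p) a * cf (geo c p) b) = 0"
      proof clarify
        fix a b' assume "(a, b') \<in> splits m" "cf (mvar c p) a * cf (geo c p) b' \<noteq> 0"
        then have "a + b' = m" "a = ?s"
          by (auto simp: splits_def mvar_def split: if_splits)
        then show "a = ?s \<and> b' = b" using b by simp
      qed
    next
      show "{(?s, b)} \<subseteq> splits m" by (simp add: b splits_def)
    qed simp
    then have *: "cf (mvar c p * geo c p) m = c * cf (geo c p) b"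
      by (simp add: mvar_def)
    have "m = Poly_Mapping.single p (mdeg m) \<longleftrightarrow> ?s + b = ?s + Poly_Mapping.single p (mdeg b)"
      unfolding deg single_add [symmetric] by (simp add: b)
    then have "m = Poly_Mapping.single p (mdeg m) \<longleftrightarrow> b = Poly_Mapping.single p (mdeg b)"
      by simp
    then have "cf (geo c p) m = c * cf (geo c p) b"
      by (simp add: geo_def deg)
    then show ?thesis using * \<open>m \<noteq> 0\<close> by (simp add: cf_1)
  next
    case False
    have "cf (mvar c p) a * cf (geo c p) b = 0" if "a + b = m" for a b
      using False that by (auto simp: mvar_def)
    then have *: "cf (mvar c p * geo c p) m = cf (0 * 0) m"
      by (intro cf_mult_cong) simp
    show ?thesis
    proof (cases "m = 0")
      case True
      then show ?thesis by simp
    next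
      case m: False
      have "m \<noteq> Poly_Mapping.single p (mdeg m)"
      proof
        assume m': "m = Poly_Mapping.single p (mdeg m)"
        obtain d where "mdeg m = 1 + d"
          using m by (metis mdeg_eq_0_iff Suc_eq_plus1_left not0_implies_Suc)
        then have "m = ?s + Poly_Mapping.single p d"
          using m' by (metis single_add)
        then show False using False by blast
      qed
      then show ?thesis
        using * m by (simp add: cf_1 geo_def)
    qed
  qed
qed

lemma geo_mult: "geo c p * (1 - mvar c p) = 1"
  using geo_rec[of c p] by (simp add: algebra_simps)

lemma psum_lin: "psum (letter (lin c p)) = geo c p - 1"
proof (rule mser_eqI)
  fix a
  show "cf (psum (letter (lin c p))) a = cf (geo c p - 1) a"
    by (cases "a = 0") (auto simp: psum_def power_sum_letter lin_power geo_def cf_1 lookup_single when_def)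
qed

lemma euler_mvar: "euler (mvar c p) = mvar c p"
  by (rule mser_eqI) (simp add: mvar_def)

text \<open>With x = \<open>mvar c p\<close> the power sums add up to x / (1 - x), and the
  derivative of 1 - x is -x.\<close>

lemma newton_lin_inv: "newton (- psum (letter (lin c p))) (1 - mvar c p)"
proof -
  have "psum (letter (lin c p)) * (1 - mvar c p) = mvar c p"
    using geo_mult[of c p] by (simp add: psum_lin left_diff_distrib)
  then show ?thesis
    by (simp add: newton_def psum_lin euler_diff euler_1 euler_mvar algebra_simps)
qed

lemma newton_inverse:
  assumes "newton (- p) h" "g * h = 1"
  shows "newton p g"
proof -
  have 0: "cf p 0 = 0" "cf h 0 = 1" "euler h = - (p * h)"
    using assms(1) by (auto simp: newton_def)
  have "cf (g * h) 0 = 1" by (simp add: assms)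
  then have g0: "cf g 0 = 1" using 0 by simp
  have "euler g * h + g * euler h = 0"
    by (metis assms(2) euler_1 euler_mult)
  then have "euler g * h * g = p * (g * h) * g"
    using 0 by (simp add: algebra_simps)
  then have "euler g * (g * h) = p * (g * h) * g"
    by (simp add: algebra_simps)
  then have "euler g = p * g"
    by (simp add: assms)
  then show ?thesis
    using 0 g0 by (simp add: newton_def)
qed

lemma newton_lin: "newton (psum (letter (lin c p))) (geo c p)"
  by (rule newton_inverse[OF newton_lin_inv geo_mult])

lemma newton_mult: "newton p g \<Longrightarrow> newton q h \<Longrightarrow> newton (p + q) (g * h)"
  by (simp add: newton_def euler_mult algebra_simps)

lemma newton_1: "newton 0 1"
  by (simp add: newton_def euler_1)

lemma newton_prod:
  "finite A \<Longrightarrow> (\<And>i. i \<in> A \<Longrightarrow> newton (p i) (h i)) \<Longrightarrow> newton (sum p A) (prod h A)"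
  by (induction A rule: finite_induct) (simp_all add: newton_1 newton_mult)

section \<open>Degree bounds and vanishing of homogeneous parts\<close>

definition deg_le :: "nat \<Rightarrow> 'k::field_char_0 mser \<Rightarrow> bool" where
  "deg_le d f \<longleftrightarrow> (\<forall>a. cf f a \<noteq> 0 \<longrightarrow> mdeg a \<le> d)"

lemma deg_le_mult:
  assumes "deg_le c f" "deg_le d g"
  shows "deg_le (c + d) (f * g)"
  unfolding deg_le_def
proof (intro allI impI)
  fix m assume "cf (f * g) m \<noteq> 0"
  then obtain a b where "(a, b) \<in> splits m" "cf f a * cf g b \<noteq> 0"
    unfolding cf_mult by (metis (no_types, lifting) case_prodE sum.neutral surj_pair case_prod_conv)
  then have "mdeg m = mdeg a + mdeg b" "mdeg a \<le> c" "mdeg b \<le> d"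
    using assms by (auto simp: deg_le_def splits_def)
  then show "mdeg m \<le> c + d" by simp
qed

lemma deg_le_1: "deg_le 0 1"
  by (simp add: deg_le_def cf_1)

lemma deg_le_lin: "deg_le 1 (1 - mvar c p)"
  by (auto simp: deg_le_def cf_1 mvar_def split: if_splits)

lemma deg_le_prod:
  "finite A \<Longrightarrow> (\<And>i. i \<in> A \<Longrightarrow> deg_le 1 (h i)) \<Longrightarrow> deg_le (card A) (prod h A)"
proof (induction A rule: finite_induct)
  case (insert i A)
  then show ?case using deg_le_mult[of 1 "h i" "card A" "prod h A"] by simp
qed (simp add: deg_le_1)

lemma graded_eq_0: "deg_le e f \<Longrightarrow> int e < d \<Longrightarrow> graded d f = 0"
proof (rule mser_eqI)
  fix m
  assume "deg_le e f" "int e < d"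
  then have "cf f m = 0" if "int (mdeg m) = d"
    using that by (metis deg_le_def of_nat_le_iff not_le)
  then show "cf (graded d f) m = cf 0 m" by (simp add: graded_def)
qed

lemma graded_neg: "d < 0 \<Longrightarrow> graded d f = 0"
  by (rule mser_eqI) (auto simp: graded_def)

lemma graded_0: "cf f 0 = 1 \<Longrightarrow> graded 0 f = 1"
  by (rule mser_eqI) (auto simp: graded_def cf_1)

section \<open>Vertex operators as series of endomorphisms\<close>

text \<open>By homogeneity the monomial \<open>a\<close> occurs in the power sum of index
  \<open>k\<close> only for \<open>k = mdeg a\<close>. The sums over \<open>k\<close> and over the
  splittings are interchanged, and the one over \<open>k\<close> collapses.\<close>

lemma series_sum_current:
  fixes X :: "'k::field_char_0 alphabet"
  assumes "homog X" "s = 1 \<or> s = - 1"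
  shows "series_sum (\<lambda>k::nat. if k = 0 then (\<lambda>m. 0)
     else series_scale (1 / of_nat k) (series_mult (power_sum k X) (series_current (s * int k) (ev T x))))
     = ev (Hop s (psum X) * T) x"
proof
  fix m
  let ?g = "\<lambda>k a b. if k = 0 then 0 else fock_scale (1 / of_nat k)
    (fock_scale (Poly_Mapping.lookup (power_sum k X) a) (current (s * int k) (app (cf T b) x)))"
  let ?f = "\<lambda>k. \<Sum>(a, b)\<in>splits m. ?g k a b"
  have gz: "?g k a b = 0" if "mdeg a \<noteq> k" for k a b
  proof -
    have "Poly_Mapping.lookup (power_sum k X) a = 0"
      using assms(1) that by (auto simp: homog_def)
    then show ?thesis by (simp add: fock_scale_0_left fock_scale_0_right)
  qed
  have fz: "?f k = 0" if "mdeg m < k" for k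
  proof (rule sum.neutral, clarify)
    fix a b assume "(a, b) \<in> splits m"
    then have "mdeg a \<noteq> k" using that by (auto simp: splits_def)
    then show "?g k a b = 0" by (rule gz)
  qed
  have "series_sum (\<lambda>k::nat. if k = 0 then (\<lambda>m. 0)
     else series_scale (1 / of_nat k) (series_mult (power_sum k X) (series_current (s * int k) (ev T x)))) m
     = Sum_any ?f"
    unfolding series_sum_def
    by (rule Sum_any.cong)
      (simp add: series_scale_def series_mult_def series_current_def ev_def fock_scale_sum case_prod_unfold)
  also have "\<dots> = sum ?f {..mdeg m}"
  proof (rule Sum_any.expand_superset)
    show "{k. ?f k \<noteq> 0} \<subseteq> {..mdeg m}"
    proof
      fix k assume "k \<in> {k. ?f k \<noteq> 0}"
      then have "\<not> mdeg m < k" using fz by blast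
      then show "k \<in> {..mdeg m}" by simp
    qed
  qed simp
  also have "\<dots> = (\<Sum>(a, b)\<in>splits m. \<Sum>k\<le>mdeg m. ?g k a b)"
    by (simp only: case_prod_unfold) (rule sum.swap)
  also have "\<dots> = (\<Sum>(a, b)\<in>splits m. app (cf (Hop s (psum X)) a) (app (cf T b) x))"
  proof (rule sum.cong[OF refl], clarify)
    fix a b assume "(a, b) \<in> splits m"
    then have "mdeg a \<le> mdeg m" by (auto simp: splits_def)
    then have "(\<Sum>k\<le>mdeg m. ?g k a b) = (\<Sum>k\<in>{mdeg a}. ?g k a b)"
      by (intro sum.mono_neutral_right) (use gz in auto)
    also have "\<dots> = app (cf (Hop s (psum X)) a) (app (cf T b) x)"
      using assms(2)
      by (cases "a = 0") (auto simp: Hop_def psum_def app_cur fock_scale_fock_scale)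
    finally show "(\<Sum>k\<le>mdeg m. ?g k a b) = app (cf (Hop s (psum X)) a) (app (cf T b) x)" .
  qed
  also have "\<dots> = ev (Hop s (psum X) * T) x m"
    by (simp add: ev_def cf_mult app_sum_left case_prod_unfold)
  finally show "series_sum (\<lambda>k::nat. if k = 0 then (\<lambda>m. 0)
     else series_scale (1 / of_nat k) (series_mult (power_sum k X) (series_current (s * int k) (ev T x)))) m
     = ev (Hop s (psum X) * T) x m" .
qed

lemma H_ev: "homog X \<Longrightarrow> H X (ev T x) = ev (Hop 1 (psum X) * T) x"
  unfolding H_def using series_sum_current[of X 1 T x] by (simp cong: if_cong)

lemma H_star_ev: "homog X \<Longrightarrow> H_star X (ev T x) = ev (Hop (- 1) (psum X) * T) x"
  unfolding H_star_def using series_sum_current[of X "- 1" T x] by (simp cong: if_cong)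

lemma Hop_uminus: "Hop s (- p) = - Hop s p"
  by (rule mser_eqI) (simp add: Hop_def sc_uminus)

lemma neg_op_ev: "T (ev S x) = ev (F * S) x \<Longrightarrow> neg_op T (ev S x) = ev (- F * S) x"
  by (simp add: neg_op_def series_uminus_def ev_def)

definition Estar :: "'k::field_char_0 mser \<Rightarrow> 'k fend mser" where
  "Estar p = mexp (Hop (- 1) p)"

lemma adj_Estar: "adj (Estar p) (Eop p)"
  unfolding Estar_def Eop_def by (rule adj_mexp[OF adj_Hop])

lemma exp_H_ev: "homog X \<Longrightarrow> exp_op (H X) (ev S x) = ev (Eop (psum X) * S) x"
  unfolding Eop_def by (rule exp_op_ev) (simp_all add: H_ev)

lemma exp_neg_H_ev: "homog X \<Longrightarrow> exp_op (neg_op (H X)) (ev S x) = ev (Eop (- psum X) * S) x"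
  unfolding Eop_def Hop_uminus by (rule exp_op_ev) (simp_all only: H_ev neg_op_ev, simp)

lemma exp_H_star_ev: "homog X \<Longrightarrow> exp_op (H_star X) (ev S x) = ev (Estar (psum X) * S) x"
  unfolding Estar_def by (rule exp_op_ev) (simp_all add: H_star_ev)

lemma exp_neg_H_star_ev:
  "homog X \<Longrightarrow> exp_op (neg_op (H_star X)) (ev S x) = ev (Estar (- psum X) * S) x"
  unfolding Estar_def Hop_uminus by (rule exp_op_ev) (simp_all only: H_star_ev neg_op_ev, simp)

section \<open>Annihilators\<close>

text \<open>The operators with this property form a left ideal; the vacuum expectation is computed
  modulo it.\<close>

definition kills :: "'k::field_char_0 fock \<Rightarrow> 'k fend mser \<Rightarrow> bool" where
  "kills x T \<longleftrightarrow> (\<forall>m. app (cf T m) x = 0)"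

lemma kills_mult: "kills x T \<Longrightarrow> kills x (S * T)"
  by (simp add: kills_def cf_mult app_sum_left case_prod_unfold app_0)

lemma kills_add: "kills x S \<Longrightarrow> kills x T \<Longrightarrow> kills x (S + T)"
  by (simp add: kills_def)

lemma kills_diff: "kills x S \<Longrightarrow> kills x T \<Longrightarrow> kills x (S - T)"
  by (simp add: kills_def)

lemma kills_0: "kills x 0"
  by (simp add: kills_def)

text \<open>Currents of positive degree kill the shifted vacuum, so only the term
  \<open>n = 0\<close> of the exponential contributes.\<close>

lemma kills_Eop: "kills (shifted_vac (- int l)) (Eop p - 1)"
proof -
  have "kills (shifted_vac (- int l)) (Hop 1 p)"
    unfolding kills_def
  proof
    fix m
    show "app (cf (Hop 1 p) m) (shifted_vac (- int l)) = 0"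
      by (cases "m = 0") (simp_all add: Hop_def app_cur current_shifted_vac[OF _] fock_scale_0_right
          flip: mdeg_eq_0_iff)
  qed
  then have "kills (shifted_vac (- int l)) (Hop 1 p ^ Suc n)" for n
    using kills_mult[of _ "Hop 1 p" "Hop 1 p ^ n"] by (simp add: power_commutes)
  then have *: "app (cf (Hop 1 p ^ n) m) (shifted_vac (- int l)) = 0" if "n \<noteq> 0" for n m
    using that by (metis kills_def not0_implies_Suc)
  show ?thesis
    unfolding kills_def
  proof
    fix m
    have "app (cf (Eop p) m) (shifted_vac (- int l)) =
        (\<Sum>n\<in>{0}. app (sc (1 / fact n) * cf (Hop 1 p ^ n) m) (shifted_vac (- int l)))"
      unfolding Eop_def cf_mexp app_sum_left
      by (rule sum.mono_neutral_right) (auto simp: * fock_scale_0_right)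
    then show "app (cf (Eop p - 1) m) (shifted_vac (- int l)) = 0"
      by (simp add: fock_scale_1)
  qed
qed

lemma kills_psi_star_mser: "- int l \<le> n \<Longrightarrow> kills (shifted_vac (- int l)) (psi_star_mser h n)"
  by (simp add: kills_def psi_star_mser_def psi_star_shifted_vac fock_scale_0_right)

section \<open>Products of anticommuting operators\<close>

text \<open>\<open>c\<close> travels to the right until it kills \<open>x\<close>. Passing
  \<open>u j\<close> leaves the central \<open>M j\<close> times the product without
  \<open>c\<close> and \<open>u j\<close>, which the premise disposes of; \<open>ps\<close> collects
  the operators already passed.\<close>

lemma kills_move:
  assumes anticomm: "\<And>j. c * u j = M j - u j * c" and central: "\<And>j T. M j * T = T * M j"
    and c: "kills x c"
  shows "(\<And>ys j zs. js = ys @ j # zs \<Longrightarrow> M j = 0 \<or> kills x (A * prod_list (map u (ps @ ys @ zs))))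
    \<Longrightarrow> kills x (A * prod_list (map u ps) * c * prod_list (map u js))"
proof (induction js arbitrary: ps)
  case Nil
  show ?case using kills_mult[OF c] by simp
next
  case (Cons j js)
  let ?P = "\<lambda>xs. prod_list (map u xs)"
  have "A * ?P ps * c * ?P (j # js) = A * ?P ps * (c * u j) * ?P js"
    by (simp add: mult.assoc)
  also have "\<dots> = M j * (A * ?P (ps @ js)) - A * ?P (ps @ [j]) * c * ?P js"
  proof -
    have "A * ?P ps * M j * ?P js = M j * (A * ?P ps * ?P js)"
      by (simp only: central [symmetric] mult.assoc)
    then show ?thesis
      by (simp add: anticomm right_diff_distrib left_diff_distrib mult.assoc)
  qed
  finally have eq: "A * ?P ps * c * ?P (j # js) = M j * (A * ?P (ps @ js)) - A * ?P (ps @ [j]) * c * ?P js" .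
  have "M j = 0 \<or> kills x (A * ?P (ps @ js))"
    using Cons.prems[of "[]" j js] by simp
  then have 1: "kills x (M j * (A * ?P (ps @ js)))"
    by (auto simp: kills_0 kills_mult)
  have 2: "kills x (A * ?P (ps @ [j]) * c * ?P js)"
  proof (rule Cons.IH)
    fix ys j' zs assume "js = ys @ j' # zs"
    then show "M j' = 0 \<or> kills x (A * ?P ((ps @ [j]) @ ys @ zs))"
      using Cons.prems[of "j # ys" j' zs] by simp
  qed
  show ?case
    unfolding eq by (rule kills_diff[OF 1 2])
qed

text \<open>Wick expansion along the last \<open>c\<close>, in the manner of a determinant. The
  length condition says that the zero block of rows \<open>P\<close> and columns \<open>Q\<close>
  has more rows than there are columns outside it, so every expansion term vanishes.\<close>

lemma kills_zero_block:
  assumes anticomm: "\<And>i j. c i * u j = M i j - u j * c i"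
    and central: "\<And>i j T. M i j * T = T * M i j"
  shows "(\<And>i. i \<in> set is \<Longrightarrow> kills x (c i))
    \<Longrightarrow> (\<And>i j. i \<in> set is \<Longrightarrow> j \<in> set js \<Longrightarrow> P i \<Longrightarrow> Q j \<Longrightarrow> M i j = 0)
    \<Longrightarrow> length (filter (\<lambda>j. \<not> Q j) js) < length (filter P is)
    \<Longrightarrow> kills x (prod_list (map c is) * prod_list (map u js))"
proof (induction "is" arbitrary: js rule: rev_induct)
  case (snoc i "is")
  have "kills x (prod_list (map c is) * prod_list (map u []) * c i * prod_list (map u js))"
  proof (rule kills_move[where M = "M i"])
    fix ys j zs assume js: "js = ys @ j # zs"
    show "M i j = 0 \<or> kills x (prod_list (map c is) * prod_list (map u ([] @ ys @ zs)))"
    proof (cases "P i \<and> Q j")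
      case True
      then show ?thesis using snoc.prems(2) js by simp
    next
      case False
      \<comment> \<open>Outside the block the inequality persists: if \<open>i\<close> is not in
        \<open>P\<close>, the number of block rows stays and that of outer columns does not grow; if
        \<open>j\<close> is not in \<open>Q\<close>, an outer column is lost along with at most one
        row.\<close>
      have "kills x (prod_list (map c is) * prod_list (map u (ys @ zs)))"
        by (rule snoc.IH) (use snoc.prems js False in \<open>auto split: if_splits\<close>)
      then show ?thesis by simp
    qed
  qed (use snoc.prems anticomm central in auto)
  then show ?case by (simp add: mult.assoc)
qed simp

text \<open>The innermost pair \<open>c i * u i\<close> contributes 1 and leaves the shorter
  product. The remaining term vanishes because \<open>c i\<close> anticommutes with all later
  \<open>u j\<close> and reaches \<open>x\<close>.\<close>

lemma kills_unitriangular: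
  assumes anticomm: "\<And>i j. c i * u j = M i j - u j * c i"
    and central: "\<And>i j T. M i j * T = T * M i j"
  shows "(\<And>i. i \<in> set js \<Longrightarrow> kills x (c i)) \<Longrightarrow> (\<And>i. i \<in> set js \<Longrightarrow> M i i = 1)
    \<Longrightarrow> sorted_wrt (\<lambda>i j. M i j = 0) js
    \<Longrightarrow> kills x (prod_list (map c (rev js)) * prod_list (map u js) - 1)"
proof (induction js)
  case Nil
  then show ?case by (simp add: kills_0)
next
  case (Cons i js)
  let ?C = "prod_list (map c (rev js))" and ?U = "prod_list (map u js)"
  have "kills x (1 * prod_list (map u []) * c i * ?U)"
    by (rule kills_move[where M = "M i"]) (use Cons.prems anticomm central in auto)
  then have "kills x (c i * ?U)" by simp
  then have 1: "kills x (?C * u i * (c i * ?U))"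
    by (rule kills_mult)
  have 2: "kills x (?C * ?U - 1)"
    using Cons by simp
  have "prod_list (map c (rev (i # js))) * prod_list (map u (i # js)) - 1 = ?C * (c i * u i) * ?U - 1"
    by (simp add: mult.assoc)
  also have "\<dots> = (?C * ?U - 1) - ?C * u i * (c i * ?U)"
    using Cons.prems(2)[of i] by (simp add: anticomm right_diff_distrib left_diff_distrib mult.assoc)
  finally show ?case
    using kills_diff[OF 2 1] by (simp only:)
qed

section \<open>Partitions\<close>

lemma part_antimono:
  assumes "is_partition lam" "1 \<le> i" "i \<le> j"
  shows "part lam j \<le> part lam i"
proof (cases "j \<le> length lam \<and> i < j")
  case True
  then have "lam ! (i - 1) \<ge> lam ! (j - 1)"
    using assms sorted_wrt_nth_less[of "(\<ge>)" lam "i - 1" "j - 1"] by (auto simp: is_partition_def)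
  then show ?thesis using True assms by (simp add: part_def)
next
  case False
  then show ?thesis using assms by (cases "i = j") (auto simp: part_def)
qed

lemma part_pos_iff: "is_partition lam \<Longrightarrow> 0 < part lam i \<longleftrightarrow> 1 \<le> i \<and> i \<le> length lam"
  by (auto simp: part_def is_partition_def) (metis Suc_le_eq diff_less le_less_trans less_numeral_extra(1)
      not_gr_zero nth_mem One_nat_def Suc_pred)

lemma partition_eqI:
  assumes "is_partition lam" "is_partition mu" "\<And>i. 1 \<le> i \<Longrightarrow> part lam i = part mu i"
  shows "lam = mu"
proof (rule nth_equalityI)
  have "1 \<le> i \<Longrightarrow> i \<le> length lam \<longleftrightarrow> i \<le> length mu" for i
    using part_pos_iff[OF assms(1), of i] part_pos_iff[OF assms(2), of i] assms(3)[of i] by simp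
  from this[of "length lam"] this[of "length mu"] show len: "length lam = length mu"
    by linarith
  fix i assume "i < length lam"
  then show "lam ! i = mu ! i"
    using assms(3)[of "Suc i"] len by (simp add: part_def)
qed

section \<open>The bras and kets\<close>

definition pA :: "nat \<Rightarrow> 'k::field_char_0 mser" where
  "pA k = psum (A_alph (int k))"

text \<open>Both products are later extended to a common length; beyond the original
  \<open>l\<close> the factors carry no beta exponential.\<close>

definition pB :: "nat \<Rightarrow> nat \<Rightarrow> 'k::field_char_0 mser" where
  "pB l i = (if i \<le> l then psum (B_alph i) else 0)"

definition ket_factor :: "nat \<Rightarrow> nat list \<Rightarrow> nat \<Rightarrow> 'k::field_char_0 fend mser" where
  "ket_factor l lam i = Eop (- pA (part lam i - 1)) * cst (fop (psi (int (part lam i) - int i)))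
     * Eop (pB l i) * Eop (pA (part lam i - 1))"

text \<open>The adjoint of an upper factor: the order is reversed, and \<open>psi\<close> and the
  negative currents become \<open>psi_star\<close> and the positive ones.\<close>

definition bra_factor :: "nat \<Rightarrow> nat list \<Rightarrow> nat \<Rightarrow> 'k::field_char_0 fend mser" where
  "bra_factor n mu i = Eop (- pA (part mu i)) * Eop (- pB n i)
     * cst (fop (psi_star (int (part mu i) - int i))) * Eop (pA (part mu i))"

lemma A_alph_nonpos: "k \<le> 0 \<Longrightarrow> A_alph k = 0"
  by (simp add: A_alph_def)

lemma pA_0: "pA 0 = 0"
  by (simp add: pA_def A_alph_nonpos psum_0)

text \<open>At \<open>n = 0\<close> truncated subtraction gives index 0 in place of -1; both
  alphabets are empty.\<close>

lemma pA_int: "pA (n - 1) = psum (A_alph (int n - 1))"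
  by (cases n) (simp_all add: pA_def A_alph_nonpos)

lemma upt_append: "a \<le> b \<Longrightarrow> b \<le> c \<Longrightarrow> [a..<c] = [a..<b] @ [b..<c]"
  by (metis upt_add_eq_append le_add_diff_inverse)

text \<open>The higher vacuum is refilled from the lower one by bare fermions, so bra and ket can be
  based at the same vacuum.\<close>

lemma ev_shifted_vac:
  "l \<le> L \<Longrightarrow> ev S (shifted_vac (- int l)) =
    ev (S * prod_list (map (\<lambda>i. cst (fop (psi (- int i)))) [Suc l..<Suc L])) (shifted_vac (- int L))"
proof (induction L rule: dec_induct)
  case base
  then show ?case by simp
next
  case (step L)
  have "ev T (shifted_vac (- int L)) = ev (T * cst (fop (psi (- int (Suc L))))) (shifted_vac (- int (Suc L)))"
    for T :: "'a fend mser"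
    unfolding ev_def by (simp only: cf_mult_cst app_simps app_fop psi_shifted_vac)
  then show ?case
    using step by (simp add: mult.assoc)
qed

lemma lower_factor_ev:
  "i \<le> l \<Longrightarrow> lower_factor lam i (ev S x) = ev (ket_factor l lam i * S) x"
  by (simp add: lower_factor_def ket_factor_def exp_H_ev exp_neg_H_ev homog_A_alph homog_B_alph
      series_act_ev pA_int [unfolded One_nat_def] pB_def mult.assoc)

lemma foldr_ev:
  assumes "\<And>i S. i \<in> set is \<Longrightarrow> f i (ev S x) = ev (F i * S) x"
  shows "foldr f is (ev S x) = ev (prod_list (map F is) * S) x"
  using assms by (induction "is") (simp_all add: mult.assoc)

text \<open>The bare fermions of index \<open>- i\<close> added for \<open>l < i\<close> have the
  shape of further ket factors, with part 0 and no exponentials.\<close>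

lemma ket_lower_ev:
  assumes "length lam \<le> l" "l \<le> L"
  shows "(ket_lower l lam :: 'k::field_char_0 fock pseries) =
    ev (prod_list (map (ket_factor l lam) [1..<Suc L])) (shifted_vac (- int L))"
proof -
  have "(ket_lower l lam :: 'k fock pseries) = ev (prod_list (map (ket_factor l lam) [1..<Suc l])) (shifted_vac (- int l))"
    unfolding ket_lower_def series_of_ev
    by (subst foldr_ev[where F = "ket_factor l lam"]) (auto simp: lower_factor_ev)
  also have "\<dots> = ev (prod_list (map (ket_factor l lam) [1..<Suc l]) *
      prod_list (map (ket_factor l lam) [Suc l..<Suc L])) (shifted_vac (- int L))"
  proof -
    have "map (ket_factor l lam) [Suc l..<Suc L] =
        (map (\<lambda>i. cst (fop (psi (- int i)))) [Suc l..<Suc L] :: 'k fend mser list)"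
    proof (rule map_cong[OF refl])
      fix i assume "i \<in> set [Suc l..<Suc L]"
      then have "part lam i = 0" "\<not> i \<le> l" using assms by (auto simp: part_def)
      then show "ket_factor l lam i = (cst (fop (psi (- int i))) :: 'k fend mser)"
        by (simp add: ket_factor_def pA_0 pB_def Eop_0)
    qed
    then show ?thesis by (simp only: ev_shifted_vac[OF assms(2)])
  qed
  also have "prod_list (map (ket_factor l lam) [1..<Suc l]) * prod_list (map (ket_factor l lam) [Suc l..<Suc L])
      = prod_list (map (ket_factor l lam) [1..<Suc L])"
    using upt_append[of 1 "Suc l" "Suc L"] assms by simp
  finally show ?thesis .
qed

definition upper_factor_op :: "nat list \<Rightarrow> nat \<Rightarrow> 'k::field_char_0 fend mser" where
  "upper_factor_op mu i = Estar (pA (part mu i)) * (cst (fop (psi (int (part mu i) - int i)))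
     * (Estar (- psum (B_alph i)) * Estar (- pA (part mu i))))"

lemma upper_factor_ev: "upper_factor mu i (ev S x) = ev (upper_factor_op mu i * S) x"
  by (simp add: upper_factor_def upper_factor_op_def exp_H_star_ev exp_neg_H_star_ev homog_A_alph
      homog_B_alph series_act_ev pA_def mult.assoc)

lemma adj_upper_factor: "i \<le> n \<Longrightarrow> adj (upper_factor_op mu i) (bra_factor n mu i)"
proof -
  assume "i \<le> n"
  have "adj (upper_factor_op mu i) (((Eop (- pA (part mu i)) * Eop (- psum (B_alph i)))
     * cst (fop (star (psi (int (part mu i) - int i))))) * Eop (pA (part mu i)))"
    unfolding upper_factor_op_def by (intro adj_mult adj_Estar adj_fop)
  then show ?thesis
    using \<open>i \<le> n\<close> by (simp add: bra_factor_def pB_def star_psi)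
qed

lemma adj_prod_list:
  "(\<And>i. i \<in> set is \<Longrightarrow> adj (f i) (g i)) \<Longrightarrow> adj (prod_list (map f is)) (prod_list (map g (rev is)))"
  by (induction "is") (auto intro: adj_mult simp: adj_1)

lemma ket_upper_ev:
  assumes "length mu < n" "n \<le> L"
  obtains S where "ket_upper n mu = ev S (shifted_vac (- int L))"
    and "adj S (prod_list (map (bra_factor n mu) (rev [1..<Suc L])))"
proof -
  let ?P = "prod_list (map (\<lambda>i. cst (fop (psi (- int i)))) [Suc n..<Suc L]) :: 'a fend mser"
  let ?S = "prod_list (map (upper_factor_op mu) [1..<Suc n]) * Estar (pA (part mu n)) :: 'a fend mser"
  have 1: "ket_upper n mu = ev (?S * ?P) (shifted_vac (- int L))"
    unfolding ket_upper_def series_of_ev exp_H_star_ev[OF homog_A_alph]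
    by (subst foldr_ev[where F = "upper_factor_op mu"])
      (simp_all add: upper_factor_ev ev_shifted_vac[OF assms(2)] pA_def mult.assoc del: upt_Suc)
  have "adj ?P (prod_list (map (\<lambda>i. cst (fop (psi_star (- int i)))) (rev [Suc n..<Suc L])))"
    by (rule adj_prod_list) (metis adj_fop star_psi)
  also have "map (\<lambda>i. cst (fop (psi_star (- int i)))) (rev [Suc n..<Suc L]) =
      (map (bra_factor n mu) (rev [Suc n..<Suc L]) :: 'a fend mser list)"
  proof (rule map_cong[OF refl])
    fix i assume "i \<in> set (rev [Suc n..<Suc L])"
    then have "part mu i = 0" "\<not> i \<le> n" using assms by (auto simp: part_def)
    then show "cst (fop (psi_star (- int i))) = (bra_factor n mu i :: 'a fend mser)"
      by (simp add: bra_factor_def pA_0 pB_def Eop_0)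
  qed
  finally have P: "adj ?P (prod_list (map (bra_factor n mu) (rev [Suc n..<Suc L])))" .
  have Q: "adj (prod_list (map (upper_factor_op mu) [1..<Suc n]))
      (prod_list (map (bra_factor n mu) (rev [1..<Suc n])) :: 'a fend mser)"
    by (rule adj_prod_list) (auto intro: adj_upper_factor)
  \<comment> \<open>The strict bound \<open>length mu < n\<close> enters here: the rightmost
    exponential has an empty alphabet.\<close>
  have "part mu n = 0" using assms by (simp add: part_def)
  then have "adj (Estar (pA (part mu n))) (1 :: 'a fend mser)"
    using adj_Estar[of "0 :: 'a mser"] by (simp add: pA_0 Eop_0)
  then have "adj (?S * ?P) (prod_list (map (bra_factor n mu) (rev [Suc n..<Suc L])) *
      (1 * prod_list (map (bra_factor n mu) (rev [1..<Suc n]))))"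
    by (intro adj_mult P Q)
  moreover have "[1..<Suc L] = [1..<Suc n] @ [Suc n..<Suc L]"
    using upt_append[of 1 "Suc n" "Suc L"] assms by simp
  ultimately have "adj (?S * ?P) (prod_list (map (bra_factor n mu) (rev [1..<Suc L])))"
    by (simp del: upt_Suc)
  with 1 show ?thesis by (rule that)
qed

section \<open>Pulling the exponentials out\<close>

text \<open>The beta exponents accumulated from the factors before \<open>i\<close>, capped because
  only the first \<open>l\<close> factors have one.\<close>

definition pBs :: "nat \<Rightarrow> nat \<Rightarrow> 'k::field_char_0 mser" where
  "pBs l i = (\<Sum>k\<in>{1..<min i (Suc l)}. psum (B_alph k))"

lemma pBs_Suc: "1 \<le> i \<Longrightarrow> pBs l (Suc i) = pBs l i + pB l i"
proof (cases "i \<le> l")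
  case True
  assume "1 \<le> i"
  with True show ?thesis by (simp add: pBs_def pB_def min_def)
next
  case False
  then have "min (Suc i) (Suc l) = Suc l" "min i (Suc l) = Suc l" by auto
  with False show ?thesis by (simp add: pBs_def pB_def)
qed

text \<open>The complete homogeneous series of the alphabet by which \<open>psi\<close> is
  conjugated. The letters -\<alpha>_k enter with negative multiplicity, so they give polynomial
  factors 1 + \<alpha>_k.\<close>

definition ket_coeff :: "nat \<Rightarrow> nat list \<Rightarrow> nat \<Rightarrow> 'k::field_char_0 mser" where
  "ket_coeff l lam i = (\<Prod>k\<in>{1..<min i (Suc l)}. geo 1 (Beta k)) *
     (\<Prod>k\<in>{1..part lam i - 1}. 1 - mvar (- 1) (Alpha k))"

definition bra_coeff :: "nat \<Rightarrow> nat list \<Rightarrow> nat \<Rightarrow> 'k::field_char_0 mser" where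
  "bra_coeff n mu i = (\<Prod>k\<in>{1..<min i (Suc n)}. 1 - mvar 1 (Beta k)) *
     (\<Prod>k\<in>{1..part mu i}. geo (- 1) (Alpha k))"

lemma pA_eq: "pA k = (\<Sum>i\<in>{1..k}. psum (letter (lin (- 1) (Alpha i))))"
  by (simp add: pA_def A_alph_lin psum_sum)

lemma newton_ket_coeff: "newton (pBs l i - pA (part lam i - 1)) (ket_coeff l lam i)"
proof -
  have "newton (pBs l i + (\<Sum>k\<in>{1..part lam i - 1}. - psum (letter (lin (- 1) (Alpha k))))) (ket_coeff l lam i)"
    unfolding ket_coeff_def pBs_def B_alph_lin
    by (intro newton_mult newton_prod newton_lin newton_lin_inv) simp_all
  then show ?thesis by (simp add: pA_eq sum_negf)
qed

lemma newton_bra_coeff: "newton (- (pBs n i - pA (part mu i))) (bra_coeff n mu i)"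
proof -
  have "newton ((\<Sum>k\<in>{1..<min i (Suc n)}. - psum (B_alph k)) + pA (part mu i)) (bra_coeff n mu i)"
    unfolding bra_coeff_def B_alph_lin pA_eq
    by (intro newton_mult newton_prod newton_lin newton_lin_inv) simp_all
  then show ?thesis by (simp add: pBs_def sum_negf)
qed

definition ket_op :: "nat \<Rightarrow> nat list \<Rightarrow> nat \<Rightarrow> 'k::field_char_0 fend mser" where
  "ket_op l lam i = psi_mser (ket_coeff l lam i) (int (part lam i) - int i)"

definition bra_op :: "nat \<Rightarrow> nat list \<Rightarrow> nat \<Rightarrow> 'k::field_char_0 fend mser" where
  "bra_op n mu i = psi_star_mser (bra_coeff n mu i) (int (part mu i) - int i)"

text \<open>Moving the exponentials to the right of \<open>psi\<close> cancels those of the alpha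
  alphabets and adds the beta alphabet of index \<open>i\<close> to the accumulated ones.\<close>

lemma ket_factor_step:
  assumes "1 \<le> i"
  shows "Eop (pBs l i) * ket_factor l lam i = ket_op l lam i * Eop (pBs l (Suc i))"
proof -
  let ?a = "pA (part lam i - 1) :: 'a mser" and ?psi = "cst (fop (psi (int (part lam i) - int i)))"
  have "Eop (pBs l i) * ket_factor l lam i = (Eop (pBs l i) * Eop (- ?a)) * ?psi * (Eop (pB l i) * Eop ?a)"
    by (simp add: ket_factor_def mult.assoc)
  also have "\<dots> = (Eop (pBs l i - ?a) * ?psi) * Eop (pB l i + ?a)"
    by (simp add: Eop_mult)
  also have "\<dots> = ket_op l lam i * (Eop (pBs l i - ?a) * Eop (pB l i + ?a))"
    unfolding Eop_psi[OF newton_ket_coeff] by (simp only: ket_op_def mult.assoc)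
  also have "Eop (pBs l i - ?a) * Eop (pB l i + ?a) = Eop (pBs l (Suc i))"
    using assms by (simp add: Eop_mult pBs_Suc algebra_simps)
  finally show ?thesis .
qed

lemma bra_factor_step:
  assumes "1 \<le> i"
  shows "bra_factor n mu i * Eop (- pBs n i) = Eop (- pBs n (Suc i)) * bra_op n mu i"
proof -
  let ?a = "pA (part mu i) :: 'a mser" and ?psi = "cst (fop (psi_star (int (part mu i) - int i)))"
  let ?q = "pBs n i - ?a"
  have inv: "Eop ?q * Eop (- ?q) = 1" "Eop (- ?q) * Eop ?q = 1"
    by (simp_all add: Eop_mult Eop_0)
  have "bra_factor n mu i * Eop (- pBs n i) = Eop (- ?a) * Eop (- pB n i) * ?psi * (Eop ?a * Eop (- pBs n i))"
    by (simp add: bra_factor_def mult.assoc)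
  also have "\<dots> = Eop (- ?a - pB n i) * (?psi * Eop (- ?q))"
    by (simp add: Eop_mult mult.assoc)
  \<comment> \<open>Here the exponential has to move to the left, so the commutation rule is applied
    to the inverse exponential inserted in front of the fermion.\<close>
  also have "?psi * Eop (- ?q) = Eop (- ?q) * (Eop ?q * ?psi) * Eop (- ?q)"
    by (simp only: mult.assoc [symmetric] inv mult_1_left)
  also have "\<dots> = Eop (- ?q) * bra_op n mu i"
    by (simp only: Eop_psi_star[OF newton_bra_coeff] mult.assoc inv mult_1_right bra_op_def)
  also have "Eop (- ?a - pB n i) * (Eop (- ?q) * bra_op n mu i) = Eop (- pBs n (Suc i)) * bra_op n mu i"
  proof -
    have "- ?a - pB n i + - ?q = - pBs n (Suc i)"
      using assms by (simp add: pBs_Suc)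
    then show ?thesis
      by (simp only: mult.assoc [symmetric] Eop_mult)
  qed
  finally show ?thesis .
qed

lemma ket_factors:
  "prod_list (map (ket_factor l lam) [1..<Suc i]) =
     prod_list (map (ket_op l lam) [1..<Suc i]) * Eop (pBs l (Suc i))"
proof (induction i)
  case 0
  then show ?case by (simp add: pBs_def Eop_0)
next
  case (Suc i)
  have "[1..<Suc (Suc i)] = [1..<Suc i] @ [Suc i]" by simp
  then show ?case
    using Suc by (simp add: mult.assoc ket_factor_step del: upt_Suc)
qed

lemma bra_factors:
  "(prod_list (map (bra_factor n mu) (rev [1..<Suc i])) :: 'k::field_char_0 fend mser) =
     Eop (- pBs n (Suc i)) * prod_list (map (bra_op n mu) (rev [1..<Suc i]))"
proof (induction i)
  case 0
  then show ?case by (simp add: pBs_def Eop_0)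
next
  case (Suc i)
  have "[1..<Suc (Suc i)] = [1..<Suc i] @ [Suc i]" by simp
  then show ?case
    using Suc bra_factor_step[of "Suc i" n mu, where 'a = 'k]
    by (simp add: mult.assoc [symmetric] del: upt_Suc)
qed

section \<open>The matrix of anticommutators\<close>

definition bk :: "nat \<Rightarrow> nat list \<Rightarrow> nat \<Rightarrow> nat list \<Rightarrow> nat \<Rightarrow> nat \<Rightarrow> 'k::field_char_0 fend mser" where
  "bk n mu l lam i j = graded (int (part lam j) - int j - (int (part mu i) - int i))
     (bra_coeff n mu i * ket_coeff l lam j)"

lemma bra_op_ket_op: "bra_op n mu i * ket_op l lam j = bk n mu l lam i j - ket_op l lam j * bra_op n mu i"
  by (simp add: bra_op_def ket_op_def bk_def psi_star_psi_mser)

lemma bk_commute: "bk n mu l lam i j * T = T * bk n mu l lam i j"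
  unfolding bk_def by (rule graded_commute)

lemma prod_geo_cancel:
  fixes i j :: nat
  assumes "1 \<le> j" "j \<le> i"
  shows "(\<Prod>k\<in>{1..<i}. 1 - mvar c (p k)) * (\<Prod>k\<in>{1..<j}. geo c (p k)) = (\<Prod>k\<in>{j..<i}. 1 - mvar c (p k))"
proof -
  let ?u = "\<lambda>k. 1 - mvar c (p k)"
  have one: "prod ?u {1..<j} * (\<Prod>k\<in>{1..<j}. geo c (p k)) = 1"
    by (simp add: prod.distrib [symmetric] geo_mult mult.commute[of "1 - _"])
  have "prod ?u {1..<i} * (\<Prod>k\<in>{1..<j}. geo c (p k)) =
      (prod ?u {1..<j} * (\<Prod>k\<in>{1..<j}. geo c (p k))) * prod ?u {j..<i}"
    by (simp only: prod.atLeastLessThan_concat[OF assms, of ?u, symmetric] ac_simps)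
  then show ?thesis
    by (simp only: one mult_1_left)
qed

text \<open>The bounds on \<open>j\<close> let all inverse factors cancel. What is left has degree
  at most (i - j) + (\<open>part lam j - part mu i\<close> - 1), one less than the degree
  required.\<close>

lemma bk_eq_0_below:
  assumes "1 \<le> j" "j \<le> i" "j \<le> Suc n" "j \<le> Suc l" "part mu i < part lam j"
  shows "bk n mu l lam i j = 0"
proof -
  let ?i = "min i (Suc n)" and ?m = "part mu i" and ?l = "part lam j"
  have "bra_coeff n mu i * ket_coeff l lam j =
      ((\<Prod>k\<in>{1..<?i}. 1 - mvar 1 (Beta k)) * (\<Prod>k\<in>{1..<j}. geo 1 (Beta k))) *
      ((\<Prod>k\<in>{1..<?l}. 1 - mvar (- 1) (Alpha k)) * (\<Prod>k\<in>{1..<Suc ?m}. geo (- 1) (Alpha k)))"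
  proof -
    have "{1..?l - 1} = {1..<?l}" "{1..?m} = {1..<Suc ?m}" "min j (Suc l) = j"
      using assms by auto
    then show ?thesis
      by (simp only: bra_coeff_def ket_coeff_def ac_simps)
  qed
  also have "\<dots> = (\<Prod>k\<in>{j..<?i}. 1 - mvar 1 (Beta k)) * (\<Prod>k\<in>{Suc ?m..<?l}. 1 - mvar (- 1) (Alpha k))"
    using assms by (subst (1 2) prod_geo_cancel) auto
  finally have eq: "bra_coeff n mu i * ket_coeff l lam j =
      (\<Prod>k\<in>{j..<?i}. 1 - mvar 1 (Beta k)) * (\<Prod>k\<in>{Suc ?m..<?l}. 1 - mvar (- 1) (Alpha k))" .
  have "deg_le (card {j..<?i} + card {Suc ?m..<?l}) (bra_coeff n mu i * ket_coeff l lam j)"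
    unfolding eq by (intro deg_le_mult deg_le_prod deg_le_lin) simp_all
  moreover have "int (card {j..<?i} + card {Suc ?m..<?l}) < int ?l - int j - (int ?m - int i)"
    using assms by (simp add: min_def)
  ultimately show ?thesis
    unfolding bk_def by (rule graded_eq_0)
qed

text \<open>The required degree is the sum of the integer differences
  \<open>part lam j - part mu i\<close> and \<open>i - j\<close>, both nonpositive and one of them
  negative.\<close>

lemma bk_eq_0_above:
  assumes "i \<le> j" "part lam j \<le> part mu i" "i < j \<or> part lam j < part mu i"
  shows "bk n mu l lam i j = 0"
  unfolding bk_def by (rule graded_neg) (use assms in linarith)

lemma bk_diag: "part lam i = part mu i \<Longrightarrow> bk n mu l lam i i = (1 :: 'k::field_char_0 fend mser)"
  using newton_ket_coeff[of l i lam, where 'a = 'k] newton_bra_coeff[of n i mu, where 'a = 'k]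
  by (simp add: bk_def graded_0 newton_def)

lemma kills_bra_op: "i \<le> L \<Longrightarrow> kills (shifted_vac (- int L)) (bra_op n mu i)"
  unfolding bra_op_def by (rule kills_psi_star_mser) simp

lemma length_filter_upt: "length (filter P [1..<Suc L]) = card {i \<in> {1..L}. P i}"
  by (subst distinct_card[symmetric]) (auto intro: arg_cong[of _ _ card])

lemma bra_ket_ops:
  fixes lam mu :: "nat list"
  assumes lam: "is_partition lam" and mu: "is_partition mu"
    and l: "length lam \<le> l" "l \<le> L" and n: "length mu \<le> n" "n \<le> L"
  shows "kills (shifted_vac (- int L))
    (prod_list (map (bra_op n mu) (rev [1..<Suc L])) * prod_list (map (ket_op l lam) [1..<Suc L])
      - (of_bool (lam = mu) :: 'k::field_char_0 fend mser))"
proof (cases "lam = mu")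
  case True
  have "kills (shifted_vac (- int L))
    (prod_list (map (bra_op n mu) (rev [1..<Suc L])) * prod_list (map (ket_op l lam) [1..<Suc L])
      - (1 :: 'k fend mser))"
  proof (rule kills_unitriangular[OF bra_op_ket_op bk_commute])
    \<comment> \<open>For \<open>i < j\<close> the parts weakly decrease, so the required degree is
      negative.\<close>
    show "sorted_wrt (\<lambda>i j. bk n mu l lam i j = (0 :: 'k fend mser)) [1..<Suc L]"
      by (rule sorted_wrt_mono_rel[OF _ sorted_wrt_upt])
        (use True mu part_antimono[OF mu] in \<open>auto intro!: bk_eq_0_above\<close>)
  qed (use True in \<open>auto intro: kills_bra_op bk_diag\<close>)
  then show ?thesis using True by simp
next
  case False
  \<comment> \<open>The first index where the partitions differ is the corner of the zero
    block.\<close>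
  define d where "d = (LEAST i. 1 \<le> i \<and> part lam i \<noteq> part mu i)"
  have ex: "\<exists>i. 1 \<le> i \<and> part lam i \<noteq> part mu i"
    using False partition_eqI[OF lam mu] by blast
  have d: "1 \<le> d" "part lam d \<noteq> part mu d"
    using LeastI_ex[OF ex] by (auto simp: d_def)
  have least: "part lam i = part mu i" if "1 \<le> i" "i < d" for i
    using not_less_Least[of i "\<lambda>i. 1 \<le> i \<and> part lam i \<noteq> part mu i"] that by (auto simp: d_def)
  have dL: "d \<le> L"
    using d l n by (auto simp: part_def split: if_splits)
  have "kills (shifted_vac (- int L))
    (prod_list (map (bra_op n mu) (rev [1..<Suc L])) * prod_list (map (ket_op l lam) [1..<Suc L])
      :: 'k fend mser)"
  proof (cases "part mu d < part lam d")
    case True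
    \<comment> \<open>The bra must supply the beta factors of all indices below \<open>d\<close> for
      the cancellation. Otherwise the partitions would agree at \<open>Suc n\<close>, where
      \<open>mu\<close> has part 0, and \<open>part lam d\<close> would be 0.\<close>
    have "d \<le> Suc n"
    proof (rule ccontr)
      assume "\<not> d \<le> Suc n"
      then have "part lam (Suc n) = part mu (Suc n)" by (intro least) auto
      also have "\<dots> = 0" using n by (simp add: part_def)
      finally have "part lam d = 0"
        using part_antimono[OF lam, of "Suc n" d] \<open>\<not> d \<le> Suc n\<close> by simp
      then show False using True by simp
    qed
    have "0 < part lam d" using True by simp
    then have "d \<le> l" using part_pos_iff[OF lam, of d] l by simp
    \<comment> \<open>L - d + 1 rows and d columns make one more than the size L of the
      matrix.\<close>
    show ?thesis
    proof (rule kills_zero_block[OF bra_op_ket_op bk_commute, where P = "\<lambda>i. d \<le> i" and Q = "\<lambda>j. j \<le> d"])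
      fix i j assume ij: "i \<in> set (rev [1..<Suc L])" "j \<in> set [1..<Suc L]" "d \<le> i" "j \<le> d"
      have "part mu i \<le> part mu d" "part lam d \<le> part lam j"
        using ij d by (auto intro!: part_antimono lam mu)
      then show "bk n mu l lam i j = (0 :: 'k fend mser)"
        using ij True \<open>d \<le> Suc n\<close> \<open>d \<le> l\<close> by (intro bk_eq_0_below) auto
    next
      have "{i \<in> {1..L}. \<not> i \<le> d} = {Suc d..L}" "{i \<in> {1..L}. d \<le> i} = {d..L}"
        using d by auto
      then show "length (filter (\<lambda>j. \<not> j \<le> d) [1..<Suc L]) < length (filter (\<lambda>i. d \<le> i) (rev [1..<Suc L]))"
        using dL by (simp only: rev_filter [symmetric] length_rev length_filter_upt) simp
    qed (auto intro: kills_bra_op)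
  next
    case False
    then have less: "part lam d < part mu d" using d by simp
    \<comment> \<open>The transposed block, with d rows and L - d + 1 columns.\<close>
    show ?thesis
    proof (rule kills_zero_block[OF bra_op_ket_op bk_commute, where P = "\<lambda>i. i \<le> d" and Q = "\<lambda>j. d \<le> j"])
      fix i j assume ij: "i \<in> set (rev [1..<Suc L])" "j \<in> set [1..<Suc L]" "i \<le> d" "d \<le> j"
      have "part mu d \<le> part mu i" "part lam j \<le> part lam d"
        using ij d by (auto intro!: part_antimono lam mu)
      then show "bk n mu l lam i j = (0 :: 'k fend mser)"
        using ij less by (intro bk_eq_0_above) auto
    next
      have "{i \<in> {1..L}. \<not> d \<le> i} = {1..<d}" "{i \<in> {1..L}. i \<le> d} = {1..d}"
        using dL by auto
      then show "length (filter (\<lambda>j. \<not> d \<le> j) [1..<Suc L]) < length (filter (\<lambda>i. i \<le> d) (rev [1..<Suc L]))"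
        using d by (simp only: rev_filter [symmetric] length_rev length_filter_upt) simp
    qed (auto intro: kills_bra_op)
  qed
  then show ?thesis using False by simp
qed

lemma bra_ket:
  fixes lam mu :: "nat list"
  assumes lam: "is_partition lam" and mu: "is_partition mu" and "length lam \<le> l" "length mu < n"
  shows "series_pairing (bra_lower n mu) (ket_lower l lam) =
    (series_of (if lam = mu then 1 else 0) :: 'k::field_char_0 pseries)"
proof -
  \<comment> \<open>A common length for the products of the bra and the ket.\<close>
  define L where "L = max l n"
  let ?v = "shifted_vac (- int L) :: 'k fock"
  obtain S :: "'k fend mser" where S: "ket_upper n mu = ev S ?v"
      "adj S (prod_list (map (bra_factor n mu) (rev [1..<Suc L])))"
    using ket_upper_ev[of mu n L] assms by (auto simp: L_def)
  define B K where "B = (prod_list (map (bra_op n mu) (rev [1..<Suc L])) :: 'k fend mser)"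
    and "K = (prod_list (map (ket_op l lam) [1..<Suc L]) :: 'k fend mser)"
  let ?E = "Eop (- pBs n (Suc L)) :: 'k fend mser" and ?F = "Eop (pBs l (Suc L)) :: 'k fend mser"
  have "kills ?v (B * K - of_bool (lam = mu))"
    unfolding B_def K_def using assms by (intro bra_ket_ops) (auto simp: L_def)
  \<comment> \<open>On the vacuum \<open>?F\<close> becomes 1, then \<open>B * K\<close> becomes a
    scalar, whereupon \<open>?E\<close> stands next to the vacuum and becomes 1 too; the summands
    are the three errors.\<close>
  then have "kills ?v (?E * (B * K - of_bool (lam = mu)) + (?E * (B * K) * (?F - 1)
      + of_bool (lam = mu) * (?E - 1)))"
    by (intro kills_add kills_mult kills_Eop)
  also have "?E * (B * K - of_bool (lam = mu)) + (?E * (B * K) * (?F - 1) + of_bool (lam = mu) * (?E - 1)) =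
      (?E * B) * (K * ?F) - of_bool (lam = mu)"
    by (cases "lam = mu") (simp_all add: algebra_simps)
  finally have T: "app (cf ((?E * B) * (K * ?F)) m) ?v = app (cf (of_bool (lam = mu)) m) ?v" for m
    by (simp add: kills_def)
  have "l \<le> L" by (simp add: L_def)
  then have ket: "ket_lower l lam = ev (K * ?F) ?v"
    using ket_lower_ev[OF assms(3)] by (simp only: ket_factors K_def)
  have bra: "adj S (?E * B)"
    using S(2) unfolding bra_factors B_def .
  have "series_pairing (bra_lower n mu) (ket_lower l lam) = (\<lambda>m. bilin ?v (app (cf ((?E * B) * (K * ?F)) m) ?v))"
    unfolding bra_lower_def S(1) ket by (rule series_pairing_ev[OF bra])
  also have "\<dots> = series_of (if lam = mu then 1 else 0)"
    unfolding T by (rule ext) (simp add: series_of_def cf_1 bilin_shifted_vac bilin_0_right)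
  finally show ?thesis .
qed

theorem theorem3p10:
  fixes lam mu :: "nat list" and l l' m m' :: nat
  assumes "is_partition lam" and "is_partition mu"
    and "length lam \<le> l" and "length mu \<le> l'"
    and "length lam < m" and "length mu < m'"
  shows "series_pairing (bra_lower m' mu) (ket_lower l lam)
           = (series_of (if lam = mu then 1 else 0) :: 'k::field_char_0 pseries)
       \<and> series_pairing (bra_upper l' mu) (ket_upper m lam)
           = (series_of (if lam = mu then 1 else 0) :: 'k::field_char_0 pseries)"
proof
  show "series_pairing (bra_lower m' mu) (ket_lower l lam)
      = (series_of (if lam = mu then 1 else 0) :: 'k pseries)"
    using assms by (intro bra_ket)
  have "series_pairing (bra_upper l' mu) (ket_upper m lam)
      = (series_pairing (bra_lower m lam) (ket_lower l' mu) :: 'k pseries)"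
    unfolding bra_upper_def bra_lower_def by (rule series_pairing_sym)
  also have "\<dots> = series_of (if mu = lam then 1 else 0)"
    using assms by (intro bra_ket)
  finally show "series_pairing (bra_upper l' mu) (ket_upper m lam)
      = (series_of (if lam = mu then 1 else 0) :: 'k pseries)"
    by (simp add: eq_commute)
qed

end
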